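(* For each $t\in[0,T]$ let $\varphi^t:H\to(-\infty,\infty]$ be a proper lower-semicontinuous convex functional, suppose that conditions (A1) and (A2) (stated in the context) hold, and let $u_0\in D(\varphi^0)$. Then there exists a constant $c\in[0,\infty)$ such that the following holds for every nonnegative and nonincreasing function $k\in W^{1,1}(0,T)$ and every $u,g\in L^2(0,T;H)$ such that $\varphi^\bullet(u(\bullet))\in L^1(0,T)$, $u(t)\in D(\partial\varphi^t)$ and $g(t)\in\partial\varphi^t(u(t))$ for a.e. $t\in(0,T)$ (that is, $c$ is independent of $u$, $g$ and $k$). For all $\varepsilon\in(0,1)$, $$\begin{aligned}\bigl(\partial_t[k*(u-u_0)](t),g(t)\bigr)_H\ \ge\ &\partial_t\bigl[k*\varphi^\bullet(u(\bullet))\bigr](t)-k(t)\varphi^0(u_0)-\varepsilon c\|k\|_{L^1(0,T)}\|g(t)\|_H^2\\&-\frac c\varepsilon\|k\|_{L^1(0,T)}\bigl(1+|\varphi^0(u_0)|\bigr)-\frac c\varepsilon\int_0^t\bigl(-sk'(s)\bigr)\,|\varphi^{t-s}(u(t-s))|\,ds\end{aligned}$$ for a.e. $t\in(0,T)$, and moreover $$\begin{aligned}\int_0^t\bigl(\partial_t[k*(u-u_0)](s),g(s)\bigr)_H\,ds\ \ge\ &\bigl[k*\varphi^\bullet(u(\bullet))\bigr](t)-\varphi^0(u_0)\int_0^tk(s)\,ds-\varepsilon c\|k\|_{L^1(0,T)}\int_0^t\|g(s)\|_H^2\,ds\\&-\frac c\varepsilon\,t\,\|k\|_{L^1(0,T)}\bigl(1+|\varphi^0(u_0)|\bigr)-\frac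 c\varepsilon\|k\|_{L^1(0,T)}\int_0^t|\varphi^s(u(s))|\,ds\end{aligned}$$ for all $t\in(0,T]$.
   Context: $T\in(0,\infty)$ is fixed and $H$ is a real Hilbert space with inner product $(\cdot,\cdot)_H$ and norm $\|\cdot\|_H$. Proper means $\varphi^t\not\equiv\infty$. $D(\varphi^t)=\{w\in H:\varphi^t(w)<\infty\}$; the subdifferential is $\partial\varphi^t(z)=\{\xi\in H:\varphi^t(v)-\varphi^t(z)\ge(\xi,v-z)_H\ \text{for all }v\in D(\varphi^t)\}$ for $z \in H$; $D(\partial\varphi^t)=\{w\in D(\varphi^t):\partial\varphi^t(w)\ne\emptyset\}$. The symbol $\varphi^\bullet(u(\bullet))$ denotes the function $t\mapsto\varphi^t(u(t))$. Convolution: $(k*w)(t)=\int_0^tk(t-s)w(s)\,ds$. $k'$ denotes the weak derivative of $k$. Condition (A1): there is a constant $c_1\in[0,\infty)$ such that for each $s,t\in[0,T]$ with $s\le t$ and each $z_s\in D(\varphi^s)$ there exists $z_{s,t}\in D(\varphi^t)$ with $$\|z_{s,t}-z_s\|_H\le c_1|t-s|\bigl(1+|\varphi^s(z_s)|\bigr)^{1/2},\qquad \varphi^t(z_{s,t})\le\varphi^s(z_s)+c_1|t-s|\bigl(1+|\varphi^s(z_s)|\bigr).$$ Condition (A2): there is a constant $c_2\in[0,\infty)$ such that for each $u\in L^2(0,T;H)$ satisfying $\varphi^\bullet(u(\bullet))\in L^1(0,T)$ and for each $t\in(0,T)$ there exists a function $w_t\in L^2(0,t;H)$ such that, for a.e.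 $s\in(0,t)$, $$\|w_t(s)-u(s)\|_H\le c_2|t-s|\bigl(1+|\varphi^s(u(s))|\bigr)^{1/2},\qquad \varphi^t(w_t(s))\le\varphi^s(u(s))+c_2|t-s|\bigl(1+|\varphi^s(u(s))|\bigr).$$ *)

theory Defs
  imports "HOL-Analysis.Analysis"
begin

abbreviation leb :: "real \<Rightarrow> real measure" where
  "leb t \<equiv> lebesgue_on {0<..<t}"


section \<open>Bochner integration in a possibly non-separable space\<close>

text \<open>
  The Bochner integral of HOL-Analysis is confined to second countable target types.
  These are its defining clauses with that sort constraint dropped; approximation by simple
  functions in mean makes integrable functions almost everywhere separably valued.
\<close>

definition has_Bochner_integral ::
    "'a measure \<Rightarrow> ('a \<Rightarrow> 'b::real_normed_vector) \<Rightarrow> 'b \<Rightarrow> bool" where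
  "has_Bochner_integral M f x \<longleftrightarrow>
     f \<in> borel_measurable M \<and>
     (\<exists>s. (\<forall>i::nat. Bochner_Integration.simple_bochner_integrable M (s i)) \<and>
          (\<lambda>i. \<integral>\<^sup>+ y. ennreal (norm (f y - s i y)) \<partial>M) \<longlonglongrightarrow> 0 \<and>
          (\<lambda>i. Bochner_Integration.simple_bochner_integral M (s i)) \<longlonglongrightarrow> x)"

definition Bochner_integrable :: "'a measure \<Rightarrow> ('a \<Rightarrow> 'b::real_normed_vector) \<Rightarrow> bool" where
  "Bochner_integrable M f \<longleftrightarrow> (\<exists>x. has_Bochner_integral M f x)"

definition Bochner_integral :: "'a measure \<Rightarrow> ('a \<Rightarrow> 'b::real_normed_vector) \<Rightarrow> 'b" where
  "Bochner_integral M f =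
     (if Bochner_integrable M f then (THE x. has_Bochner_integral M f x) else 0)"

lemma has_Bochner_integral_eq_library:
  fixes f :: "'a \<Rightarrow> 'b::{real_normed_vector, second_countable_topology}"
  shows "has_Bochner_integral M f x \<longleftrightarrow> has_bochner_integral M f x"
  unfolding has_Bochner_integral_def has_bochner_integral.simps by blast

lemma Bochner_integrable_eq_library:
  fixes f :: "'a \<Rightarrow> 'b::{real_normed_vector, second_countable_topology}"
  shows "Bochner_integrable M f \<longleftrightarrow> integrable M f"
  by (simp add: Bochner_integrable_def has_Bochner_integral_eq_library integrable.simps)

lemma Bochner_integral_eq_library:
  fixes f :: "'a \<Rightarrow> 'b::{real_normed_vector, second_countable_topology}"
  shows "Bochner_integral M f = integral\<^sup>L M f"
proof -
  have "has_Bochner_integral M f = has_bochner_integral M f"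
    by (simp add: fun_eq_iff has_Bochner_integral_eq_library)
  then show ?thesis
    by (simp add: Bochner_integral_def Bochner_integrable_def lebesgue_integral_def)
qed


section \<open>Function spaces on an interval\<close>

text \<open>
  Elements of Lebesgue and Sobolev spaces are represented by functions on the real line, only
  their values on \<open>(0,T)\<close> up to null sets being relevant. As \<open>(0,T)\<close> has finite measure,
  square integrable functions are Bochner integrable; requiring this in \<open>L2\<close> supplies
  strong measurability.
\<close>

definition L2 :: "real \<Rightarrow> (real \<Rightarrow> 'a::real_normed_vector) set" where
  "L2 T = {f. Bochner_integrable (leb T) f \<and> integrable (leb T) (\<lambda>t. (norm (f t))\<^sup>2)}"

definition L1_ereal :: "real \<Rightarrow> (real \<Rightarrow> ereal) set" where
  "L1_ereal T = {f. f \<in> borel_measurable (leb T) \<and> (\<integral>\<^sup>+ t. e2ennreal \<bar>f t\<bar> \<partial>leb T) < \<infinity>}"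

definition L1_norm :: "real \<Rightarrow> (real \<Rightarrow> real) \<Rightarrow> real" where
  "L1_norm T k = (LINT t|leb T. \<bar>k t\<bar>)"

text \<open>\<open>test_fun T p p'\<close>: \<open>p\<close> is a \<open>C\<^sup>1\<close> function with compact support in \<open>(0,T)\<close>
  and derivative \<open>p'\<close>. In one dimension \<open>C\<^sup>1\<close> test functions and smooth ones give the same weak
  derivatives.\<close>

definition test_fun :: "real \<Rightarrow> (real \<Rightarrow> real) \<Rightarrow> (real \<Rightarrow> real) \<Rightarrow> bool" where
  "test_fun T p p' \<longleftrightarrow>
     (\<forall>t. (p has_real_derivative p' t) (at t)) \<and> continuous_on UNIV p' \<and>
     (\<exists>a b. 0 < a \<and> b < T \<and> (\<forall>t. t \<notin> {a..b} \<longrightarrow> p t = 0))"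

definition has_weak_deriv ::
    "real \<Rightarrow> (real \<Rightarrow> 'a::real_normed_vector) \<Rightarrow> (real \<Rightarrow> 'a) \<Rightarrow> bool" where
  "has_weak_deriv T f f' \<longleftrightarrow>
     Bochner_integrable (leb T) f \<and> Bochner_integrable (leb T) f' \<and>
     (\<forall>p p'. test_fun T p p' \<longrightarrow>
        Bochner_integral (leb T) (\<lambda>t. p' t *\<^sub>R f t) =
        - Bochner_integral (leb T) (\<lambda>t. p t *\<^sub>R f' t))"

definition W11 :: "real \<Rightarrow> (real \<Rightarrow> 'a::real_normed_vector) set" where
  "W11 T = {f. \<exists>f'. has_weak_deriv T f f'}"

text \<open>An arbitrary representative; weak derivatives are unique almost everywhere. Meaningful
  only for elements of \<open>W11 T\<close>.\<close>

definition weak_deriv :: "real \<Rightarrow> (real \<Rightarrow> 'a::real_normed_vector) \<Rightarrow> real \<Rightarrow> 'a" where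
  "weak_deriv T f = (SOME f'. has_weak_deriv T f f')"

definition nonneg_nonincreasing :: "real \<Rightarrow> (real \<Rightarrow> real) \<Rightarrow> bool" where
  "nonneg_nonincreasing T k \<longleftrightarrow>
     (\<exists>k0. (AE t in leb T. k t = k0 t) \<and> (\<forall>t\<in>{0<..<T}. 0 \<le> k0 t) \<and> antimono_on {0<..<T} k0)"

definition conv :: "(real \<Rightarrow> real) \<Rightarrow> (real \<Rightarrow> 'a::real_normed_vector) \<Rightarrow> real \<Rightarrow> 'a" where
  "conv k w t = Bochner_integral (leb t) (\<lambda>s. k (t - s) *\<^sub>R w s)"


section \<open>Convex functionals\<close>

definition proper :: "('a \<Rightarrow> ereal) \<Rightarrow> bool" where
  "proper f \<longleftrightarrow> (\<forall>x. f x \<noteq> -\<infinity>) \<and> (\<exists>x. f x \<noteq> \<infinity>)"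

definition lsc :: "('a::topological_space \<Rightarrow> ereal) \<Rightarrow> bool" where
  "lsc f \<longleftrightarrow> (\<forall>x. f x \<le> Liminf (at x) f)"

definition convex_functional :: "('a::real_vector \<Rightarrow> ereal) \<Rightarrow> bool" where
  "convex_functional f \<longleftrightarrow>
     (\<forall>x y. \<forall>l\<in>{0<..<1}. f ((1 - l) *\<^sub>R x + l *\<^sub>R y) \<le> ereal (1 - l) * f x + ereal l * f y)"

definition Dom :: "('a \<Rightarrow> ereal) \<Rightarrow> 'a set" where
  "Dom f = {w. f w < \<infinity>}"

definition subdiff :: "('a::real_inner \<Rightarrow> ereal) \<Rightarrow> 'a \<Rightarrow> 'a set" where
  "subdiff f z = {\<xi>. \<forall>v\<in>Dom f. f v - f z \<ge> ereal (\<xi> \<bullet> (v - z))}"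

definition Dom_subdiff :: "('a::real_inner \<Rightarrow> ereal) \<Rightarrow> 'a set" where
  "Dom_subdiff f = {w \<in> Dom f. subdiff f w \<noteq> {}}"

text \<open>Real value of a functional, for use at points where it is finite.\<close>

abbreviation rval :: "(real \<Rightarrow> 'a \<Rightarrow> ereal) \<Rightarrow> real \<Rightarrow> 'a \<Rightarrow> real" where
  "rval \<phi> t z \<equiv> real_of_ereal (\<phi> t z)"

definition cond_A1 :: "real \<Rightarrow> (real \<Rightarrow> 'a::real_normed_vector \<Rightarrow> ereal) \<Rightarrow> bool" where
  "cond_A1 T \<phi> \<longleftrightarrow>
     (\<exists>c\<^sub>1\<ge>0. \<forall>s\<in>{0..T}. \<forall>t\<in>{0..T}. s \<le> t \<longrightarrow>
       (\<forall>z\<in>Dom (\<phi> s). \<exists>z'\<in>Dom (\<phi> t).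
          norm (z' - z) \<le> c\<^sub>1 * \<bar>t - s\<bar> * sqrt (1 + \<bar>rval \<phi> s z\<bar>) \<and>
          \<phi> t z' \<le> \<phi> s z + ereal (c\<^sub>1 * \<bar>t - s\<bar> * (1 + \<bar>rval \<phi> s z\<bar>))))"

definition cond_A2 :: "real \<Rightarrow> (real \<Rightarrow> 'a::real_normed_vector \<Rightarrow> ereal) \<Rightarrow> bool" where
  "cond_A2 T \<phi> \<longleftrightarrow>
     (\<exists>c\<^sub>2\<ge>0. \<forall>u\<in>L2 T. (\<lambda>t. \<phi> t (u t)) \<in> L1_ereal T \<longrightarrow>
       (\<forall>t\<in>{0<..<T}. \<exists>w\<in>L2 t. AE s in leb t.
          norm (w s - u s) \<le> c\<^sub>2 * \<bar>t - s\<bar> * sqrt (1 + \<bar>rval \<phi> s (u s)\<bar>) \<and>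
          \<phi> t (w s) \<le> \<phi> s (u s) + ereal (c\<^sub>2 * \<bar>t - s\<bar> * (1 + \<bar>rval \<phi> s (u s)\<bar>))))"

end

theory Submission
  imports Defs
begin

text \<open>
  Why the inequality holds. Write \<open>w = u - u\<^sub>0\<close> and let \<open>K(t) = k\<^sub>0 + \<integral>\<^sub>0\<^sup>t k'\<close> be the absolutely
  continuous representative of the kernel. Differentiating the convolution gives
  \<open>\<partial>\<^sub>t(k * w)(t) = k\<^sub>0 w(t) + \<integral>\<^sub>0\<^sup>t k'(t-s) w(s) ds = K(t) w(t) + \<integral>\<^sub>0\<^sup>t (-k'(t-s)) (w(t) - w(s)) ds\<close>.
  As \<open>k\<close> is nonnegative and nonincreasing, the weights \<open>K(t)\<close> and \<open>-k'(t-s)\<close> are nonnegative, and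
  the same formula holds for \<open>b(s) = \<phi>\<^sup>s(u(s))\<close> in place of \<open>w\<close>. For fixed \<open>t\<close> it therefore suffices
  to compare \<open>(u(t) - y, g(t))\<close> with \<open>b(t) - b(s)\<close> for \<open>y = u(s)\<close>, and with \<open>b(t) - \<phi>\<^sup>0(u\<^sub>0)\<close> for
  \<open>y = u\<^sub>0\<close>.

  The subgradient inequality bounds \<open>(u(t) - z, g(t))\<close> below by \<open>\<phi>\<^sup>t(u(t)) - \<phi>\<^sup>t(z)\<close> for every \<open>z\<close> in
  the domain of \<open>\<phi>\<^sup>t\<close>. The point \<open>y\<close> itself need not lie there, but (A1) and (A2) provide a
  \<open>z\<close> whose distance from \<open>y\<close> and whose excess of energy are of the order of the time lag.
  The resulting error \<open>lag * sqrt(1 + |b|) * \<parallel>g(t)\<parallel>\<close> is split by Young's inequality into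
  \<open>\<epsilon> \<parallel>g(t)\<parallel>\<^sup>2\<close> and \<open>(1 + |b|)/\<epsilon>\<close>; this is lemma \<open>subdiff_perturbed_bound\<close>. When these bounds are
  integrated against the weights (lemma \<open>kernel_inequality\<close>), the lags add up to
  \<open>t K(t) + \<integral>\<^sub>0\<^sup>t s (-k'(s)) ds = \<integral>\<^sub>0\<^sup>t K \<le> \<parallel>k\<parallel>\<close>, the norm being that of \<open>L\<^sup>1(0,T)\<close>
  (lemma \<open>integral_kernel_identity\<close>). This identity is the reason why only \<open>\<parallel>k\<parallel>\<close> enters the
  estimate and why \<open>c = 2 (c\<^sub>1 + c\<^sub>2)\<close> is independent of \<open>k\<close>, \<open>u\<close> and \<open>g\<close>.

  The integrated inequality follows by integrating the pointwise one: \<open>k * b\<close> is exactly, at every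
  \<open>t\<close>, the primitive of its weak derivative (lemma \<open>conv_eq_integral\<close>), and the remaining double
  integral is a convolution whose mass is bounded by Tonelli and the identity above. The left-hand
  side is integrable because \<open>\<parallel>g(t)\<parallel> (|k'| * \<parallel>w\<parallel>)(t)\<close> is dominated by
  \<open>|k'| * \<parallel>w\<parallel>\<^sup>2 + \<parallel>k'\<parallel> \<parallel>g(t)\<parallel>\<^sup>2\<close>.

  The analytic basis has three parts. In a possibly non-separable Hilbert space, integrable functions
  are handled as \<open>L\<^sup>1\<close> limits of simple functions (lemma \<open>Bochner_integrable_L1_limit\<close>), and
  identities between integrals are reduced to scalar ones by taking inner products. Fubini's theorem for
  scalar convolutions gives the primitive of \<open>k\<^sub>0 w + k' * w\<close>, hence the weak derivative of \<open>k * w\<close>.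
  Finally \<open>k' \<le> 0\<close> almost everywhere is deduced from the monotonicity of \<open>K\<close> by comparing the
  Lebesgue-Stieltjes measure of a primitive with the densities of the positive and negative parts
  (lemma \<open>AE_nonneg_if_integral_mono\<close>).
\<close>

section \<open>The Bochner integral in a Hilbert space\<close>

lemma complete_measure_restrict_space:
  assumes "complete_measure M" "S \<in> sets M"
  shows "complete_measure (restrict_space M S)"
proof -
  interpret complete_measure M by fact
  show ?thesis
  proof
    fix A B assume "B \<subseteq> A" "A \<in> null_sets (restrict_space M S)"
    then show "B \<in> sets (restrict_space M S)"
      using complete null_sets_restrict_space[OF assms(2)] sets_restrict_space_iff[of S M] assms(2)
      by (metis (no_types, lifting) inf.absorb_iff2 dual_order.trans sets.Int_space_eq2)
  qed
qed

lemma complete_measure_leb: "complete_measure (leb t)"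
  by (rule complete_measure_restrict_space[OF completion.complete_measure_axioms]) simp

lemma (in complete_measure) measurable_cong_AE:
  assumes g: "g \<in> measurable M N" and ae: "AE x in M. f x = g x"
    and sp: "\<And>x. x \<in> space M \<Longrightarrow> f x \<in> space N"
  shows "f \<in> measurable M N"
proof (rule measurableI)
  fix A assume "A \<in> sets N"
  then have "g -` A \<inter> space M \<in> sets M" using g by auto
  moreover have "AE x in M. (x \<in> g -` A \<inter> space M) = (x \<in> f -` A \<inter> space M)"
    using ae by eventually_elim auto
  ultimately show "f -` A \<inter> space M \<in> sets M"
    using in_sets_AE[of "g -` A \<inter> space M" "f -` A \<inter> space M"] by blast
qed (use sp in auto)

text \<open>A sum of two Borel functions with values in a non-separable space need not be Borel. For
  this reason the measurability of sums and products is derived below from sequences of simple functions.\<close>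

lemma (in complete_measure) borel_measurable_AE_limit:
  fixes f :: "'a \<Rightarrow> 'b::metric_space"
  assumes s: "\<And>i. s i \<in> borel_measurable M" and ae: "AE x in M. (\<lambda>i. s i x) \<longlonglongrightarrow> f x"
  shows "f \<in> borel_measurable M"
proof -
  from AE_E3[OF ae] obtain N where N: "\<And>x. x \<in> space M - N \<Longrightarrow> (\<lambda>i. s i x) \<longlonglongrightarrow> f x"
    "N \<in> null_sets M" by auto
  \<comment> \<open>An arbitrary value, taken on the exceptional null set.\<close>
  obtain c :: 'b where True by blast
  have "(\<lambda>x. if x \<in> N then c else f x) \<in> borel_measurable M"
  proof (rule borel_measurable_LIMSEQ_metric)
    show "(\<lambda>x. if x \<in> N then c else s i x) \<in> borel_measurable M" for i
      using N(2) s by (intro measurable_If_set) auto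
    show "(\<lambda>i. if x \<in> N then c else s i x) \<longlonglongrightarrow> (if x \<in> N then c else f x)"
      if "x \<in> space M" for x using N(1)[of x] that by auto
  qed
  then show ?thesis
    by (rule measurable_cong_AE) (use AE_not_in[OF N(2)] in \<open>auto elim!: eventually_mono\<close>)
qed

text \<open>Joint measurability can fail in non-separable spaces, but a simple function splits the space into
  finitely many measurable pieces, on each of which the second argument is constant.\<close>

lemma borel_measurable_compose_simple_function:
  fixes f :: "'a \<Rightarrow> 'b::topological_space" and s :: "'a \<Rightarrow> 'c" 
    and p :: "'b \<Rightarrow> 'c \<Rightarrow> 'd::topological_space"
  assumes f: "f \<in> borel_measurable M" and s: "simple_function M s"
    and p: "\<And>c. continuous_on UNIV (\<lambda>x. p x c)"
  shows "(\<lambda>x. p (f x) (s x)) \<in> borel_measurable M"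
proof (rule measurable_compose_countable'[where I="s ` space M" and f="\<lambda>c x. p (f x) c" and g=s])
  show "(\<lambda>x. p (f x) c) \<in> borel_measurable M" for c
    using measurable_compose[OF f borel_measurable_continuous_onI[OF p]] .
  show "s \<in> M \<rightarrow>\<^sub>M count_space (s ` space M)"
    using s by (auto simp: simple_function_def measurable_count_space_eq2)
  show "countable (s ` space M)"
    using s by (auto simp: simple_function_def countable_finite)
qed

lemma simple_bochner_integrableD:
  "Bochner_Integration.simple_bochner_integrable M s \<Longrightarrow> simple_function M s"
  by (simp add: simple_bochner_integrable.simps)

lemma borel_measurable_Bochner_integrable:
  "Bochner_integrable M f \<Longrightarrow> f \<in> borel_measurable M"
  by (auto simp: Bochner_integrable_def has_Bochner_integral_def)

lemma borel_measurable_norm_diff_simple: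
  fixes f :: "'a \<Rightarrow> 'b::real_normed_vector"
  assumes "f \<in> borel_measurable M" "simple_function M s"
  shows "(\<lambda>x. norm (f x - s x)) \<in> borel_measurable M"
  by (rule borel_measurable_compose_simple_function[OF assms, of "\<lambda>x y. norm (x - y)"]) 
     (intro continuous_intros)

lemma has_Bochner_integral_simple:
  fixes s :: "'a \<Rightarrow> 'b::real_normed_vector"
  assumes "Bochner_Integration.simple_bochner_integrable M s"
  shows "has_Bochner_integral M s (Bochner_Integration.simple_bochner_integral M s)"
  using assms borel_measurable_simple_function[OF simple_bochner_integrableD[OF assms]]
  by (auto simp: has_Bochner_integral_def intro!: exI[of _ "\<lambda>_. s"])

lemma tendsto_if_ennreal_norm_diff_tendsto_0:
  fixes y :: "'b::real_normed_vector"
  assumes "(\<lambda>i. ennreal (norm (y - s i))) \<longlonglongrightarrow> 0"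
  shows "s \<longlonglongrightarrow> y"
proof -
  have "(\<lambda>i. norm (y - s i)) \<longlonglongrightarrow> 0"
    using assms tendsto_ennreal_iff[of "\<lambda>i. norm (y - s i)" sequentially 0] by simp
  then have "(\<lambda>i. norm (s i - y)) \<longlonglongrightarrow> 0" by (simp only: norm_minus_commute)
  then show ?thesis by (simp only: tendsto_norm_zero_iff LIM_zero_iff)
qed

text \<open>Along a subsequence the integrals are dominated by a geometric series, so the sum of the
  functions is integrable and its terms tend to 0 where it is finite.\<close>

lemma AE_subseq_of_nn_integral_tendsto_0:
  fixes e :: "nat \<Rightarrow> 'a \<Rightarrow> ennreal"
  assumes [measurable]: "\<And>i. e i \<in> borel_measurable M"
    and e: "(\<lambda>i. \<integral>\<^sup>+x. e i x \<partial>M) \<longlonglongrightarrow> 0"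
  obtains r :: "nat \<Rightarrow> nat" where "strict_mono r" "AE x in M. (\<lambda>i. e (r i) x) \<longlonglongrightarrow> 0"
proof -
  have "\<exists>N. \<forall>n\<ge>N. (\<integral>\<^sup>+x. e n x \<partial>M) < ennreal ((1/2)^k)" for k
    using order_tendstoD(2)[OF e, of "ennreal ((1/2)^k)"] by (auto simp: eventually_sequentially)
  then obtain N where N: "\<And>k n. n \<ge> N k \<Longrightarrow> (\<integral>\<^sup>+x. e n x \<partial>M) < ennreal ((1/2)^k)" by metis
  \<comment> \<open>Partial sums make the choice of indices strictly increasing while keeping \<open>r n \<ge> N n\<close>.\<close>
  define r where "r n = (\<Sum>k\<le>n. Suc (N k))" for n
  have "strict_mono r" by (auto simp: strict_mono_Suc_iff r_def)
  have "r n \<ge> N n" for n unfolding r_def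
    using member_le_sum[of n "{..n}" "\<lambda>k. Suc (N k)"] by auto
  then have r: "(\<integral>\<^sup>+x. e (r n) x \<partial>M) \<le> ennreal ((1/2)^n)" for n using N by (auto intro: less_imp_le)
  have "(\<integral>\<^sup>+x. (\<Sum>n. e (r n) x) \<partial>M) = (\<Sum>n. \<integral>\<^sup>+x. e (r n) x \<partial>M)"
    by (rule nn_integral_suminf) auto
  also have "\<dots> \<le> (\<Sum>n. ennreal ((1/2)^n))" by (intro suminf_le r) auto
  also have "\<dots> < \<infinity>" by (subst suminf_ennreal2) auto
  finally have "AE x in M. (\<Sum>n. e (r n) x) \<noteq> \<infinity>"
    by (intro nn_integral_PInf_AE) auto
  then have "AE x in M. (\<lambda>i. e (r i) x) \<longlonglongrightarrow> 0"
  proof eventually_elim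
    case (elim x)
    then have fin: "e (r n) x \<noteq> \<infinity>" for n
      using ennreal_suminf_lessD[of "\<lambda>n. e (r n) x" \<infinity> n] by (auto simp: less_top)
    define d where "d n = enn2real (e (r n) x)" for n
    have d: "e (r n) x = ennreal (d n)" "d n \<ge> 0" for n using fin by (auto simp: d_def less_top)
    have "summable d"
    proof (rule summable_suminf_not_top)
      show "(\<Sum>i. ennreal (d i)) \<noteq> top" using elim unfolding d(1) by simp
    qed (rule d(2))
    then have "d \<longlonglongrightarrow> 0" by (rule summable_LIMSEQ_zero)
    from tendsto_ennrealI[OF this] show ?case unfolding d(1) by simp
  qed
  with \<open>strict_mono r\<close> that show thesis by blast
qed

lemma Bochner_integrable_approx:
  fixes f :: "'a \<Rightarrow> 'b::real_normed_vector"
  assumes "Bochner_integrable M f"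
  obtains s where "\<And>i. Bochner_Integration.simple_bochner_integrable M (s i)"
    "(\<lambda>i. \<integral>\<^sup>+x. norm (f x - s i x) \<partial>M) \<longlonglongrightarrow> 0"
    "AE x in M. (\<lambda>i. s i x) \<longlonglongrightarrow> f x"
proof -
  from assms obtain s where f: "f \<in> borel_measurable M"
    and s: "\<And>i::nat. Bochner_Integration.simple_bochner_integrable M (s i)"
    and lim: "(\<lambda>i. \<integral>\<^sup>+x. norm (f x - s i x) \<partial>M) \<longlonglongrightarrow> 0"
    by (auto simp: Bochner_integrable_def has_Bochner_integral_def)
  have meas: "(\<lambda>x. ennreal (norm (f x - s i x))) \<in> borel_measurable M" for i
    using borel_measurable_norm_diff_simple[OF f simple_bochner_integrableD[OF s]] by simp
  obtain r where r: "strict_mono r" "AE x in M. (\<lambda>i. ennreal (norm (f x - s (r i) x))) \<longlonglongrightarrow> 0"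
    using AE_subseq_of_nn_integral_tendsto_0[OF meas lim] by blast
  show thesis
  proof (rule that[of "\<lambda>i. s (r i)"])
    show "(\<lambda>i. \<integral>\<^sup>+x. norm (f x - s (r i) x) \<partial>M) \<longlonglongrightarrow> 0"
      using LIMSEQ_subseq_LIMSEQ[OF lim r(1)] by (simp add: o_def)
    show "AE x in M. (\<lambda>i. s (r i) x) \<longlonglongrightarrow> f x"
      using r(2) by eventually_elim (rule tendsto_if_ennreal_norm_diff_tendsto_0)
  qed (rule s)
qed

text \<open>The working criterion for integrability. The error is controlled by measurable functions
  \<open>e i\<close>, not by \<open>norm (f x - F i x)\<close> itself, so that nothing about \<open>f\<close> has to be known in advance:
  an error subsequence that tends to 0 almost everywhere makes \<open>f\<close> measurable, and the integrals of
  nearby simple functions form a Cauchy sequence.\<close>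

lemma Bochner_integrable_L1_limit:
  fixes f :: "'a \<Rightarrow> 'b::{real_normed_vector, complete_space}"
  assumes M: "complete_measure M"
    and fi: "\<And>i. Bochner_integrable M (F i)"
    and e[measurable]: "\<And>i. e i \<in> borel_measurable M"
    and le: "\<And>i. AE x in M. ennreal (norm (f x - F i x)) \<le> e i x"
    and lim: "(\<lambda>i. \<integral>\<^sup>+x. e i x \<partial>M) \<longlonglongrightarrow> 0"
  shows "Bochner_integrable M f"
proof -
  interpret complete_measure M by fact
  have "\<exists>s. Bochner_Integration.simple_bochner_integrable M s \<and> (\<integral>\<^sup>+x. norm (F i x - s x) \<partial>M) < ennreal (1/Suc i)" for i
  proof -
    obtain s where s: "\<And>j. Bochner_Integration.simple_bochner_integrable M (s j)"
      "(\<lambda>j. \<integral>\<^sup>+x. norm (F i x - s j x) \<partial>M) \<longlonglongrightarrow> 0"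
      using Bochner_integrable_approx[OF fi[of i]] by blast
    have "\<forall>\<^sub>F j in sequentially. (\<integral>\<^sup>+x. norm (F i x - s j x) \<partial>M) < ennreal (1/Suc i)"
      by (rule order_tendstoD(2)[OF s(2)]) (simp add: ennreal_zero_less_one)
    with s(1) show ?thesis by (auto simp: eventually_sequentially)
  qed
  then obtain s where s: "\<And>i. Bochner_Integration.simple_bochner_integrable M (s i)"
    and sl: "\<And>i. (\<integral>\<^sup>+x. norm (F i x - s i x) \<partial>M) < ennreal (1/Suc i)" by metis
  have [measurable]: "(\<lambda>x. norm (F i x - s i x)) \<in> borel_measurable M" for i
    by (intro borel_measurable_norm_diff_simple borel_measurable_Bochner_integrable fi
          simple_bochner_integrableD s)
  define E where "E i x = e i x + ennreal (norm (F i x - s i x))" for i x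
  have [measurable]: "E i \<in> borel_measurable M" for i unfolding E_def by measurable
  have Elim: "(\<lambda>i. \<integral>\<^sup>+x. E i x \<partial>M) \<longlonglongrightarrow> 0"
  proof -
    have l: "(\<lambda>i. ennreal (1/Suc i)) \<longlonglongrightarrow> 0"
      using tendsto_ennrealI[OF LIMSEQ_Suc[OF lim_1_over_n]] by (simp only: ennreal_0)
    have "(\<lambda>i. \<integral>\<^sup>+x. norm (F i x - s i x) \<partial>M) \<longlonglongrightarrow> 0"
    proof (rule tendsto_sandwich[OF _ _ tendsto_const l])
      show "\<forall>\<^sub>F i in sequentially. (\<integral>\<^sup>+x. norm (F i x - s i x) \<partial>M) \<le> ennreal (1/Suc i)"
        using less_imp_le[OF sl] by (intro always_eventually allI)
    qed simp
    from tendsto_add[OF lim this] show ?thesis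
      unfolding E_def by (simp add: nn_integral_add)
  qed
  have Ele: "AE x in M. ennreal (norm (f x - s i x)) \<le> E i x" for i
    using le[of i]
  proof eventually_elim
    case (elim x)
    have "norm (f x - s i x) \<le> norm (f x - F i x) + norm (F i x - s i x)"
      using norm_triangle_ineq[of "f x - F i x" "F i x - s i x"] by simp
    then have "ennreal (norm (f x - s i x)) \<le> ennreal (norm (f x - F i x)) + ennreal (norm (F i x - s i x))"
      by (simp add: ennreal_leI flip: ennreal_plus)
    then show ?case unfolding E_def using elim by (meson add_right_mono order_trans)
  qed
  obtain r where r: "strict_mono r" "AE x in M. (\<lambda>i. E (r i) x) \<longlonglongrightarrow> 0"
    using AE_subseq_of_nn_integral_tendsto_0[OF _ Elim] by auto
  have f: "f \<in> borel_measurable M"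
  proof (rule borel_measurable_AE_limit[where s="\<lambda>i. s (r i)"])
    show "s (r i) \<in> borel_measurable M" for i
      by (intro borel_measurable_simple_function simple_bochner_integrableD s)
    have "AE x in M. \<forall>i. ennreal (norm (f x - s i x)) \<le> E i x" using Ele by (simp add: AE_all_countable)
    with r(2) show "AE x in M. (\<lambda>i. s (r i) x) \<longlonglongrightarrow> f x"
    proof eventually_elim
      case (elim x)
      then have "(\<lambda>i. ennreal (norm (f x - s (r i) x))) \<longlonglongrightarrow> 0"
        by (intro tendsto_sandwich[OF _ _ tendsto_const elim(1)] always_eventually allI) simp_all
      then show ?case by (rule tendsto_if_ennreal_norm_diff_tendsto_0)
    qed
  qed
  have flim: "(\<lambda>i. \<integral>\<^sup>+x. norm (f x - s i x) \<partial>M) \<longlonglongrightarrow> 0"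
    by (rule tendsto_sandwich[OF _ _ tendsto_const Elim])
       (intro always_eventually allI nn_integral_mono_AE Ele zero_le)+
  have bd: "ennreal (norm (Bochner_Integration.simple_bochner_integral M (s i) - Bochner_Integration.simple_bochner_integral M (s j)))
     \<le> (\<integral>\<^sup>+x. E i x \<partial>M) + (\<integral>\<^sup>+x. E j x \<partial>M)" for i j
  proof -
    have "ennreal (norm (Bochner_Integration.simple_bochner_integral M (s i) - Bochner_Integration.simple_bochner_integral M (s j)))
      = norm (Bochner_Integration.simple_bochner_integral M (\<lambda>x. s i x - s j x))"
      using s by (subst simple_bochner_integral_diff) auto
    also have "\<dots> \<le> Bochner_Integration.simple_bochner_integral M (\<lambda>x. norm (s i x - s j x))"
      using simple_bochner_integrable_compose2[of "(-)" M "s i" "s j"] s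
      by (auto intro!: simple_bochner_integral_norm_bound)
    also have "\<dots> = (\<integral>\<^sup>+x. norm (s i x - s j x) \<partial>M)"
      using simple_bochner_integrable_compose2[of "\<lambda>x y. norm (x - y)" M "s i" "s j"] s
      by (auto intro!: simple_bochner_integral_eq_nn_integral)
    also have "\<dots> \<le> (\<integral>\<^sup>+x. E i x + E j x \<partial>M)"
    proof (rule nn_integral_mono_AE)
      show "AE x in M. ennreal (norm (s i x - s j x)) \<le> E i x + E j x"
        using Ele[of i] Ele[of j]
      proof eventually_elim
        case (elim x)
        have "norm (s i x - s j x) \<le> norm (f x - s i x) + norm (f x - s j x)"
          by (metis dual_order.refl norm_diff_triangle_le norm_minus_commute)
        then have "ennreal (norm (s i x - s j x)) \<le> ennreal (norm (f x - s i x)) + ennreal (norm (f x - s j x))"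
          by (simp add: ennreal_leI flip: ennreal_plus)
        with elim show ?case by (meson add_mono order_trans)
      qed
    qed
    also have "\<dots> = (\<integral>\<^sup>+x. E i x \<partial>M) + (\<integral>\<^sup>+x. E j x \<partial>M)" by (rule nn_integral_add) auto
    finally show ?thesis .
  qed
  have "Cauchy (\<lambda>i. Bochner_Integration.simple_bochner_integral M (s i))"
  proof (rule metric_CauchyI)
    fix d :: real assume "0 < d"
    then have "\<forall>\<^sub>F i in sequentially. (\<integral>\<^sup>+x. E i x \<partial>M) < ennreal (d/2)"
      by (intro order_tendstoD(2)[OF Elim]) simp
    then obtain N where N: "\<And>i. i \<ge> N \<Longrightarrow> (\<integral>\<^sup>+x. E i x \<partial>M) < ennreal (d/2)"
      by (auto simp: eventually_sequentially)
    show "\<exists>N. \<forall>m\<ge>N. \<forall>n\<ge>N. dist (Bochner_Integration.simple_bochner_integral M (s m)) (Bochner_Integration.simple_bochner_integral M (s n)) < d"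
    proof (intro exI allI impI)
      fix m n assume "m \<ge> N" "n \<ge> N"
      then have "ennreal (norm (Bochner_Integration.simple_bochner_integral M (s m) - Bochner_Integration.simple_bochner_integral M (s n))) < ennreal (d/2) + ennreal (d/2)"
        by (intro le_less_trans[OF bd] add_strict_mono N)
      also have "\<dots> = ennreal d" using \<open>0 < d\<close> by (subst ennreal_plus[symmetric]) auto
      finally show "dist (Bochner_Integration.simple_bochner_integral M (s m)) (Bochner_Integration.simple_bochner_integral M (s n)) < d"
        by (simp add: dist_norm ennreal_less_iff)
    qed
  qed
  then obtain x where "(\<lambda>i. Bochner_Integration.simple_bochner_integral M (s i)) \<longlonglongrightarrow> x"
    using Cauchy_convergent_iff convergent_def by blast
  with f s flim show ?thesis
    by (auto simp: Bochner_integrable_def has_Bochner_integral_def)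
qed

text \<open>Inner products reduce the vector-valued integral to the integral of real functions. Since
  vectors are determined by their inner products, uniqueness, linearity and Fubini-type identities
  need to be proved for real functions only.\<close>

lemma has_Bochner_integral_inner_left:
  fixes f :: "'a \<Rightarrow> 'b::real_inner"
  assumes "has_Bochner_integral M f x"
  shows "has_bochner_integral M (\<lambda>y. f y \<bullet> h) (x \<bullet> h)"
proof -
  from assms obtain s where f: "f \<in> borel_measurable M"
    and s: "\<And>i::nat. Bochner_Integration.simple_bochner_integrable M (s i)"
    and lim: "(\<lambda>i. \<integral>\<^sup>+x. norm (f x - s i x) \<partial>M) \<longlonglongrightarrow> 0"
    and x: "(\<lambda>i. Bochner_Integration.simple_bochner_integral M (s i)) \<longlonglongrightarrow> x"
    by (auto simp: has_Bochner_integral_def)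
  have sh: "Bochner_Integration.simple_bochner_integrable M (\<lambda>x. s i x \<bullet> h)" for i
    using simple_bochner_integrable_compose2[of "\<lambda>x y. x \<bullet> h", OF _ s s] by simp
  have meas: "(\<lambda>x. norm (f x - s i x)) \<in> borel_measurable M" for i
    using borel_measurable_norm_diff_simple[OF f simple_bochner_integrableD[OF s]] .
  have "has_Bochner_integral M (\<lambda>y. f y \<bullet> h) (x \<bullet> h)"
    unfolding has_Bochner_integral_def
  proof (intro conjI exI[of _ "\<lambda>i x. s i x \<bullet> h"] allI sh)
    show "(\<lambda>y. f y \<bullet> h) \<in> borel_measurable M"
      by (rule measurable_compose[OF f borel_measurable_continuous_onI]) (intro continuous_intros)
    have "(\<lambda>i. ennreal (norm h) * (\<integral>\<^sup>+x. norm (f x - s i x) \<partial>M)) \<longlonglongrightarrow> ennreal (norm h) * 0"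
      by (intro ennreal_tendsto_cmult lim) simp
    then have l: "(\<lambda>i. ennreal (norm h) * (\<integral>\<^sup>+x. norm (f x - s i x) \<partial>M)) \<longlonglongrightarrow> 0" by simp
    show "(\<lambda>i. \<integral>\<^sup>+y. norm (f y \<bullet> h - s i y \<bullet> h) \<partial>M) \<longlonglongrightarrow> 0"
    proof (rule tendsto_sandwich[OF _ _ tendsto_const l]; intro always_eventually allI zero_le)
      fix i
      have "(\<integral>\<^sup>+y. norm (f y \<bullet> h - s i y \<bullet> h) \<partial>M) \<le> (\<integral>\<^sup>+y. ennreal (norm h) * ennreal (norm (f y - s i y)) \<partial>M)"
      proof (rule nn_integral_mono)
        fix y
        have "norm (f y \<bullet> h - s i y \<bullet> h) \<le> norm h * norm (f y - s i y)"
          using Cauchy_Schwarz_ineq2[of "f y - s i y" h] by (simp add: inner_diff_left mult.commute)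
        then show "ennreal (norm (f y \<bullet> h - s i y \<bullet> h)) \<le> ennreal (norm h) * ennreal (norm (f y - s i y))"
          by (simp add: ennreal_leI flip: ennreal_mult)
      qed
      also have "\<dots> = ennreal (norm h) * (\<integral>\<^sup>+x. norm (f x - s i x) \<partial>M)"
        using meas by (intro nn_integral_cmult) simp
      finally show "(\<integral>\<^sup>+y. norm (f y \<bullet> h - s i y \<bullet> h) \<partial>M) \<le> ennreal (norm h) * (\<integral>\<^sup>+x. norm (f x - s i x) \<partial>M)" .
    qed
    have "linear (\<lambda>x::'b. x \<bullet> h)" by (intro bounded_linear.linear bounded_linear_inner_left)
    then show "(\<lambda>i. Bochner_Integration.simple_bochner_integral M (\<lambda>x. s i x \<bullet> h)) \<longlonglongrightarrow> x \<bullet> h"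
      using tendsto_inner[OF x tendsto_const[of h]] 
      by (subst simple_bochner_integral_linear[OF _ s]) auto
  qed
  then show ?thesis by (simp add: has_Bochner_integral_eq_library)
qed

lemma has_Bochner_integral_unique:
  fixes f :: "'a \<Rightarrow> 'b::real_inner"
  assumes "has_Bochner_integral M f x" "has_Bochner_integral M f y"
  shows "x = y"
proof -
  have "x \<bullet> h = y \<bullet> h" for h
    using has_bochner_integral_eq assms[THEN has_Bochner_integral_inner_left] by blast
  then show ?thesis using vector_eq_rdot by blast
qed

lemma has_Bochner_integral_integral:
  fixes f :: "'a \<Rightarrow> 'b::real_inner"
  assumes "Bochner_integrable M f"
  shows "has_Bochner_integral M f (Bochner_integral M f)"
proof -
  obtain x where "has_Bochner_integral M f x" using assms by (auto simp: Bochner_integrable_def)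
  then have "has_Bochner_integral M f (THE x. has_Bochner_integral M f x)"
    by (rule theI) (rule has_Bochner_integral_unique[OF _ \<open>has_Bochner_integral M f x\<close>])
  then show ?thesis using assms by (simp only: Bochner_integral_def if_True)
qed

lemma Bochner_integral_inner_left:
  fixes f :: "'a \<Rightarrow> 'b::real_inner"
  assumes "Bochner_integrable M f"
  shows integrable_inner_left_Bochner: "integrable M (\<lambda>x. f x \<bullet> h)"
    and "Bochner_integral M f \<bullet> h = (LINT x|M. f x \<bullet> h)"
  using has_Bochner_integral_inner_left[OF has_Bochner_integral_integral[OF assms], of h]
  by (auto simp: has_bochner_integral_iff)

lemma Bochner_integrable_norm:
  fixes f :: "'a \<Rightarrow> 'b::real_normed_vector"
  assumes "Bochner_integrable M f"
  shows "integrable M (\<lambda>x. norm (f x))"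
proof -
  from Bochner_integrable_approx[OF assms] obtain s where
    s: "\<And>i::nat. Bochner_Integration.simple_bochner_integrable M (s i)"
    and lim: "(\<lambda>i. \<integral>\<^sup>+x. norm (f x - s i x) \<partial>M) \<longlonglongrightarrow> 0" by blast
  have f: "f \<in> borel_measurable M" by (rule borel_measurable_Bochner_integrable) fact
  have "\<forall>\<^sub>F i in sequentially. (\<integral>\<^sup>+x. norm (f x - s i x) \<partial>M) < 1"
    by (rule order_tendstoD(2)[OF lim]) (simp add: ennreal_zero_less_one)
  then obtain i where i: "(\<integral>\<^sup>+x. norm (f x - s i x) \<partial>M) < 1" by (auto simp: eventually_sequentially)
  have [measurable]: "(\<lambda>x. norm (f x - s i x)) \<in> borel_measurable M"
    using borel_measurable_norm_diff_simple[OF f simple_bochner_integrableD[OF s]] .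
  have n: "Bochner_Integration.simple_bochner_integrable M (\<lambda>x. norm (s i x))"
    using simple_bochner_integrable_compose2[of "\<lambda>x y. norm x", OF _ s s] by simp
  have "integrable M (\<lambda>x. norm (f x - s i x))"
    using i by (intro integrableI_bounded) (auto intro: less_trans)
  moreover have "integrable M (\<lambda>x. norm (s i x))"
    using has_bochner_integral_simple_bochner_integrable[OF n] by (auto simp: has_bochner_integral_iff)
  ultimately have "integrable M (\<lambda>x. norm (f x - s i x) + norm (s i x))" by simp
  then show ?thesis
  proof (rule Bochner_Integration.integrable_bound)
    show "(\<lambda>x. norm (f x)) \<in> borel_measurable M"
      by (rule measurable_compose[OF f borel_measurable_continuous_onI]) (intro continuous_intros)
    show "AE x in M. norm (norm (f x)) \<le> norm (norm (f x - s i x) + norm (s i x))"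
      using norm_triangle_sub by (intro AE_I2) (auto simp: add.commute)
  qed
qed

text \<open>Test the integral \<open>x\<close> against itself: \<open>\<parallel>x\<parallel>\<^sup>2\<close> is the integral of \<open>f \<bullet> x\<close>, which is at most
  \<open>\<parallel>x\<parallel>\<close> times the integral of \<open>\<parallel>f\<parallel>\<close>.\<close>

lemma norm_Bochner_integral_le:
  fixes f :: "'a \<Rightarrow> 'b::real_inner"
  assumes "Bochner_integrable M f"
  shows "norm (Bochner_integral M f) \<le> (LINT x|M. norm (f x))"
proof -
  let ?x = "Bochner_integral M f"
  have "norm ?x * norm ?x = (LINT y|M. f y \<bullet> ?x)"
    using Bochner_integral_inner_left(2)[OF assms, of ?x] by (simp add: power2_norm_eq_inner flip: power2_eq_square)
  also have "\<dots> \<le> (LINT y|M. norm (f y) * norm ?x)"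
    using norm_cauchy_schwarz
    by (intro integral_mono integrable_inner_left_Bochner assms integrable_mult_left Bochner_integrable_norm) auto
  also have "\<dots> = (LINT y|M. norm (f y)) * norm ?x" by simp
  finally show ?thesis
    by (cases "norm ?x = 0") (auto intro: integral_nonneg_AE)
qed

lemma Bochner_integrable_simple:
  "Bochner_Integration.simple_bochner_integrable M s \<Longrightarrow> Bochner_integrable M s"
  using has_Bochner_integral_simple Bochner_integrable_def by blast

lemma Bochner_integrable_cong_AE:
  fixes f :: "'a \<Rightarrow> 'b::{real_normed_vector, complete_space}"
  assumes "complete_measure M" "Bochner_integrable M g" "AE x in M. f x = g x"
  shows "Bochner_integrable M f"
  by (rule Bochner_integrable_L1_limit[OF assms(1), of "\<lambda>_. g" "\<lambda>_ _. 0"])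
     (use assms in \<open>auto elim!: eventually_mono\<close>)

lemma Bochner_integrable_add:
  fixes f :: "'a \<Rightarrow> 'b::{real_normed_vector, complete_space}"
  assumes M: "complete_measure M" and f: "Bochner_integrable M f" and g: "Bochner_integrable M g"
  shows "Bochner_integrable M (\<lambda>x. f x + g x)"
proof -
  obtain s where s: "\<And>i::nat. Bochner_Integration.simple_bochner_integrable M (s i)"
    and slim: "(\<lambda>i. \<integral>\<^sup>+x. norm (f x - s i x) \<partial>M) \<longlonglongrightarrow> 0"
    using Bochner_integrable_approx[OF f] by blast
  obtain t where t: "\<And>i::nat. Bochner_Integration.simple_bochner_integrable M (t i)"
    and tlim: "(\<lambda>i. \<integral>\<^sup>+x. norm (g x - t i x) \<partial>M) \<longlonglongrightarrow> 0"
    using Bochner_integrable_approx[OF g] by blast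
  have [measurable]: "(\<lambda>x. norm (f x - s i x)) \<in> borel_measurable M" for i
    by (intro borel_measurable_norm_diff_simple borel_measurable_Bochner_integrable f
          simple_bochner_integrableD s)
  have [measurable]: "(\<lambda>x. norm (g x - t i x)) \<in> borel_measurable M" for i
    by (intro borel_measurable_norm_diff_simple borel_measurable_Bochner_integrable g
          simple_bochner_integrableD t)
  show ?thesis
  proof (rule Bochner_integrable_L1_limit[OF M])
    show "Bochner_integrable M (\<lambda>x. s i x + t i x)" for i
      by (intro Bochner_integrable_simple simple_bochner_integrable_compose2[of "(+)"] s t) simp
    show "(\<lambda>x. ennreal (norm (f x - s i x)) + ennreal (norm (g x - t i x))) \<in> borel_measurable M" for i
      by measurable
    show "AE x in M. ennreal (norm (f x + g x - (s i x + t i x)))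
        \<le> ennreal (norm (f x - s i x)) + ennreal (norm (g x - t i x))" for i
    proof (rule AE_I2)
      fix x
      have "norm (f x + g x - (s i x + t i x)) \<le> norm (f x - s i x) + norm (g x - t i x)"
        by (rule norm_diff_triangle_ineq)
      then show "ennreal (norm (f x + g x - (s i x + t i x)))
        \<le> ennreal (norm (f x - s i x)) + ennreal (norm (g x - t i x))"
        by (simp add: ennreal_leI flip: ennreal_plus)
    qed
    show "(\<lambda>i. \<integral>\<^sup>+x. ennreal (norm (f x - s i x)) + ennreal (norm (g x - t i x)) \<partial>M) \<longlonglongrightarrow> 0"
      using tendsto_add[OF slim tlim] by (simp add: nn_integral_add)
  qed
qed

lemma Bochner_integrable_scaleR_const:
  fixes c :: "'b::real_normed_vector" and h :: "'a \<Rightarrow> real"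
  assumes h: "integrable M h"
  shows "Bochner_integrable M (\<lambda>x. h x *\<^sub>R c)"
proof -
  have "has_Bochner_integral M h (integral\<^sup>L M h)"
    using has_bochner_integral_integrable[OF h] by (simp add: has_Bochner_integral_eq_library)
  then obtain s where s: "\<And>i::nat. Bochner_Integration.simple_bochner_integrable M (s i)"
    and lim: "(\<lambda>i. \<integral>\<^sup>+x. norm (h x - s i x) \<partial>M) \<longlonglongrightarrow> 0"
    and x: "(\<lambda>i. Bochner_Integration.simple_bochner_integral M (s i)) \<longlonglongrightarrow> integral\<^sup>L M h"
    by (auto simp: has_Bochner_integral_def)
  have [measurable]: "h \<in> borel_measurable M" using h by simp
  have [measurable]: "s i \<in> borel_measurable M" for i
    by (intro borel_measurable_simple_function simple_bochner_integrableD s)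
  have "has_Bochner_integral M (\<lambda>x. h x *\<^sub>R c) (integral\<^sup>L M h *\<^sub>R c)"
    unfolding has_Bochner_integral_def
  proof (intro conjI exI[of _ "\<lambda>i x. s i x *\<^sub>R c"] allI)
    show "(\<lambda>x. h x *\<^sub>R c) \<in> borel_measurable M"
      by (rule measurable_compose[OF _ borel_measurable_continuous_onI]) (auto intro!: continuous_intros)
    show "Bochner_Integration.simple_bochner_integrable M (\<lambda>x. s i x *\<^sub>R c)" for i
      using simple_bochner_integrable_compose2[of "\<lambda>x y. x *\<^sub>R c", OF _ s s] by simp
    have "(\<integral>\<^sup>+x. norm (h x *\<^sub>R c - s i x *\<^sub>R c) \<partial>M) = (\<integral>\<^sup>+x. norm (h x - s i x) \<partial>M) * ennreal (norm c)" for i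
      by (subst nn_integral_multc[symmetric]) (auto simp: ennreal_mult simp flip: scaleR_diff_left)
    then show "(\<lambda>i. \<integral>\<^sup>+x. norm (h x *\<^sub>R c - s i x *\<^sub>R c) \<partial>M) \<longlonglongrightarrow> 0"
      using ennreal_tendsto_cmult[OF _ lim, of "ennreal (norm c)"] by (simp add: mult.commute)
    have l: "linear (\<lambda>x. x *\<^sub>R c)" by (rule linear_scaleR_left)
    show "(\<lambda>i. Bochner_Integration.simple_bochner_integral M (\<lambda>x. s i x *\<^sub>R c)) \<longlonglongrightarrow> integral\<^sup>L M h *\<^sub>R c"
      unfolding simple_bochner_integral_linear[OF l s] by (intro tendsto_intros x)
  qed
  then show ?thesis by (auto simp: Bochner_integrable_def)
qed

lemma Bochner_integrable_sum:
  fixes f :: "'i \<Rightarrow> 'a \<Rightarrow> 'b::{real_normed_vector, complete_space}"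
  assumes "complete_measure M" "\<And>i. i \<in> I \<Longrightarrow> Bochner_integrable M (f i)"
  shows "Bochner_integrable M (\<lambda>x. \<Sum>i\<in>I. f i x)"
proof -
  have zero: "Bochner_integrable M (\<lambda>x. 0::'b)"
    using Bochner_integrable_scaleR_const[of M "\<lambda>_. 0" 0] by simp
  show ?thesis
  proof (cases "finite I")
    case True
    then show ?thesis using assms(2)
    proof (induction I)
      case (insert i I)
      have "Bochner_integrable M (\<lambda>x. f i x + (\<Sum>i\<in>I. f i x))"
        by (rule Bochner_integrable_add[OF assms(1)]) (use insert in auto)
      then show ?case using insert.hyps by simp
    qed (use zero in simp)
  qed (use zero in simp)
qed

text \<open>The value 0 is left out so that every set in the sum has finite measure when \<open>s\<close> is
  integrable.\<close>

lemma simple_function_eq_sum_indicator: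
  fixes s :: "'a \<Rightarrow> 'b::real_vector"
  assumes s: "simple_function M s" and x: "x \<in> space M"
  shows "s x = (\<Sum>y\<in>s ` space M - {0}. indicator {z\<in>space M. s z = y} x *\<^sub>R y)"
proof -
  have fin: "finite (s ` space M - {0})" using s by (auto simp: simple_function_def)
  have "(\<Sum>y\<in>s ` space M - {0}. indicat_real {z\<in>space M. s z = y} x *\<^sub>R y)
      = (\<Sum>y\<in>s ` space M - {0}. if y = s x then y else 0)"
    using x by (intro sum.cong) (auto split: split_indicator)
  also have "\<dots> = s x" using x by (simp add: sum.delta[OF fin])
  finally show ?thesis by simp
qed

lemma sets_Collect_simple_function:
  assumes "simple_function M s"
  shows "{x\<in>space M. P (s x)} \<in> sets M"
  using simple_functionD(2)[OF assms, of "Collect P"] by (simp add: vimage_def Int_def conj_commute)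

lemma Bochner_integrable_scaleR_bounded:
  fixes f :: "'a \<Rightarrow> 'b::{real_normed_vector, complete_space}" and h :: "'a \<Rightarrow> real"
  assumes M: "complete_measure M" and f: "Bochner_integrable M f"
    and h[measurable]: "h \<in> borel_measurable M" and C: "\<And>x. \<bar>h x\<bar> \<le> C"
  shows "Bochner_integrable M (\<lambda>x. h x *\<^sub>R f x)"
proof -
  obtain s where s: "\<And>i::nat. Bochner_Integration.simple_bochner_integrable M (s i)"
    and lim: "(\<lambda>i. \<integral>\<^sup>+x. norm (f x - s i x) \<partial>M) \<longlonglongrightarrow> 0"
    using Bochner_integrable_approx[OF f] by blast
  have [measurable]: "(\<lambda>x. norm (f x - s i x)) \<in> borel_measurable M" for i
    by (intro borel_measurable_norm_diff_simple borel_measurable_Bochner_integrable f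
          simple_bochner_integrableD s)
  have "C \<ge> 0" using C[of undefined] by linarith
  show ?thesis
  proof (rule Bochner_integrable_L1_limit[OF M])
    fix i
    have "Bochner_integrable M (\<lambda>x. \<Sum>y\<in>s i ` space M - {0}. (h x * indicator {z\<in>space M. s i z = y} x) *\<^sub>R y)"
    proof (intro Bochner_integrable_sum M Bochner_integrable_scaleR_const)
      fix y assume y: "y \<in> s i ` space M - {0}"
      have A[measurable]: "{z\<in>space M. s i z = y} \<in> sets M"
        by (intro sets_Collect_simple_function simple_bochner_integrableD s)
      have "emeasure M {z\<in>space M. s i z = y} \<le> emeasure M {z\<in>space M. s i z \<noteq> 0}"
        using y by (intro emeasure_mono sets_Collect_simple_function simple_bochner_integrableD s) auto
      also have "\<dots> < \<infinity>" using s[of i] by (auto simp: simple_bochner_integrable.simps less_top)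
      finally have "integrable M (\<lambda>x. C * indicator {z\<in>space M. s i z = y} x)"
        using A by (intro integrable_mult_right integrable_real_indicator) auto
      then show "integrable M (\<lambda>x. h x * indicator {z\<in>space M. s i z = y} x)"
        by (rule Bochner_Integration.integrable_bound) (use C \<open>C \<ge> 0\<close> in \<open>auto split: split_indicator\<close>)
    qed
    then show "Bochner_integrable M (\<lambda>x. h x *\<^sub>R s i x)"
    proof (rule Bochner_integrable_cong_AE[OF M], intro AE_I2)
      fix x assume "x \<in> space M"
      from simple_function_eq_sum_indicator[OF simple_bochner_integrableD[OF s] this, of i]
      have "h x *\<^sub>R s i x = h x *\<^sub>R (\<Sum>y\<in>s i ` space M - {0}. indicator {z\<in>space M. s i z = y} x *\<^sub>R y)"
        by (rule arg_cong)
      then show "h x *\<^sub>R s i x = (\<Sum>y\<in>s i ` space M - {0}. (h x * indicator {z\<in>space M. s i z = y} x) *\<^sub>R y)"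
        by (simp only: scaleR_sum_right scaleR_scaleR)
    qed
    show "(\<lambda>x. ennreal C * ennreal (norm (f x - s i x))) \<in> borel_measurable M" by measurable
    show "AE x in M. ennreal (norm (h x *\<^sub>R f x - h x *\<^sub>R s i x)) \<le> ennreal C * ennreal (norm (f x - s i x))"
      using C \<open>C \<ge> 0\<close>
      by (intro AE_I2) (auto simp: mult_right_mono simp flip: scaleR_diff_right ennreal_mult intro!: ennreal_leI)
  next
    show "(\<lambda>i. \<integral>\<^sup>+x. ennreal C * ennreal (norm (f x - s i x)) \<partial>M) \<longlonglongrightarrow> 0"
      using ennreal_tendsto_cmult[OF _ lim, of "ennreal C"] by (simp add: nn_integral_cmult)
  qed
qed

text \<open>Truncating \<open>h\<close> reduces the claim to bounded factors; dominated convergence supplies the error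
  bound of the \<open>L\<^sup>1\<close> criterion.\<close>

lemma Bochner_integrable_scaleR:
  fixes f :: "'a \<Rightarrow> 'b::{real_normed_vector, complete_space}" and h :: "'a \<Rightarrow> real"
  assumes M: "complete_measure M" and f: "Bochner_integrable M f"
    and h[measurable]: "h \<in> borel_measurable M" and int: "integrable M (\<lambda>x. h x * norm (f x))"
  shows "Bochner_integrable M (\<lambda>x. h x *\<^sub>R f x)"
proof (rule Bochner_integrable_L1_limit[OF M])
  have [measurable]: "(\<lambda>x. norm (f x)) \<in> borel_measurable M"
    using Bochner_integrable_norm[OF f] by simp
  define H where "H i x = (if \<bar>h x\<bar> \<le> real i then h x else 0)" for i x
  have [measurable]: "H i \<in> borel_measurable M" for i unfolding H_def by measurable
  show "Bochner_integrable M (\<lambda>x. H i x *\<^sub>R f x)" for i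
    by (rule Bochner_integrable_scaleR_bounded[OF M f, of _ "real i"]) (auto simp: H_def)
  show "(\<lambda>x. ennreal (\<bar>h x - H i x\<bar> * norm (f x))) \<in> borel_measurable M" for i by measurable
  show "AE x in M. ennreal (norm (h x *\<^sub>R f x - H i x *\<^sub>R f x)) \<le> ennreal (\<bar>h x - H i x\<bar> * norm (f x))" for i
    by (intro AE_I2) (simp flip: scaleR_diff_left)
  have "(\<lambda>i. \<integral>\<^sup>+x. ennreal (\<bar>h x - H i x\<bar> * norm (f x)) \<partial>M) \<longlonglongrightarrow> (\<integral>\<^sup>+x. 0 \<partial>M)"
  proof (rule nn_integral_dominated_convergence)
    show "(\<lambda>x. ennreal (\<bar>h x * norm (f x)\<bar>)) \<in> borel_measurable M" by measurable
    show "(\<integral>\<^sup>+x. ennreal (\<bar>h x * norm (f x)\<bar>) \<partial>M) < \<infinity>"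
      using int by (simp add: integrable_iff_bounded)
    show "AE x in M. ennreal (\<bar>h x - H j x\<bar> * norm (f x)) \<le> ennreal (\<bar>h x * norm (f x)\<bar>)" for j
      by (intro AE_I2 ennreal_leI) (auto simp: H_def abs_mult)
    show "AE x in M. (\<lambda>i. ennreal (\<bar>h x - H i x\<bar> * norm (f x))) \<longlonglongrightarrow> 0"
    proof (rule AE_I2)
      fix x
      obtain N where "\<bar>h x\<bar> \<le> real N" using real_arch_simple by blast
      then have "\<forall>\<^sub>F i in sequentially. 0 = ennreal (\<bar>h x - H i x\<bar> * norm (f x))"
        unfolding eventually_sequentially by (intro exI[of _ N]) (auto simp: H_def)
      then show "(\<lambda>i. ennreal (\<bar>h x - H i x\<bar> * norm (f x))) \<longlonglongrightarrow> 0"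
        using tendsto_cong tendsto_const by fast
    qed
  qed measurable
  then show "(\<lambda>i. \<integral>\<^sup>+x. ennreal (\<bar>h x - H i x\<bar> * norm (f x)) \<partial>M) \<longlonglongrightarrow> 0" by simp
qed

lemma borel_measurable_inner_Bochner:
  fixes f g :: "'a \<Rightarrow> 'b::real_inner"
  assumes M: "complete_measure M" and f: "Bochner_integrable M f" and g: "Bochner_integrable M g"
  shows "(\<lambda>x. f x \<bullet> g x) \<in> borel_measurable M"
proof -
  interpret complete_measure M by fact
  obtain s where s: "\<And>i::nat. Bochner_Integration.simple_bochner_integrable M (s i)"
    and lim: "AE x in M. (\<lambda>i. s i x) \<longlonglongrightarrow> g x"
    using Bochner_integrable_approx[OF g] by blast
  show ?thesis
  proof (rule borel_measurable_AE_limit)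
    show "(\<lambda>x. f x \<bullet> s i x) \<in> borel_measurable M" for i
      by (rule borel_measurable_compose_simple_function[OF borel_measurable_Bochner_integrable[OF f] simple_bochner_integrableD[OF s]])
         (intro continuous_intros)
    show "AE x in M. (\<lambda>i. f x \<bullet> s i x) \<longlonglongrightarrow> f x \<bullet> g x"
      using lim by eventually_elim (intro tendsto_intros)
  qed
qed

text \<open>The exceptional null set may depend on \<open>h\<close>. It suffices to consider the countably many values
  of a sequence of simple functions converging to \<open>f\<close>: at almost every point, \<open>f \<bullet> f\<close> is the limit of
  inner products of \<open>f\<close> with such values.\<close>

lemma AE_eq_0_if_inner_AE_eq_0:
  fixes f :: "'a \<Rightarrow> 'b::real_inner"
  assumes f: "Bochner_integrable M f" and z: "\<And>h. AE x in M. f x \<bullet> h = 0"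
  shows "AE x in M. f x = 0"
proof -
  obtain s where s: "\<And>i::nat. Bochner_Integration.simple_bochner_integrable M (s i)"
    and lim: "AE x in M. (\<lambda>i. s i x) \<longlonglongrightarrow> f x"
    using Bochner_integrable_approx[OF f] by blast
  define D where "D = (\<Union>i. s i ` space M)"
  have "countable D" unfolding D_def
    using simple_bochner_integrableD[OF s] by (auto simp: simple_function_def countable_finite)
  then have "AE x in M. \<forall>h\<in>D. f x \<bullet> h = 0"
    using z by (simp add: AE_ball_countable)
  with lim AE_space show ?thesis
  proof eventually_elim
    case (elim x)
    then have "(\<lambda>i. f x \<bullet> s i x) = (\<lambda>_. 0)" by (auto simp: D_def)
    moreover have "(\<lambda>i. f x \<bullet> s i x) \<longlonglongrightarrow> f x \<bullet> f x" using elim by (intro tendsto_intros)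
    ultimately have "f x \<bullet> f x = 0" by (simp add: LIMSEQ_const_iff)
    then show ?case by simp
  qed
qed

lemma Bochner_integrable_restrict_space:
  fixes f :: "'a \<Rightarrow> 'b::{real_normed_vector, complete_space}"
  assumes M: "complete_measure M" and f: "Bochner_integrable M f" and S: "S \<in> sets M"
  shows "Bochner_integrable (restrict_space M S) f"
proof -
  obtain s where s: "\<And>i::nat. Bochner_Integration.simple_bochner_integrable M (s i)"
    and lim: "(\<lambda>i. \<integral>\<^sup>+x. norm (f x - s i x) \<partial>M) \<longlonglongrightarrow> 0"
    using Bochner_integrable_approx[OF f] by blast
  have meas[measurable]: "(\<lambda>x. norm (f x - s i x)) \<in> borel_measurable M" for i
    by (intro borel_measurable_norm_diff_simple borel_measurable_Bochner_integrable f
          simple_bochner_integrableD s)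
  have S': "S \<inter> space M \<in> sets M" using S by simp
  show ?thesis
  proof (rule Bochner_integrable_L1_limit[OF complete_measure_restrict_space[OF M S]])
    fix i
    have ind: "simple_function M (indicat_real S)" using S by (rule simple_function_indicator)
    have "simple_function M (\<lambda>x. indicat_real S x *\<^sub>R s i x)"
      using simple_function_compose2[OF ind simple_bochner_integrableD[OF s], of "(*\<^sub>R)"] by simp
    moreover have "emeasure M {y \<in> space M. indicat_real S y *\<^sub>R s i y \<noteq> 0} \<le> emeasure M {y\<in>space M. s i y \<noteq> 0}"
      by (intro emeasure_mono sets_Collect_simple_function simple_bochner_integrableD s) auto
    then have "emeasure M {y \<in> space M. indicat_real S y *\<^sub>R s i y \<noteq> 0} \<noteq> \<infinity>"
      using s[of i] by (auto simp: simple_bochner_integrable.simps top_unique)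
    ultimately show "Bochner_integrable (restrict_space M S) (s i)"
      by (intro Bochner_integrable_simple simple_bochner_integrable_restrict_space[OF S', THEN iffD2]
          simple_bochner_integrable.intros)
    show "(\<lambda>x. ennreal (norm (f x - s i x))) \<in> borel_measurable (restrict_space M S)"
      by (rule measurable_restrict_space1) measurable
    show "AE x in restrict_space M S. ennreal (norm (f x - s i x)) \<le> ennreal (norm (f x - s i x))" by simp
  next
    show "(\<lambda>i. \<integral>\<^sup>+x. norm (f x - s i x) \<partial>restrict_space M S) \<longlonglongrightarrow> 0"
    proof (rule tendsto_sandwich[OF _ _ tendsto_const lim]; intro always_eventually allI zero_le)
      fix i show "(\<integral>\<^sup>+x. norm (f x - s i x) \<partial>restrict_space M S) \<le> (\<integral>\<^sup>+x. norm (f x - s i x) \<partial>M)"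
        unfolding nn_integral_restrict_space[OF S'] by (intro nn_integral_mono) (auto split: split_indicator)
    qed
  qed
qed

section \<open>Convolution of scalar functions\<close>

lemma AE_leb_iff: "(AE x in leb t. P x) \<longleftrightarrow> (AE x in lborel. x \<in> {0<..<t} \<longrightarrow> P x)"
  by (simp add: AE_restrict_space_iff AE_completion_iff)

lemma AE_leb_mono: "AE x in leb T. P x \<Longrightarrow> t \<le> T \<Longrightarrow> AE x in leb t. P x"
  unfolding AE_leb_iff by (auto elim!: eventually_mono)

lemma leb_eq_restrict_space: "t \<le> T \<Longrightarrow> leb t = restrict_space (leb T) {..<t}"
  by (subst restrict_restrict_space) (auto intro!: arg_cong[where f="restrict_space lebesgue"])

lemma sets_leb_lessThan: "{..<t} \<inter> space (leb T) \<in> sets (leb T)"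
  by (auto simp: sets_restrict_space)

lemma integrable_leb_iff:
  fixes f :: "real \<Rightarrow> real"
  assumes "t \<le> T"
  shows "integrable (leb t) f \<longleftrightarrow> integrable (leb T) (\<lambda>s. indicator {..<t} s * f s)"
  unfolding leb_eq_restrict_space[OF assms] by (simp add: integrable_restrict_space[OF sets_leb_lessThan])

lemma integral_leb_eq:
  fixes f :: "real \<Rightarrow> real"
  assumes "t \<le> T"
  shows "(LINT s|leb t. f s) = (LINT s|leb T. indicator {..<t} s * f s)"
  unfolding leb_eq_restrict_space[OF assms] by (simp add: integral_restrict_space[OF sets_leb_lessThan])

lemma integrable_leb_mono:
  fixes f :: "real \<Rightarrow> real"
  assumes "integrable (leb T) f" "t \<le> T"
  shows "integrable (leb t) f"
proof -
  have ind: "indicat_real {..<t} s = (if s < t then 1 else 0)" for s by simp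
  have [measurable]: "(\<lambda>s. s) \<in> borel_measurable (leb T)"
    using id_borel_measurable_lebesgue_on[of "{0<..<T}"] by (simp add: id_def)
  have i: "indicat_real {..<t} \<in> borel_measurable (leb T)" unfolding ind by measurable
  show ?thesis
    unfolding integrable_leb_iff[OF assms(2)]
    using assms(1) i
    by (intro Bochner_Integration.integrable_bound[OF assms(1)] borel_measurable_times)
       (auto split: split_indicator)
qed

lemma borel_measurable_id_leb: "(\<lambda>x. x) \<in> borel_measurable (leb T)"
  using id_borel_measurable_lebesgue_on[of "{0<..<T}"] by (simp add: id_def)

lemma finite_measure_leb: "finite_measure (leb T)"
  by (rule finite_measure_lebesgue_on) simp

lemma measure_leb: "0 \<le> T \<Longrightarrow> measure (leb T) {0<..<T} = T"
  by (simp add: measure_restrict_space)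

lemma AE_lborel_reflect:
  assumes "AE x in lborel. P x"
  shows "AE s in lborel. P (t - s :: real)"
proof -
  from AE_E3[OF assms] obtain N where N: "\<And>x. x \<notin> N \<Longrightarrow> P x" "N \<in> null_sets lborel" by auto
  have "AE x in lborel. x \<notin> N" using N(2) by (rule AE_not_in)
  moreover have "N \<in> sets borel" using N(2) by auto
  ultimately have "AE s in lborel. t + (-1) * s \<notin> N"
    by (intro AE_borel_affine[of "-1" "\<lambda>x. x \<notin> N"]) auto
  then show ?thesis by eventually_elim (use N(1) in auto)
qed

lemma
  fixes f :: "real \<Rightarrow> real"
  assumes f: "integrable (leb t) f"
  shows integrable_leb_reflect: "integrable (leb t) (\<lambda>s. f (t - s))"
    and integral_leb_reflect: "(LINT s|leb t. f (t - s)) = (LINT s|leb t. f s)"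
proof -
  let ?g = "\<lambda>s. indicator {0<..<t} s * f s"
  have meas: "(\<lambda>x. t + (-1) * x) \<in> lebesgue \<rightarrow>\<^sub>M lebesgue"
    using lebesgue_affine_measurable[of "\<lambda>_. -1" t] by simp
  have L: "lebesgue = distr lebesgue lebesgue (\<lambda>x. t + (-1) * x)"
    using lebesgue_real_affine[of "-1" t] by (simp add: density_1)
  have g: "integrable lebesgue ?g" using f by (simp add: integrable_restrict_space)
  have eq: "?g (t + (-1) * s) = indicator {0<..<t} s * f (t - s)" for s
    by (auto split: split_indicator)
  have "integrable lebesgue (\<lambda>s. ?g (t + (-1) * s))"
    using g integrable_distr[OF meas, of ?g] L by simp
  then show "integrable (leb t) (\<lambda>s. f (t - s))"
    unfolding eq by (simp add: integrable_restrict_space)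
  have "(LINT s|lebesgue. ?g s) = (LINT s|lebesgue. ?g (t + (-1) * s))"
    by (subst L) (rule integral_distr[OF meas], use g in simp)
  then show "(LINT s|leb t. f (t - s)) = (LINT s|leb t. f s)"
    unfolding eq by (simp add: integral_restrict_space)
qed

text \<open>Translates of a Lebesgue measurable function are jointly measurable in both variables only after
  passing to a Borel version; extension by 0 keeps translates inside the integration domain.\<close>

lemma borel_representative:
  assumes a: "integrable (leb T) a"
  obtains b :: "real \<Rightarrow> real" where "b \<in> borel_measurable borel" "integrable lborel b"
    "AE x in lborel. x \<in> {0<..<T} \<longrightarrow> a x = b x" "\<And>x. x \<notin> {0<..<T} \<Longrightarrow> b x = 0"
proof -
  have g: "integrable lebesgue (\<lambda>x. indicator {0<..<T} x * a x)"
    using a by (simp add: integrable_restrict_space)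
  then obtain g' where [measurable]: "g' \<in> borel_measurable lborel"
    and ae: "AE x in lborel. indicator {0<..<T} x * a x = g' x"
    using completion_ex_borel_measurable_real[of "\<lambda>x. indicator {0<..<T} x * a x" lborel] by auto
  define b where "b x = indicator {0<..<T} x * g' x" for x
  have b[measurable]: "b \<in> borel_measurable borel" unfolding b_def by measurable
  have ae': "AE x in lborel. indicator {0<..<T} x * a x = b x"
    using ae by eventually_elim (auto simp: b_def split: split_indicator)
  have "integrable lebesgue b"
    by (rule integrable_cong_AE_imp[OF g]) (use ae' in \<open>auto intro!: measurable_completion AE_completion elim!: eventually_mono\<close>)
  then have "integrable lborel b" by (simp add: integrable_completion)
  moreover have "AE x in lborel. x \<in> {0<..<T} \<longrightarrow> a x = b x"
    using ae' by eventually_elim auto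
  ultimately show thesis using that[OF b] by (auto simp: b_def)
qed

context
  fixes T :: real and a b :: "real \<Rightarrow> real"
  assumes a: "integrable (leb T) a" and b: "integrable (leb T) b"
begin

interpretation pair_sigma_finite "leb T" "leb T"
  using finite_measure.axioms(1)[OF finite_measure_leb] by (simp add: pair_sigma_finite_def)

text \<open>Exchange of the order of integration over the triangle \<open>0 < s < r < T\<close>. The indicator keeps
  both integrals on \<open>(0,T)\<close>, so that Fubini's theorem can be applied on the square.\<close>

lemma Fubini_triangle:
  shows "(LINT r|leb T. a r * (LINT s|leb r. b s)) = (LINT s|leb T. (LINT r|leb T. indicator {s<..} r * a r) * b s)"
proof -
  have [measurable]: "a \<in> borel_measurable (leb T)" "b \<in> borel_measurable (leb T)" using a b by auto
  have ind: "indicator {s<..} r = (if s < r then 1 else 0 :: real)" for r s :: real by simp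
  have m: "(\<lambda>(r, s). indicator {s<..} r * a r * b s) \<in> borel_measurable (leb T \<Otimes>\<^sub>M leb T)"
    unfolding ind using borel_measurable_id_leb[measurable] by measurable
  have int: "integrable (leb T \<Otimes>\<^sub>M leb T) (\<lambda>(r, s). indicator {s<..} r * a r * b s)"
  proof (rule Bochner_Integration.integrable_bound[OF _ m])
    show "integrable (leb T \<Otimes>\<^sub>M leb T) (\<lambda>(r, s). a r * b s)"
    proof (rule Fubini_integrable)
      show "integrable (leb T) (\<lambda>r. LINT s|leb T. norm (case (r, s) of (r, s) \<Rightarrow> a r * b s))"
        using a by (simp add: abs_mult)
    qed (use a b in auto)
    show "AE x in leb T \<Otimes>\<^sub>M leb T. norm (case x of (r, s) \<Rightarrow> indicator {s<..} r * a r * b s)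
        \<le> norm (case x of (r, s) \<Rightarrow> a r * b s)"
      by (intro AE_I2) (auto split: split_indicator)
  qed
  have "(LINT r|leb T. a r * (LINT s|leb r. b s)) = (LINT r|leb T. (LINT s|leb T. indicator {s<..} r * a r * b s))"
  proof (rule Bochner_Integration.integral_cong[OF refl])
    fix r assume "r \<in> space (leb T)"
    then have "(LINT s|leb r. b s) = (LINT s|leb T. indicator {..<r} s * b s)"
      by (intro integral_leb_eq) simp
    also have "a r * \<dots> = (LINT s|leb T. a r * (indicator {..<r} s * b s))" by simp
    also have "\<dots> = (LINT s|leb T. indicator {s<..} r * a r * b s)"
      by (intro Bochner_Integration.integral_cong) (auto split: split_indicator)
    finally show "a r * (LINT s|leb r. b s) = (LINT s|leb T. indicator {s<..} r * a r * b s)" .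
  qed
  also have "\<dots> = (LINT s|leb T. (LINT r|leb T. indicator {s<..} r * a r * b s))"
    by (rule Fubini_integral[symmetric, OF int])
  finally show ?thesis by simp
qed

text \<open>Fubini's theorem for \<open>(s, t) \<mapsto> a'(t - s) b(s)\<close> on the square, where \<open>a'\<close> is a Borel version of
  \<open>a\<close> extended by 0: since \<open>a'\<close> vanishes on the negative axis, integrating over the square is
  integrating over the triangle \<open>s < t\<close>. For fixed \<open>t\<close> the passage from \<open>a\<close> to \<open>a'\<close> is harmless
  because reflections preserve null sets.\<close>

lemma
  shows AE_integrable_conv: "AE t in leb T. integrable (leb t) (\<lambda>s. a (t - s) * b s)"
    and integrable_conv: "integrable (leb T) (\<lambda>t. LINT s|leb t. a (t - s) * b s)"
    and integral_conv_full: "(LINT t|leb T. LINT s|leb t. a (t - s) * b s)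
       = (LINT s|leb T. (LINT q|leb (T - s). a q) * b s)"
proof -
  obtain a' where [measurable]: "a' \<in> borel_measurable borel" and a': "integrable lborel a'"
    "AE x in lborel. x \<in> {0<..<T} \<longrightarrow> a x = a' x" "\<And>x. x \<notin> {0<..<T} \<Longrightarrow> a' x = 0"
    using borel_representative[OF a] by blast
  have [measurable]: "b \<in> borel_measurable (leb T)" using b by auto
  have sh: "integrable lebesgue (\<lambda>t. a' (t - s))" for s
    using lborel_integrable_real_affine[OF a'(1), of 1 "-s"] by (simp add: integrable_completion)
  have sh_int: "(LINT t|lebesgue. \<bar>a' (t - s)\<bar>) = (LINT t|lebesgue. \<bar>a' t\<bar>)" for s
    using lborel_integral_real_affine[of 1 "\<lambda>t. \<bar>a' t\<bar>" "-s"] by (simp add: integral_completion)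
  have shT: "integrable (leb T) (\<lambda>t. a' (t - s))" for s
    using integrable_mult_indicator[OF _ sh, of "{0<..<T}" s] by (simp add: integrable_restrict_space)
  have sh_le: "(LINT t|leb T. \<bar>a' (t - s)\<bar>) \<le> (LINT t|lebesgue. \<bar>a' t\<bar>)" for s
  proof -
    have "(LINT t|leb T. \<bar>a' (t - s)\<bar>) = (LINT t|lebesgue. indicator {0<..<T} t * \<bar>a' (t - s)\<bar>)"
      by (simp add: integral_restrict_space)
    also have "\<dots> \<le> (LINT t|lebesgue. \<bar>a' (t - s)\<bar>)"
      using sh[of s] by (intro integral_mono_AE') (auto split: split_indicator)
    finally show ?thesis using sh_int by simp
  qed
  have m: "(\<lambda>(s, t). a' (t - s) * b s) \<in> borel_measurable (leb T \<Otimes>\<^sub>M leb T)"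
    using borel_measurable_id_leb[measurable] by measurable
  have int: "integrable (leb T \<Otimes>\<^sub>M leb T) (\<lambda>(s, t). a' (t - s) * b s)"
  proof (rule Fubini_integrable[OF m])
    have m': "(\<lambda>s. LINT t|leb T. norm (case (s, t) of (s, t) \<Rightarrow> a' (t - s) * b s)) \<in> borel_measurable (leb T)"
      using M1.borel_measurable_lebesgue_integral[of "\<lambda>s t. norm (a' (t - s) * b s)"]
        measurable_compose[OF m borel_measurable_norm] by (simp add: split_beta')
    show "integrable (leb T) (\<lambda>s. LINT t|leb T. norm (case (s, t) of (s, t) \<Rightarrow> a' (t - s) * b s))"
    proof (rule Bochner_Integration.integrable_bound[OF _ m'])
      show "integrable (leb T) (\<lambda>s. (LINT t|lebesgue. \<bar>a' t\<bar>) * \<bar>b s\<bar>)" using b by simp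
      show "AE s in leb T. norm (LINT t|leb T. norm (case (s, t) of (s, t) \<Rightarrow> a' (t - s) * b s))
          \<le> norm ((LINT t|lebesgue. \<bar>a' t\<bar>) * \<bar>b s\<bar>)"
        using sh_le by (intro AE_I2) (auto simp: abs_mult intro!: mult_right_mono)
    qed
    show "AE s in leb T. integrable (leb T) (\<lambda>t. case (s, t) of (s, t) \<Rightarrow> a' (t - s) * b s)"
      using shT by simp
  qed
  have a'm[measurable]: "(\<lambda>s. a' (t - s)) \<in> borel_measurable (leb r)" for t r
    by (rule measurable_restrict_space1, rule measurable_completion) measurable
  have eqAE: "AE s in leb t. a (t - s) * b s = a' (t - s) * b s" if "t \<le> T" for t
    unfolding AE_leb_iff using AE_lborel_reflect[OF a'(2), of t] that
    by eventually_elim (use that in auto)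
  have am: "(\<lambda>s. a (t - s) * b s) \<in> borel_measurable (leb t)" if "t \<le> T" for t
  proof -
    interpret complete_measure "leb t" by (rule complete_measure_leb)
    have [measurable]: "b \<in> borel_measurable (leb t)" using integrable_leb_mono[OF b that] by simp
    show ?thesis by (rule measurable_cong_AE[OF _ eqAE[OF that]]) auto
  qed
  have a'0: "indicator {..<t} s * (a' (t - s) * b s) = a' (t - s) * b s" for t s
    using a'(3)[of "t - s"] by (auto split: split_indicator)
  have i_iff: "integrable (leb t) (\<lambda>s. a (t - s) * b s) \<longleftrightarrow> integrable (leb T) (\<lambda>s. a' (t - s) * b s)"
    and i_eq: "(LINT s|leb t. a (t - s) * b s) = (LINT s|leb T. a' (t - s) * b s)" if "t \<le> T" for t
  proof -
    have [measurable]: "b \<in> borel_measurable (leb t)" using integrable_leb_mono[OF b that] by simp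
    have "integrable (leb t) (\<lambda>s. a (t - s) * b s) \<longleftrightarrow> integrable (leb t) (\<lambda>s. a' (t - s) * b s)"
      by (rule integrable_cong_AE[OF am[OF that] _ eqAE[OF that]]) measurable
    then show "integrable (leb t) (\<lambda>s. a (t - s) * b s) \<longleftrightarrow> integrable (leb T) (\<lambda>s. a' (t - s) * b s)"
      by (simp only: integrable_leb_iff[OF that] a'0)
    have "(LINT s|leb t. a (t - s) * b s) = (LINT s|leb t. a' (t - s) * b s)"
      by (rule integral_cong_AE[OF am[OF that] _ eqAE[OF that]]) measurable
    then show "(LINT s|leb t. a (t - s) * b s) = (LINT s|leb T. a' (t - s) * b s)"
      by (simp only: integral_leb_eq[OF that] a'0)
  qed
  have "AE t in leb T. integrable (leb T) (\<lambda>s. a' (t - s) * b s)"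
    by (rule AE_integrable_snd[OF int])
  with AE_space show "AE t in leb T. integrable (leb t) (\<lambda>s. a (t - s) * b s)"
    by eventually_elim (simp add: i_iff)
  have "integrable (leb T) (\<lambda>t. LINT s|leb T. a' (t - s) * b s)" by (rule integrable_snd[OF int])
  then show "integrable (leb T) (\<lambda>t. LINT s|leb t. a (t - s) * b s)"
    by (rule Bochner_Integration.integrable_cong[THEN iffD1, rotated 2]) (simp_all add: i_eq)
  have "(LINT t|leb T. LINT s|leb t. a (t - s) * b s) = (LINT t|leb T. LINT s|leb T. a' (t - s) * b s)"
    by (rule Bochner_Integration.integral_cong) (simp_all add: i_eq)
  also have "\<dots> = (LINT s|leb T. LINT t|leb T. a' (t - s) * b s)"
    by (rule Fubini_integral[OF int])
  also have "\<dots> = (LINT s|leb T. (LINT q|leb (T - s). a q) * b s)"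
  proof (rule Bochner_Integration.integral_cong[OF refl])
    fix s assume s: "s \<in> space (leb T)"
    have "(LINT t|leb T. a' (t - s)) = (LINT t|lebesgue. indicator {0<..<T} t * a' (t - s))"
      by (simp add: integral_restrict_space)
    also have "\<dots> = (LINT t|lborel. indicator {0<..<T} t * a' (t - s))"
      by (rule integral_completion) measurable
    also have "\<dots> = (LINT t|lborel. indicator {0<..<T} (s + 1 * t) * a' (s + 1 * t - s))"
      using lborel_integral_real_affine[of 1 "\<lambda>t. indicator {0<..<T} t * a' (t - s)" s] by simp
    also have "\<dots> = (LINT t|lborel. indicator {0<..<T-s} t * a' t)"
    proof (rule Bochner_Integration.integral_cong[OF refl])
      fix t show "indicator {0<..<T} (s + 1 * t) * a' (s + 1 * t - s) = indicator {0<..<T-s} t * a' t"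
        using s a'(3)[of t] by (cases "t > 0") (auto split: split_indicator)
    qed
    also have "\<dots> = (LINT t|lebesgue. indicator {0<..<T-s} t * a' t)"
      by (rule integral_completion[symmetric]) measurable
    also have "\<dots> = (LINT q|leb (T - s). a' q)" by (simp add: integral_restrict_space)
    also have "\<dots> = (LINT q|leb (T - s). a q)"
    proof (rule integral_cong_AE)
      show "a \<in> borel_measurable (leb (T - s))"
        using integrable_leb_mono[OF a, of "T - s"] s by simp
      show "AE x in leb (T - s). a' x = a x"
        unfolding AE_leb_iff using a'(2) by eventually_elim (use s in auto)
      show "a' \<in> borel_measurable (leb (T - s))"
        by (rule measurable_restrict_space1, rule measurable_completion) simp
    qed
    finally show "(LINT t|leb T. a' (t - s) * b s) = (LINT q|leb (T - s). a q) * b s" by simp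
  qed
  finally show "(LINT t|leb T. LINT s|leb t. a (t - s) * b s)
       = (LINT s|leb T. (LINT q|leb (T - s). a q) * b s)" .
qed

end

lemma integral_conv:
  fixes a b :: "real \<Rightarrow> real"
  assumes "integrable (leb T) a" "integrable (leb T) b" "t \<le> T"
  shows "(LINT r|leb t. LINT s|leb r. a (r - s) * b s) = (LINT s|leb t. (LINT q|leb (t - s). a q) * b s)"
  using assms by (intro integral_conv_full) (auto intro: integrable_leb_mono)

section \<open>Functions with nondecreasing primitive\<close>

lemma continuous_on_integral_leb:
  fixes f :: "real \<Rightarrow> real"
  assumes f: "integrable (leb T) f"
  shows "continuous_on {..T} (\<lambda>t. LINT s|leb t. f s)"
  unfolding continuous_on_sequentially comp_def
proof (intro ballI allI impI, elim conjE)
  fix x a assume a: "a \<in> {..T}" and x: "\<forall>n. x n \<in> {..T}" and lim: "x \<longlonglongrightarrow> a"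
  have i: "integrable (leb T) (\<lambda>s. indicator {..<t} s * f s)" if "t \<le> T" for t
    using integrable_leb_mono[OF f that] integrable_leb_iff[OF that] by blast
  have "AE s in lborel. s \<noteq> a" by (rule AE_lborel_singleton)
  then have ne: "AE s in leb T. s \<noteq> a" unfolding AE_leb_iff by (auto elim!: eventually_mono)
  have "(\<lambda>n. LINT s|leb T. indicator {..<x n} s * f s) \<longlonglongrightarrow> (LINT s|leb T. indicator {..<a} s * f s)"
  proof (rule integral_dominated_convergence[where w="\<lambda>s. \<bar>f s\<bar>"])
    show "AE s in leb T. (\<lambda>n. indicator {..<x n} s * f s) \<longlonglongrightarrow> indicator {..<a} s * f s"
      using ne
    proof eventually_elim
      case (elim s)
      then have "\<forall>\<^sub>F n in sequentially. indicator {..<x n} s * f s = indicator {..<a} s * f s"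
      proof (cases "s < a")
        case True
        show ?thesis using order_tendstoD(1)[OF lim True] by eventually_elim (use True in simp)
      next
        case False
        then have "a < s" using elim by simp
        show ?thesis using order_tendstoD(2)[OF lim \<open>a < s\<close>] by eventually_elim (use False in simp)
      qed
      then show ?case by (rule tendsto_eventually)
    qed
    show "AE s in leb T. norm (indicator {..<x n} s * f s) \<le> \<bar>f s\<bar>" for n
      by (intro AE_I2) (auto split: split_indicator)
  qed (use i x a f in auto)
  then show "(\<lambda>n. LINT s|leb (x n). f s) \<longlonglongrightarrow> (LINT s|leb a. f s)"
    using integral_leb_eq[of "x _" T f] integral_leb_eq[of a T f] x a by (simp only: atMost_iff)
qed

lemma AE_leb_meets_interval:
  assumes ae: "AE t in leb T. t \<in> S" and "0 \<le> c" "c < d" "d \<le> T"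
  obtains t where "t \<in> S" "c < t" "t < d"
proof -
  have "\<exists>t\<in>S. c < t \<and> t < d"
  proof (rule ccontr)
    assume *: "\<not> ?thesis"
    have "AE t in lborel. t \<notin> {c<..<d}"
      using ae[unfolded AE_leb_iff] by eventually_elim (use * assms in auto)
    then have "{c<..<d} \<in> null_sets lborel" by (subst (asm) AE_iff_null_sets[symmetric]) auto
    then show False using \<open>c < d\<close> by (simp add: null_sets_def)
  qed
  then show thesis using that by blast
qed

text \<open>Continuity extends monotonicity from a set of full measure to the closed interval. It is used
  with \<open>S\<close> the set where a continuous and a monotone representative agree.\<close>

lemma mono_if_mono_AE:
  fixes G :: "real \<Rightarrow> real"
  assumes G: "continuous_on {0..T} G" and ae: "AE t in leb T. t \<in> S"
    and mono: "\<And>s t. s \<in> S \<Longrightarrow> t \<in> S \<Longrightarrow> 0 < s \<Longrightarrow> s < t \<Longrightarrow> t < T \<Longrightarrow> G s \<le> G t"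
    and st: "0 \<le> s" "s \<le> t" "t \<le> T"
  shows "G s \<le> G t"
proof (cases "s = t")
  case False
  then have "s < t" using st by simp
  define m where "m = (s + t) / 2"
  have m: "s < m" "m < t" using \<open>s < t\<close> by (auto simp: m_def)
  define \<delta> where "\<delta> n = (m - s) / Suc n" for n
  have \<delta>: "\<delta> n > 0" "\<delta> n \<le> m - s" for n
  proof -
    show "\<delta> n > 0" using m by (simp add: \<delta>_def)
    show "\<delta> n \<le> m - s" unfolding \<delta>_def using m by (simp add: divide_le_eq mult_le_cancel_left1)
  qed
  have \<delta>lim: "\<delta> \<longlonglongrightarrow> 0" unfolding \<delta>_def
    using tendsto_mult[OF tendsto_const[of "m - s"] LIMSEQ_Suc[OF lim_1_over_n]] by simp
  have mts: "m - s = t - m" by (simp add: m_def field_simps)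
  have "\<exists>x\<in>S. s < x \<and> x < s + \<delta> n" for n
  proof -
    have "s < s + \<delta> n" "s + \<delta> n \<le> T" using \<delta>[of n] st m by auto
    then show ?thesis using AE_leb_meets_interval[OF ae, of s "s + \<delta> n"] st by metis
  qed
  then obtain x where x: "\<And>n. x n \<in> S" "\<And>n. s < x n" "\<And>n. x n < s + \<delta> n" by metis
  have "\<exists>y\<in>S. t - \<delta> n < y \<and> y < t" for n
  proof -
    have "0 \<le> t - \<delta> n" "t - \<delta> n < t" using \<delta>[of n] mts st m by auto
    then show ?thesis using AE_leb_meets_interval[OF ae, of "t - \<delta> n" t] st by metis
  qed
  then obtain y where y: "\<And>n. y n \<in> S" "\<And>n. t - \<delta> n < y n" "\<And>n. y n < t" by metis
  have xl: "x \<longlonglongrightarrow> s"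
  proof (rule tendsto_sandwich[OF _ _ tendsto_const])
    show "(\<lambda>n. s + \<delta> n) \<longlonglongrightarrow> s" using tendsto_add[OF tendsto_const \<delta>lim, of s] by simp
  qed (use x in \<open>auto intro!: always_eventually less_imp_le\<close>)
  have yl: "y \<longlonglongrightarrow> t"
  proof (rule tendsto_sandwich[OF _ _ _ tendsto_const])
    show "(\<lambda>n. t - \<delta> n) \<longlonglongrightarrow> t" using tendsto_diff[OF tendsto_const \<delta>lim, of t] by simp
  qed (use y in \<open>auto intro!: always_eventually less_imp_le\<close>)
  have xm: "x n < m" "m < y n" for n using x(3)[of n] y(2)[of n] \<delta>(2)[of n] mts by auto
  have "x n \<in> {0..T}" "y n \<in> {0..T}" for n
    using xm[of n] x(2)[of n] y(3)[of n] st m by auto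
  then have "(\<lambda>n. G (x n)) \<longlonglongrightarrow> G s" "(\<lambda>n. G (y n)) \<longlonglongrightarrow> G t"
    using continuous_on_tendsto_compose[OF G xl] continuous_on_tendsto_compose[OF G yl] st by auto
  moreover have "G (x n) \<le> G (y n)" for n
    using mono[OF x(1) y(1), of n n] x(2)[of n] y(3)[of n] xm[of n] st by simp
  ultimately show ?thesis by (intro LIMSEQ_le) auto
qed simp

text \<open>A monotone primitive has an almost everywhere nonnegative density. Let \<open>\<mu>\<close> be the
  Lebesgue-Stieltjes measure of the primitive, and \<open>P\<close>, \<open>N\<close> the measures whose densities are the positive
  and the negative part of (a Borel version of) \<open>f\<close>. On intervals \<open>\<mu> + N = P\<close>, hence on all Borel sets
  by Dynkin's lemma. As \<open>P\<close> vanishes on \<open>{f < 0}\<close>, so does \<open>N\<close>, which makes this set null.\<close>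

lemma AE_nonneg_if_integral_mono:
  fixes f :: "real \<Rightarrow> real"
  assumes f: "integrable (leb T) f"
    and mono: "\<And>a b. 0 \<le> a \<Longrightarrow> a \<le> b \<Longrightarrow> b \<le> T \<Longrightarrow> (LINT s|leb a. f s) \<le> (LINT s|leb b. f s)"
  shows "AE s in leb T. 0 \<le> f s"
proof (cases "0 \<le> T")
  case False
  then show ?thesis by (simp add: AE_leb_iff)
next
  case T: True
  obtain g where [measurable]: "g \<in> borel_measurable borel" and g: "integrable lborel g"
    "AE x in lborel. x \<in> {0<..<T} \<longrightarrow> f x = g x" "\<And>x. x \<notin> {0<..<T} \<Longrightarrow> g x = 0"
    using borel_representative[OF f] by blast
  define G where "G x = (LINT s|leb (min x T). f s)" for x
  have G0: "G x = 0" if "x \<le> 0" for x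
  proof -
    have "{0<..<min x T} = {}" using that T by auto
    then show ?thesis unfolding G_def by (simp only: integral_lebesgue_on_empty)
  qed
  have G_mono: "G x \<le> G y" if "x \<le> y" for x y
  proof (cases "x \<le> 0")
    case True
    show ?thesis
    proof (cases "y \<le> 0")
      case False
      then show ?thesis using G0[OF True] mono[of 0 "min y T"] T by (simp add: G_def)
    qed (use G0 True in simp)
  next
    case False
    then show ?thesis using mono[of "min x T" "min y T"] that T by (simp add: G_def)
  qed
  have G_cont: "continuous (at_right a) G" for a
  proof -
    have "continuous_on UNIV G" unfolding G_def
      by (rule continuous_on_compose2[OF continuous_on_integral_leb[OF f]]) (auto intro!: continuous_intros)
    then show ?thesis by (simp add: continuous_on_eq_continuous_at continuous_at_imp_continuous_within)
  qed
  have G_eq: "G x = (LINT s|lborel. indicator {..x} s * g s)" for x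
  proof -
    have "G x = (LINT s|lebesgue. indicator {0<..<min x T} s * f s)"
      unfolding G_def by (simp add: integral_restrict_space)
    also have "\<dots> = (LINT s|lebesgue. indicator {..x} s * g s)"
    proof (rule integral_cong_AE)
      have "integrable lebesgue (\<lambda>s. indicator {0<..<min x T} s * f s)"
        using integrable_leb_mono[OF f, of "min x T"] by (simp add: integrable_restrict_space)
      then show "(\<lambda>s. indicator {0<..<min x T} s * f s) \<in> borel_measurable lebesgue" by simp
      show "(\<lambda>s. indicator {..x} s * g s) \<in> borel_measurable lebesgue"
        by (rule measurable_completion) measurable
      have "AE s in lborel. s \<noteq> x" by (rule AE_lborel_singleton)
      with g(2) have "AE s in lborel. indicator {0<..<min x T} s * f s = indicator {..x} s * g s"
        by eventually_elim (use g(3) in \<open>auto split: split_indicator\<close>)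
      then show "AE s in lebesgue. indicator {0<..<min x T} s * f s = indicator {..x} s * g s"
        by (rule AE_completion)
    qed
    also have "\<dots> = (LINT s|lborel. indicator {..x} s * g s)"
      by (rule integral_completion) measurable
    finally show ?thesis .
  qed
  define \<mu> where "\<mu> = interval_measure G"
  define P where "P = density lborel (\<lambda>x. ennreal (g x))"
  define N where "N = density lborel (\<lambda>x. ennreal (- g x))"
  have s[simp, measurable_cong]: "sets \<mu> = sets borel" "sets P = sets borel" "sets N = sets borel"
    by (auto simp: \<mu>_def P_def N_def)
  have gi: "integrable lborel (\<lambda>s. indicator A s * h s)" if "A \<in> sets borel" "integrable lborel h"
    for A and h :: "real \<Rightarrow> real" using integrable_mult_indicator[of A lborel h] that by simp
  have pos: "integrable lborel (\<lambda>s. max 0 (g s))" "integrable lborel (\<lambda>s. max 0 (- g s))"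
    using g(1) by auto
  have P_eq: "emeasure P A = ennreal (LINT s|lborel. indicator A s * max 0 (g s))"
    and N_eq: "emeasure N A = ennreal (LINT s|lborel. indicator A s * max 0 (- g s))"
    if [measurable]: "A \<in> sets borel" for A
  proof -
    have "emeasure P A = (\<integral>\<^sup>+s. ennreal (indicator A s * max 0 (g s)) \<partial>lborel)"
      unfolding P_def by (subst emeasure_density)
        (auto intro!: nn_integral_cong split: split_indicator simp: max_def ennreal_neg)
    then show "emeasure P A = ennreal (LINT s|lborel. indicator A s * max 0 (g s))"
      using gi[OF that pos(1)] by (subst nn_integral_eq_integral[symmetric]) auto
    have "emeasure N A = (\<integral>\<^sup>+s. ennreal (indicator A s * max 0 (- g s)) \<partial>lborel)"
      unfolding N_def by (subst emeasure_density)
        (auto intro!: nn_integral_cong split: split_indicator simp: max_def ennreal_neg)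
    then show "emeasure N A = ennreal (LINT s|lborel. indicator A s * max 0 (- g s))"
      using gi[OF that pos(2)] by (subst nn_integral_eq_integral[symmetric]) auto
  qed
  \<comment> \<open>Complements in Dynkin's lemma require finite measures, whence the restriction to a bounded
    interval containing \<open>(0,T)\<close>.\<close>
  define X where "X = {-1<..T}"
  have Ioc: "emeasure \<mu> {a<..b} + emeasure N {a<..b} = emeasure P {a<..b}" for a b
  proof (cases "a \<le> b")
    case True
    have "G b - G a = (LINT s|lborel. indicator {..b} s * g s - indicator {..a} s * g s)"
      unfolding G_eq by (rule Bochner_Integration.integral_diff[symmetric]) (auto intro!: gi g)
    also have "\<dots> = (LINT s|lborel. indicator {a<..b} s * max 0 (g s) - indicator {a<..b} s * max 0 (- g s))"
      using True by (intro Bochner_Integration.integral_cong) (auto split: split_indicator simp: max_def)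
    also have "\<dots> = (LINT s|lborel. indicator {a<..b} s * max 0 (g s)) - (LINT s|lborel. indicator {a<..b} s * max 0 (- g s))"
      by (rule Bochner_Integration.integral_diff) (auto intro!: gi pos)
    finally have *: "G b - G a + (LINT s|lborel. indicator {a<..b} s * max 0 (- g s)) = (LINT s|lborel. indicator {a<..b} s * max 0 (g s))"
      by simp
    have "emeasure \<mu> {a<..b} = ennreal (G b - G a)"
      unfolding \<mu>_def by (rule emeasure_interval_measure_Ioc[OF True G_mono G_cont])
    then show ?thesis
      using G_mono[OF True] by (simp add: P_eq N_eq *[symmetric] flip: ennreal_plus)
  qed simp
  have fin: "emeasure \<mu> (A \<inter> X) \<noteq> \<infinity>" "emeasure N (A \<inter> X) \<noteq> \<infinity>" "emeasure P (A \<inter> X) \<noteq> \<infinity>"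
    if "A \<in> sets borel" for A
  proof -
    have "emeasure \<mu> (A \<inter> X) \<le> emeasure \<mu> X"
      by (intro emeasure_mono) (auto simp: X_def)
    also have "\<dots> < \<infinity>" unfolding \<mu>_def X_def
      using T by (subst emeasure_interval_measure_Ioc[OF _ G_mono G_cont]) auto
    finally show "emeasure \<mu> (A \<inter> X) \<noteq> \<infinity>" by simp
    have "A \<inter> X \<in> sets borel" using that by (auto simp: X_def)
    then show "emeasure N (A \<inter> X) \<noteq> \<infinity>" "emeasure P (A \<inter> X) \<noteq> \<infinity>"
      by (simp_all add: P_eq N_eq)
  qed
  have X[measurable]: "X \<in> sets borel" by (simp add: X_def)
  have XX: "emeasure \<mu> X + emeasure N X = emeasure P X" unfolding X_def by (rule Ioc)
  have main: "emeasure \<mu> (A \<inter> X) + emeasure N (A \<inter> X) = emeasure P (A \<inter> X)" if "A \<in> sets borel" for A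
  proof -
    let ?E = "range (\<lambda>(a, b). {a <.. b::real})"
    have SS: "sets (borel :: real measure) = sigma_sets UNIV ?E"
      by (subst borel_sigma_sets_Ioc) (simp add: sets_measure_of_conv)
    have subset_Pow: "?E \<subseteq> Pow UNIV" by simp
    have Int: "Int_stable ?E"
    proof (rule Int_stableI)
      fix a b assume "a \<in> ?E" "b \<in> ?E"
      then obtain a1 a2 b1 b2 where ab: "a = {a1<..a2}" "b = {b1<..b2}" by auto
      have "a \<inter> b = {max a1 b1<..min a2 b2}" unfolding ab by auto
      then show "a \<inter> b \<in> ?E" by (metis (no_types, lifting) case_prod_conv rangeI)
    qed
    from Int subset_Pow that[unfolded SS] show ?thesis
    proof (induction rule: sigma_sets_induct_disjoint)
      case (basic A)
      then obtain a b where "A = {a<..b}" by auto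
      then have "A \<inter> X = {max a (-1)<..min b T}" by (auto simp: X_def)
      then show ?case by (simp only: Ioc)
    next
      case (compl A)
      then have A[measurable]: "A \<in> sets borel" by (simp add: SS)
      have e: "(UNIV - A) \<inter> X = X - (A \<inter> X)" by auto
      have AX: "A \<inter> X \<in> sets borel" by measurable
      have d: "emeasure \<mu> ((UNIV - A) \<inter> X) = emeasure \<mu> X - emeasure \<mu> (A \<inter> X)"
        "emeasure N ((UNIV - A) \<inter> X) = emeasure N X - emeasure N (A \<inter> X)"
        "emeasure P ((UNIV - A) \<inter> X) = emeasure P X - emeasure P (A \<inter> X)"
        unfolding e using fin[OF A] AX by (auto intro!: emeasure_Diff)
      have "emeasure \<mu> X = emeasure \<mu> ((UNIV - A) \<inter> X) + emeasure \<mu> (A \<inter> X)"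
        "emeasure N X = emeasure N ((UNIV - A) \<inter> X) + emeasure N (A \<inter> X)"
        "emeasure P X = emeasure P ((UNIV - A) \<inter> X) + emeasure P (A \<inter> X)"
        unfolding e using AX by (subst plus_emeasure; auto intro!: arg_cong2[where f=emeasure])+
      note decomp = this
      have "(emeasure \<mu> ((UNIV - A) \<inter> X) + emeasure N ((UNIV - A) \<inter> X)) + emeasure P (A \<inter> X)
          = emeasure \<mu> X + emeasure N X"
        unfolding decomp(1,2) compl.IH[symmetric] by (simp only: ac_simps)
      also have "\<dots> = emeasure P ((UNIV - A) \<inter> X) + emeasure P (A \<inter> X)"
        unfolding XX by (rule decomp(3))
      finally show ?case using fin(3)[OF A] by (simp add: add.commute[of _ "emeasure P (A \<inter> X)"] ennreal_add_left_cancel)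
    next
      case (union A)
      then have A: "A i \<inter> X \<in> sets borel" for i by (auto simp: SS[symmetric])
      have dj: "disjoint_family (\<lambda>i. A i \<inter> X)" using union(1) by (auto simp: disjoint_family_on_def)
      have "emeasure M ((\<Union>i. A i) \<inter> X) = (\<Sum>i. emeasure M (A i \<inter> X))" if "sets M = sets borel" for M
        using suminf_emeasure[of "\<lambda>i. A i \<inter> X" M] A dj that by (simp add: image_subset_iff)
      then show ?case using union.IH by (simp add: suminf_add[OF summableI summableI])
    qed (auto)
  qed
  define A where "A = {x. g x < 0}"
  have [measurable]: "A \<in> sets borel" unfolding A_def by measurable
  have "emeasure P (A \<inter> X) = ennreal (LINT s|lborel. indicator (A \<inter> X) s * max 0 (g s))"
    by (rule P_eq) measurable
  also have "(\<lambda>s. indicator (A \<inter> X) s * max 0 (g s)) = (\<lambda>_. 0)"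
    by (auto simp: A_def split: split_indicator)
  finally have "emeasure N (A \<inter> X) = 0" using main[of A] by (simp add: add_eq_0_iff_both_eq_0)
  then have "(\<integral>\<^sup>+s. ennreal (- g s) * indicator (A \<inter> X) s \<partial>lborel) = 0"
    unfolding N_def by (subst (asm) emeasure_density) auto
  then have "AE s in lborel. ennreal (- g s) * indicator (A \<inter> X) s = 0"
    by (subst (asm) nn_integral_0_iff_AE) auto
  with g(2) show ?thesis
    unfolding AE_leb_iff
  proof eventually_elim
    case (elim s)
    show ?case
    proof
      assume "s \<in> {0<..<T}"
      then show "0 \<le> f s" using elim
        by (cases "g s < 0") (auto simp: A_def X_def split: split_indicator_asm)
    qed
  qed
qed

section \<open>Test functions and weak derivatives\<close>

lemma has_real_derivative_pos_part_square:
  "((\<lambda>x::real. (max 0 x)\<^sup>2) has_real_derivative 2 * max 0 x) (at x)"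
proof (cases x "0::real" rule: linorder_cases)
  case less
  have "((\<lambda>x::real. 0) has_real_derivative 0) (at x)" by simp
  then show ?thesis
    using less by (subst DERIV_cong_ev[OF refl _ refl, of _ "\<lambda>x. 0"])
      (auto intro!: eventually_mono[OF order_tendstoD(2)[OF tendsto_ident_at less]] simp: max_def eventually_nhds intro: exI[of _ "{..<0}"])
next
  case greater
  have "((\<lambda>x::real. x\<^sup>2) has_real_derivative 2 * x) (at x)" by (auto intro!: derivative_eq_intros)
  then show ?thesis
    using greater by (subst DERIV_cong_ev[OF refl _ refl, of _ "\<lambda>x. x\<^sup>2"])
      (auto simp: max_def eventually_nhds intro: exI[of _ "{0<..}"])
next
  case equal
  have "((\<lambda>h. ((max 0 (0 + h))\<^sup>2 - (max 0 0)\<^sup>2) / h) \<longlongrightarrow> 0) (at (0::real))"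
  proof (rule Lim_null_comparison)
    show "\<forall>\<^sub>F h in at (0::real). norm (((max 0 (0 + h))\<^sup>2 - (max 0 0)\<^sup>2) / h) \<le> \<bar>h\<bar>"
      by (intro always_eventually) (auto simp: max_def power2_eq_square)
    show "((\<lambda>h. \<bar>h\<bar>) \<longlongrightarrow> 0) (at (0::real))" by (rule tendsto_rabs_zero) (rule tendsto_ident_at)
  qed
  then show ?thesis using equal by (simp add: DERIV_def)
qed

text \<open>The square of the positive part of \<open>(t - a) (b - t)\<close> is a \<open>C\<^sup>1\<close> function \<open>h\<close> that is positive
  exactly on \<open>(a, b)\<close>, and \<open>h / (h + 1/n)\<close> increases to the indicator of this interval.\<close>

lemma test_fun_approx_indicator:
  fixes a b T :: real
  assumes ab: "0 < a" "a < b" "b < T"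
  obtains q q' :: "nat \<Rightarrow> real \<Rightarrow> real" where "\<And>n. test_fun T (q n) (q' n)" "\<And>n t. 0 \<le> q n t" "\<And>n t. q n t \<le> 1"
    "\<And>t. (\<lambda>n. q n t) \<longlonglongrightarrow> indicator {a<..<b} t"
proof -
  define h where "h t = (max 0 ((t - a) * (b - t)))\<^sup>2" for t
  define h' where "h' t = 2 * max 0 ((t - a) * (b - t)) * (a + b - 2 * t)" for t
  define c where "c n = 1 / real (Suc n)" for n
  define q where "q n t = h t / (h t + c n)" for n t
  define q' where "q' n t = h' t * c n / (h t + c n)\<^sup>2" for n t
  have h0: "h t \<ge> 0" for t by (simp add: h_def)
  have c0: "c n > 0" for n by (simp add: c_def)
  have ne: "h t + c n \<noteq> 0" for t n using h0[of t] c0[of n] by linarith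
  have hd: "(h has_real_derivative h' t) (at t)" for t
  proof -
    have "((\<lambda>t. (t - a) * (b - t)) has_real_derivative (a + b - 2 * t)) (at t)"
      by (auto intro!: derivative_eq_intros)
    from DERIV_chain2[OF has_real_derivative_pos_part_square this]
    show ?thesis unfolding h_def h'_def .
  qed
  have outside: "h t = 0" if "t \<notin> {a<..<b}" for t
  proof -
    have "(t - a) * (b - t) \<le> 0"
      using that ab by (cases "t \<le> a") (auto simp: mult_nonpos_nonneg mult_nonneg_nonpos)
    then show ?thesis by (simp add: h_def)
  qed
  have inside: "h t > 0" if "t \<in> {a<..<b}" for t
    using that by (simp add: h_def max_def)
  show thesis
  proof (rule that)
    show "test_fun T (q n) (q' n)" for n
      unfolding test_fun_def
    proof (intro conjI allI)
      show "(q n has_real_derivative q' n t) (at t)" for t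
        unfolding q_def q'_def using ne[of t n]
        by (auto intro!: derivative_eq_intros hd simp: field_simps power2_eq_square)
      show "continuous_on UNIV (q' n)"
        unfolding q'_def h'_def h_def using ne[of _ n] unfolding h_def
        by (intro continuous_intros) (auto simp: h_def)
      have "q n t = 0" if "t \<notin> {a..b}" for t
      proof -
        have "h t = 0" using that by (intro outside) auto
        then show ?thesis by (simp add: q_def)
      qed
      then show "\<exists>a b. 0 < a \<and> b < T \<and> (\<forall>t. t \<notin> {a..b} \<longrightarrow> q n t = 0)"
        using ab by blast
    qed
    show "0 \<le> q n t" for n t using h0[of t] c0[of n] by (simp add: q_def)
    show "q n t \<le> 1" for n t using h0[of t] c0[of n] by (simp add: q_def divide_le_eq)
    show "(\<lambda>n. q n t) \<longlonglongrightarrow> indicator {a<..<b} t" for t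
    proof (cases "t \<in> {a<..<b}")
      case True
      have "c \<longlonglongrightarrow> 0" unfolding c_def by (rule LIMSEQ_Suc[OF lim_1_over_n])
      then have "(\<lambda>n. h t / (h t + c n)) \<longlonglongrightarrow> h t / (h t + 0)"
        using inside[OF True] by (intro tendsto_intros) auto
      then show ?thesis using inside[OF True] True by (simp add: q_def)
    qed (use outside in \<open>auto simp: q_def\<close>)
  qed
qed

lemma test_fun_zero:
  assumes "test_fun T p p'"
  obtains a b where "0 < a" "b < T" "\<And>t. t \<notin> {a..b} \<Longrightarrow> p t = 0" "\<And>t. t \<notin> {a..b} \<Longrightarrow> p' t = 0"
proof -
  from assms obtain a b where ab: "0 < a" "b < T" "\<And>t. t \<notin> {a..b} \<Longrightarrow> p t = 0"
    and d: "\<And>t. (p has_real_derivative p' t) (at t)"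
    by (auto simp: test_fun_def)
  have "p' t = 0" if "t \<notin> {a..b}" for t
  proof -
    have "\<forall>\<^sub>F x in nhds t. p x = 0"
      unfolding eventually_nhds using that ab(3) by (intro exI[of _ "- {a..b}"]) auto
    then have "(p has_real_derivative 0) (at t)"
      by (subst DERIV_cong_ev[OF refl _ refl, of _ "\<lambda>_. 0"]) auto
    then show ?thesis using d DERIV_unique by blast
  qed
  with ab that show thesis by blast
qed

lemma test_fun_continuous:
  assumes "test_fun T p p'"
  shows "continuous_on UNIV p" "continuous_on UNIV p'"
  using assms by (auto simp: test_fun_def continuous_on_eq_continuous_at intro!: DERIV_isCont)

lemma test_fun_bounded:
  assumes "test_fun T p p'"
  obtains C where "\<And>t. \<bar>p t\<bar> \<le> C" "\<And>t. \<bar>p' t\<bar> \<le> C"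
proof -
  obtain a b where ab: "\<And>t. t \<notin> {a..b} \<Longrightarrow> p t = 0" "\<And>t. t \<notin> {a..b} \<Longrightarrow> p' t = 0"
    using test_fun_zero[OF assms] by metis
  have "bounded (p ` {a..b})" "bounded (p' ` {a..b})"
    using test_fun_continuous[OF assms]
    by (auto intro!: compact_imp_bounded compact_continuous_image continuous_on_subset[of UNIV])
  then obtain C1 C2 where "\<forall>x\<in>p ` {a..b}. norm x \<le> C1" "\<forall>x\<in>p' ` {a..b}. norm x \<le> C2"
    unfolding bounded_iff by blast
  then have C: "\<And>t. t \<in> {a..b} \<Longrightarrow> \<bar>p t\<bar> \<le> C1" "\<And>t. t \<in> {a..b} \<Longrightarrow> \<bar>p' t\<bar> \<le> C2"
    by auto
  show thesis
  proof (rule that[of "\<bar>C1\<bar> + \<bar>C2\<bar>"])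
    show "\<bar>p t\<bar> \<le> \<bar>C1\<bar> + \<bar>C2\<bar>" for t using ab[of t] C[of t] by (cases "t \<in> {a..b}") force+
    show "\<bar>p' t\<bar> \<le> \<bar>C1\<bar> + \<bar>C2\<bar>" for t using ab[of t] C[of t] by (cases "t \<in> {a..b}") force+
  qed
qed

lemma borel_measurable_continuous_leb:
  assumes "continuous_on UNIV (p :: real \<Rightarrow> real)"
  shows "p \<in> borel_measurable (leb T)"
  by (rule measurable_restrict_space1, rule measurable_completion)
     (use borel_measurable_continuous_onI[OF assms] in simp)

lemma integrable_bounded_mult:
  fixes f p :: "'a \<Rightarrow> real"
  assumes f: "integrable M f" and p: "p \<in> borel_measurable M" and C: "\<And>t. t \<in> space M \<Longrightarrow> \<bar>p t\<bar> \<le> C"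
  shows "integrable M (\<lambda>t. p t * f t)"
proof (rule Bochner_Integration.integrable_bound)
  show "integrable M (\<lambda>t. C * f t)" using f by simp
  show "AE t in M. norm (p t * f t) \<le> norm (C * f t)"
  proof (rule AE_I2)
    fix t assume "t \<in> space M"
    then have "\<bar>p t\<bar> \<le> \<bar>C\<bar>" using C[of t] by linarith
    then show "norm (p t * f t) \<le> norm (C * f t)" by (auto simp: abs_mult intro!: mult_right_mono)
  qed
qed (use f p in auto)

lemma integrable_test_fun_mult:
  fixes f :: "real \<Rightarrow> real"
  assumes f: "integrable (leb T) f" and p: "test_fun T p p'"
  shows "integrable (leb T) (\<lambda>t. p t * f t)" "integrable (leb T) (\<lambda>t. p' t * f t)"
  using test_fun_bounded[OF p] integrable_bounded_mult[OF f] borel_measurable_continuous_leb[OF test_fun_continuous(1)[OF p]]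
     borel_measurable_continuous_leb[OF test_fun_continuous(2)[OF p]] by metis+

text \<open>Approximating indicators of intervals by test functions shows that the primitive of \<open>f\<close> is
  constant; the lemma on nondecreasing primitives, applied to \<open>f\<close> and \<open>- f\<close>, gives \<open>f = 0\<close>.\<close>

lemma AE_eq_0_if_test_fun_integrals_0:
  fixes f :: "real \<Rightarrow> real"
  assumes f: "integrable (leb T) f"
    and z: "\<And>p p'. test_fun T p p' \<Longrightarrow> (LINT t|leb T. p t * f t) = 0"
  shows "AE t in leb T. f t = 0"
proof -
  have ind: "(LINT t|leb T. indicator {a<..<b} t * f t) = 0" if ab: "0 < a" "a < b" "b < T" for a b
  proof -
    obtain q q' where q: "\<And>n. test_fun T (q n) (q' n)" "\<And>n t. 0 \<le> q n t" "\<And>n t. q n t \<le> 1"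
      "\<And>t. (\<lambda>n. q n t) \<longlonglongrightarrow> indicator {a<..<b} t"
      using test_fun_approx_indicator[OF ab] by metis
    have "(\<lambda>n. LINT t|leb T. q n t * f t) \<longlonglongrightarrow> (LINT t|leb T. indicator {a<..<b} t * f t)"
    proof (rule integral_dominated_convergence[where w="\<lambda>t. \<bar>f t\<bar>"])
      show "(\<lambda>t. indicator {a<..<b} t * f t) \<in> borel_measurable (leb T)"
        using f ab by (intro borel_measurable_times borel_measurable_indicator) (auto simp: sets_restrict_space_iff)
      show "(\<lambda>t. q n t * f t) \<in> borel_measurable (leb T)" for n
        using integrable_test_fun_mult[OF f q(1)] by blast
      show "AE t in leb T. (\<lambda>n. q n t * f t) \<longlonglongrightarrow> indicator {a<..<b} t * f t"
        by (intro AE_I2 tendsto_intros q)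
      show "AE t in leb T. norm (q n t * f t) \<le> \<bar>f t\<bar>" for n
        using q(2,3)[of n] by (intro AE_I2) (auto simp: abs_mult mult_left_le_one_le)
    qed (use f in simp)
    then show ?thesis using z[OF q(1)] by (simp add: LIMSEQ_const_iff)
  qed
  have eq: "(LINT t|leb a. f t) = (LINT t|leb b. f t)" if ab: "0 < a" "a < b" "b < T" for a b
  proof -
    have i: "integrable (leb T) (\<lambda>s. indicator {..<t} s * f s)" if "t \<le> T" for t
      using integrable_leb_mono[OF f that] integrable_leb_iff[OF that] by blast
    have "(LINT t|leb b. f t) - (LINT t|leb a. f t) = (LINT t|leb T. indicator {..<b} t * f t - indicator {..<a} t * f t)"
      using i[of a] i[of b] integral_leb_eq[of a T f] integral_leb_eq[of b T f] ab
      by (subst Bochner_Integration.integral_diff) auto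
    also have "\<dots> = (LINT t|leb T. indicator {a<..<b} t * f t)"
    proof (rule integral_cong_AE)
      show "(\<lambda>t. indicator {a<..<b} t * f t) \<in> borel_measurable (leb T)"
        using f ab by (intro borel_measurable_times borel_measurable_indicator) (auto simp: sets_restrict_space_iff)
      show "(\<lambda>t. indicator {..<b} t * f t - indicator {..<a} t * f t) \<in> borel_measurable (leb T)"
        using i[of a] i[of b] ab by auto
      have "AE s in lborel. s \<noteq> a" by (rule AE_lborel_singleton)
      then show "AE t in leb T. indicator {..<b} t * f t - indicator {..<a} t * f t = indicator {a<..<b} t * f t"
        unfolding AE_leb_iff by eventually_elim (use ab in \<open>auto split: split_indicator\<close>)
    qed
    also have "\<dots> = 0" by (rule ind[OF ab])
    finally show ?thesis by simp
  qed
  have full: "AE t in leb T. t \<in> {0<..<T}" using AE_space[of "leb T"] by simp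
  have cont: "continuous_on {0..T} (\<lambda>t. LINT s|leb t. f s)"
    by (rule continuous_on_subset[OF continuous_on_integral_leb[OF f]]) auto
  have "AE t in leb T. 0 \<le> f t"
    by (rule AE_nonneg_if_integral_mono[OF f], rule mono_if_mono_AE[OF cont full]) (use eq in auto)
  moreover have "AE t in leb T. 0 \<le> - f t"
  proof (rule AE_nonneg_if_integral_mono, use f in simp)
    fix a b assume "0 \<le> a" "a \<le> b" "b \<le> T"
    moreover have "continuous_on {0..T} (\<lambda>t. LINT s|leb t. - f s)" using cont by (simp add: continuous_on_minus)
    ultimately show "(LINT s|leb a. - f s) \<le> (LINT s|leb b. - f s)"
      by (intro mono_if_mono_AE[OF _ full, of "\<lambda>t. LINT s|leb t. - f s" a b]) (use eq in auto)
  qed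
  ultimately show ?thesis by eventually_elim auto
qed

lemma integral_leb_deriv:
  fixes p p' :: "real \<Rightarrow> real"
  assumes d: "\<And>t. (p has_real_derivative p' t) (at t)" and c: "continuous_on UNIV p'"
    and s: "0 \<le> s" "s \<le> T"
  shows "(LINT r|leb T. indicator {s<..} r * p' r) = p T - p s"
proof -
  have d': "(p has_vector_derivative p' t) (at t within {s..T})" for t
    using d by (auto simp: has_real_derivative_iff_has_vector_derivative
        intro: has_vector_derivative_at_within)
  have [measurable]: "p' \<in> borel_measurable borel"
    using borel_measurable_continuous_onI[OF c] .
  have "p T - p s = (LINT r|lborel. indicator {s..T} r *\<^sub>R p' r)"
    using integral_FTC_Icc[OF s(2) d' continuous_on_subset[OF c]] by simp
  also have "\<dots> = (LINT r|lebesgue. indicator {s..T} r * p' r)"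
    by (simp, rule integral_completion[symmetric]) measurable
  also have "\<dots> = (LINT r|lebesgue. indicator {0<..<T} r * (indicator {s<..} r * p' r))"
  proof (rule integral_cong_AE)
    show "(\<lambda>r. indicator {s..T} r * p' r) \<in> borel_measurable lebesgue"
      "(\<lambda>r. indicator {0<..<T} r * (indicator {s<..} r * p' r)) \<in> borel_measurable lebesgue"
      by (rule measurable_completion, measurable)+
    have "AE r in lborel. r \<noteq> s" "AE r in lborel. r \<noteq> T" by (rule AE_lborel_singleton)+
    then have "AE r in lborel. indicat_real {s..T} r * p' r = indicator {0<..<T} r * (indicator {s<..} r * p' r)"
      by eventually_elim (use s in \<open>auto split: split_indicator\<close>)
    then show "AE r in lebesgue. indicat_real {s..T} r * p' r = indicator {0<..<T} r * (indicator {s<..} r * p' r)"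
      by (rule AE_completion)
  qed
  also have "\<dots> = (LINT r|leb T. indicator {s<..} r * p' r)"
    by (simp add: integral_restrict_space)
  finally show ?thesis by simp
qed

lemma integral_test_fun_deriv:
  assumes p: "test_fun T p p'" and s: "0 \<le> s" "s \<le> T"
  shows "(LINT r|leb T. indicator {s<..} r * p' r) = - p s"
proof -
  obtain a b where ab: "0 < a" "b < T" "\<And>t. t \<notin> {a..b} \<Longrightarrow> p t = 0"
    using test_fun_zero[OF p] by metis
  then show ?thesis using p integral_leb_deriv[OF _ test_fun_continuous(2)[OF p] s, of p]
    by (auto simp: test_fun_def)
qed

lemma Bochner_integrable_test_fun:
  fixes f :: "real \<Rightarrow> 'a::{real_normed_vector, complete_space}"
  assumes f: "Bochner_integrable (leb T) f" and p: "test_fun T p p'"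
  shows "Bochner_integrable (leb T) (\<lambda>t. p t *\<^sub>R f t)" "Bochner_integrable (leb T) (\<lambda>t. p' t *\<^sub>R f t)"
  using test_fun_bounded[OF p] Bochner_integrable_scaleR_bounded[OF complete_measure_leb f]
    borel_measurable_continuous_leb[OF test_fun_continuous(1)[OF p]]
    borel_measurable_continuous_leb[OF test_fun_continuous(2)[OF p]] by metis+

text \<open>The defining identity of the weak derivative is Fubini's theorem on the triangle \<open>s < t\<close>, as
  the integral of \<open>p'\<close> over \<open>(s, T)\<close> is \<open>- p s\<close>. The primitive is described through inner products
  so that only scalar integrals occur.\<close>

lemma has_weak_deriv_primitive:
  fixes G F :: "real \<Rightarrow> 'a::{real_inner, complete_space}"
  assumes F: "Bochner_integrable (leb T) F" and G: "Bochner_integrable (leb T) G"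
    and eq: "\<And>h. AE t in leb T. G t \<bullet> h = (LINT s|leb t. F s \<bullet> h)"
  shows "has_weak_deriv T G F"
  unfolding has_weak_deriv_def
proof (intro conjI F G allI impI)
  fix p p' assume p: "test_fun T p p'"
  note BG = Bochner_integrable_test_fun(2)[OF G p] and BF = Bochner_integrable_test_fun(1)[OF F p]
  have pi: "integrable (leb T) p'"
    using integrable_test_fun_mult(2)[OF finite_measure.integrable_const[OF finite_measure_leb, of T 1] p] by simp
  have "Bochner_integral (leb T) (\<lambda>t. p' t *\<^sub>R G t) \<bullet> h = - Bochner_integral (leb T) (\<lambda>t. p t *\<^sub>R F t) \<bullet> h" for h
  proof -
    note Fh = integrable_inner_left_Bochner[OF F, of h]
    have "Bochner_integral (leb T) (\<lambda>t. p' t *\<^sub>R G t) \<bullet> h = (LINT t|leb T. p' t * (G t \<bullet> h))"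
      using Bochner_integral_inner_left(2)[OF BG, of h] by simp
    also have "\<dots> = (LINT t|leb T. p' t * (LINT s|leb t. F s \<bullet> h))"
    proof (rule integral_cong_AE)
      show m: "(\<lambda>t. p' t * (G t \<bullet> h)) \<in> borel_measurable (leb T)"
        using integrable_inner_left_Bochner[OF BG, of h] by auto
      show ae: "AE t in leb T. p' t * (G t \<bullet> h) = p' t * (LINT s|leb t. F s \<bullet> h)"
        using eq[of h] by eventually_elim simp
      show "(\<lambda>t. p' t * (LINT s|leb t. F s \<bullet> h)) \<in> borel_measurable (leb T)"
        by (rule complete_measure.measurable_cong_AE[OF complete_measure_leb m]) (use ae in \<open>auto elim!: eventually_mono\<close>)
    qed
    also have "\<dots> = (LINT s|leb T. (LINT r|leb T. indicator {s<..} r * p' r) * (F s \<bullet> h))"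
      by (rule Fubini_triangle[OF pi Fh])
    also have "\<dots> = (LINT s|leb T. - (p s * (F s \<bullet> h)))"
      by (rule Bochner_Integration.integral_cong) (auto simp: integral_test_fun_deriv[OF p])
    also have "\<dots> = - Bochner_integral (leb T) (\<lambda>t. p t *\<^sub>R F t) \<bullet> h"
      using Bochner_integral_inner_left(2)[OF BF, of h] by simp
    finally show ?thesis .
  qed
  then show "Bochner_integral (leb T) (\<lambda>t. p' t *\<^sub>R G t) = - Bochner_integral (leb T) (\<lambda>t. p t *\<^sub>R F t)"
    using vector_eq_rdot by blast
qed

lemma has_weak_deriv_inner_left:
  fixes G F :: "real \<Rightarrow> 'a::{real_inner, complete_space}"
  assumes "has_weak_deriv T G F" "test_fun T p p'"
  shows "(LINT t|leb T. p' t * (G t \<bullet> h)) = - (LINT t|leb T. p t * (F t \<bullet> h))"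
proof -
  have G: "Bochner_integrable (leb T) G" and F: "Bochner_integrable (leb T) F"
    and eq: "Bochner_integral (leb T) (\<lambda>t. p' t *\<^sub>R G t) = - Bochner_integral (leb T) (\<lambda>t. p t *\<^sub>R F t)"
    using assms by (auto simp: has_weak_deriv_def)
  have "Bochner_integral (leb T) (\<lambda>t. p' t *\<^sub>R G t) \<bullet> h = - (Bochner_integral (leb T) (\<lambda>t. p t *\<^sub>R F t) \<bullet> h)"
    unfolding eq by simp
  then show ?thesis
    by (simp add: Bochner_integral_inner_left(2)[OF Bochner_integrable_test_fun(1)[OF F assms(2)]]
      Bochner_integral_inner_left(2)[OF Bochner_integrable_test_fun(2)[OF G assms(2)]])
qed

lemma has_weak_deriv_unique:
  fixes G F1 F2 :: "real \<Rightarrow> 'a::{real_inner, complete_space}"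
  assumes 1: "has_weak_deriv T G F1" and 2: "has_weak_deriv T G F2"
  shows "AE t in leb T. F1 t = F2 t"
proof -
  have F1: "Bochner_integrable (leb T) F1" and F2: "Bochner_integrable (leb T) F2"
    using 1 2 by (auto simp: has_weak_deriv_def)
  have "Bochner_integrable (leb T) (\<lambda>t. (-1) *\<^sub>R F2 t)"
    by (rule Bochner_integrable_scaleR_bounded[OF complete_measure_leb F2, of "\<lambda>_. -1" 1]) auto
  from Bochner_integrable_add[OF complete_measure_leb F1 this]
  have D: "Bochner_integrable (leb T) (\<lambda>t. F1 t - F2 t)" by simp
  have "AE t in leb T. F1 t - F2 t = 0"
  proof (rule AE_eq_0_if_inner_AE_eq_0[OF D])
    fix h
    show "AE t in leb T. (F1 t - F2 t) \<bullet> h = 0"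
    proof (rule AE_eq_0_if_test_fun_integrals_0[OF integrable_inner_left_Bochner[OF D]])
      fix p p' assume p: "test_fun T p p'"
      have "(LINT t|leb T. p t * ((F1 t - F2 t) \<bullet> h)) = (LINT t|leb T. p t * (F1 t \<bullet> h)) - (LINT t|leb T. p t * (F2 t \<bullet> h))"
        by (subst Bochner_Integration.integral_diff[symmetric])
           (auto simp: inner_diff_left right_diff_distrib intro!: integrable_test_fun_mult[OF _ p] integrable_inner_left_Bochner F1 F2)
      also have "\<dots> = 0"
        using has_weak_deriv_inner_left[OF 1 p, of h] has_weak_deriv_inner_left[OF 2 p, of h] by simp
      finally show "(LINT t|leb T. p t * ((F1 t - F2 t) \<bullet> h)) = 0" .
    qed
  qed
  then show ?thesis by simp
qed

section \<open>Scalar functions of class W11\<close>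

lemma test_fun_antiderivative:
  assumes q: "continuous_on UNIV q" and ab: "0 < a" "a \<le> b" "b < T"
    and z: "\<And>t. t \<notin> {a..b} \<Longrightarrow> q t = 0" and int: "(LINT t|leb T. q t) = 0"
  obtains p where "test_fun T p q"
proof -
  obtain F where "\<And>x. (F has_vector_derivative q x) (at x)"
    using einterval_antiderivative[of "-\<infinity>" "\<infinity>" q] q
    by (auto simp: continuous_on_eq_continuous_at)
  then have F: "\<And>x. (F has_real_derivative q x) (at x)"
    by (simp add: has_real_derivative_iff_has_vector_derivative)
  have "(LINT r|leb T. q r) = (LINT r|leb T. indicator {0<..} r * q r)"
    by (rule Bochner_Integration.integral_cong) auto
  then have F0T: "F T = F 0" using integral_leb_deriv[OF F q, of 0 T] int ab by simp
  have const: "F x = F y" if "convex S" "x \<in> S" "y \<in> S" "S \<inter> {a..b} = {}" for S x y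
  proof -
    have "\<exists>c. \<forall>x\<in>S. F x = c"
    proof (rule has_field_derivative_zero_constant[OF that(1)])
      fix x assume "x \<in> S"
      then have "q x = 0" using that(4) by (intro z) auto
      then show "(F has_field_derivative 0) (at x within S)"
        using F[of x] by (auto intro: has_field_derivative_at_within)
    qed
    then show ?thesis using that by metis
  qed
  have "test_fun T (\<lambda>t. F t - F 0) q"
    unfolding test_fun_def
  proof (intro conjI allI q)
    show "((\<lambda>t. F t - F 0) has_real_derivative q t) (at t)" for t
      using DERIV_diff[OF F[of t] DERIV_const] by simp
    have "F t - F 0 = 0" if "t \<notin> {a..b}" for t
    proof (cases "t < a")
      case True
      have "{..<a} \<inter> {a..b} = {}" by auto
      then show ?thesis using const[of "{..<a}" t 0] ab True by simp
    next
      case False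
      then have "t > b" using that by auto
      have "{b<..} \<inter> {a..b} = {}" by auto
      then show ?thesis using const[of "{b<..}" t T] ab F0T \<open>t > b\<close> by simp
    qed
    then show "\<exists>a b. 0 < a \<and> b < T \<and> (\<forall>t. t \<notin> {a..b} \<longrightarrow> F t - F 0 = 0)"
      using ab by blast
  qed
  then show thesis by (rule that)
qed

lemma test_fun_mass_1:
  assumes "0 < T"
  obtains e e' where "test_fun T e e'" "(LINT t|leb T. e t) = 1"
proof -
  have ab: "0 < T/3" "T/3 < 2*T/3" "2*T/3 < T" using assms by auto
  obtain q q' where q: "\<And>n. test_fun T (q n) (q' n)" "\<And>n t. 0 \<le> q n t" "\<And>n t. q n t \<le> 1"
    "\<And>t. (\<lambda>n. q n t) \<longlonglongrightarrow> indicator {T/3<..<2*T/3} t"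
    using test_fun_approx_indicator[OF ab] by metis
  have "(\<lambda>n. LINT t|leb T. q n t) \<longlonglongrightarrow> (LINT t|leb T. indicator {T/3<..<2*T/3} t)"
  proof (rule integral_dominated_convergence[where w="\<lambda>_. 1"])
    show "indicat_real {T/3<..<2*T/3} \<in> borel_measurable (leb T)"
      using ab by (intro borel_measurable_indicator) (auto simp: sets_restrict_space_iff)
    show "q n \<in> borel_measurable (leb T)" for n
      by (rule borel_measurable_continuous_leb[OF test_fun_continuous(1)[OF q(1)]])
    show "integrable (leb T) (\<lambda>_. 1::real)" by (rule finite_measure.integrable_const[OF finite_measure_leb])
  qed (use q in auto)
  also have "(LINT t|leb T. indicat_real {T/3<..<2*T/3} t) = T / 3"
  proof -
    have "{T/3<..<2*T/3} \<subseteq> {0<..<T}" using ab by auto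
    then have "measure (leb T) {T/3<..<2*T/3} = measure lebesgue {T/3<..<2*T/3}"
      by (intro measure_restrict_space) auto
    then show ?thesis using assms by (simp add: Int_absorb2)
  qed
  finally have lim: "(\<lambda>n. LINT t|leb T. q n t) \<longlonglongrightarrow> T / 3" .
  have "\<forall>\<^sub>F n in sequentially. 0 < (LINT t|leb T. q n t)"
    by (rule order_tendstoD(1)[OF lim]) (use assms in simp)
  then obtain n where n: "0 < (LINT t|leb T. q n t)" by (auto simp: eventually_sequentially)
  define I where "I = (LINT t|leb T. q n t)"
  obtain a b where ab: "0 < a" "b < T" "\<And>t. t \<notin> {a..b} \<Longrightarrow> q n t = 0"
    using test_fun_zero[OF q(1)[of n]] by metis
  have "test_fun T (\<lambda>t. q n t / I) (\<lambda>t. q' n t / I)"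
    unfolding test_fun_def
  proof (intro conjI allI)
    show "((\<lambda>t. q n t / I) has_real_derivative q' n t / I) (at t)" for t
      using q(1)[of n] by (intro DERIV_cdivide) (simp add: test_fun_def)
    show "continuous_on UNIV (\<lambda>t. q' n t / I)"
      using n by (intro continuous_intros test_fun_continuous(2)[OF q(1)]) (simp add: I_def)
    show "\<exists>a b. 0 < a \<and> b < T \<and> (\<forall>t. t \<notin> {a..b} \<longrightarrow> q n t / I = 0)" using ab by auto
  qed
  moreover have "(LINT t|leb T. q n t / I) = 1" using n by (simp add: I_def)
  ultimately show thesis by (rule that)
qed

text \<open>With a test function \<open>e\<close> of integral 1, the function \<open>q - (\<integral> q) e\<close> has integral 0 and is thus the
  derivative of a test function. Hence \<open>d\<close> integrates against \<open>q\<close> like the constant \<open>\<integral> e d\<close>.\<close>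

lemma AE_constant_if_weak_deriv_0:
  fixes d :: "real \<Rightarrow> real"
  assumes T: "0 < T" and d: "integrable (leb T) d"
    and z: "\<And>p p'. test_fun T p p' \<Longrightarrow> (LINT t|leb T. p' t * d t) = 0"
  obtains c where "AE t in leb T. d t = c"
proof -
  obtain e e' where e: "test_fun T e e'" and e1: "(LINT t|leb T. e t) = 1"
    using test_fun_mass_1[OF T] by metis
  define c where "c = (LINT t|leb T. e t * d t)"
  have one: "integrable (leb T) (\<lambda>_. 1::real)" by (rule finite_measure.integrable_const[OF finite_measure_leb])
  have "AE t in leb T. d t - c = 0"
  proof (rule AE_eq_0_if_test_fun_integrals_0)
    show "integrable (leb T) (\<lambda>t. d t - c)"
      using d finite_measure.integrable_const[OF finite_measure_leb, of T c] by simp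
    fix q q' assume q: "test_fun T q q'"
    define m where "m = (LINT t|leb T. q t)"
    have iq: "integrable (leb T) q" "integrable (leb T) e"
      using integrable_test_fun_mult(1)[OF one q] integrable_test_fun_mult(1)[OF one e] by auto
    obtain a1 b1 where 1: "0 < a1" "b1 < T" "\<And>t. t \<notin> {a1..b1} \<Longrightarrow> q t = 0"
      using test_fun_zero[OF q] by metis
    obtain a2 b2 where 2: "0 < a2" "b2 < T" "\<And>t. t \<notin> {a2..b2} \<Longrightarrow> e t = 0"
      using test_fun_zero[OF e] by metis
    \<comment> \<open>A common support interval; \<open>T/2\<close> keeps it nonempty when \<open>q\<close> or \<open>e\<close> has an empty one.\<close>
    define a where "a = min (min a1 a2) (T/2)"
    define b where "b = max (max b1 b2) (T/2)"
    obtain p where p: "test_fun T p (\<lambda>t. q t - m * e t)"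
    proof (rule test_fun_antiderivative[of "\<lambda>t. q t - m * e t" a b T])
      show "continuous_on UNIV (\<lambda>t. q t - m * e t)"
        by (intro continuous_intros test_fun_continuous(1)[OF q] test_fun_continuous(1)[OF e])
      show "0 < a" "a \<le> b" "b < T" using T 1 2 by (auto simp: a_def b_def)
      show "q t - m * e t = 0" if "t \<notin> {a..b}" for t
      proof -
        have "t \<notin> {a1..b1}" "t \<notin> {a2..b2}" using that by (auto simp: a_def b_def)
        then show ?thesis using 1(3) 2(3) by simp
      qed
      show "(LINT t|leb T. q t - m * e t) = 0"
        using iq e1 by (simp add: m_def)
    qed
    have "0 = (LINT t|leb T. (q t - m * e t) * d t)" using z[OF p] by simp
    also have "\<dots> = (LINT t|leb T. q t * d t - m * (e t * d t))" by (simp add: algebra_simps)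
    also have "\<dots> = (LINT t|leb T. q t * d t) - m * c"
      using integrable_test_fun_mult(1)[OF d q] integrable_test_fun_mult(1)[OF d e]
      by (simp add: c_def)
    also have "\<dots> = (LINT t|leb T. q t * d t) - (LINT t|leb T. q t * c)" by (simp add: m_def)
    also have "\<dots> = (LINT t|leb T. q t * (d t - c))"
      using integrable_test_fun_mult(1)[OF d q] iq
      by (subst Bochner_Integration.integral_diff[symmetric]) (auto simp: right_diff_distrib)
    finally show "(LINT t|leb T. q t * (d t - c)) = 0" by simp
  qed
  then show thesis using that[of c] by simp
qed

lemma integrable_primitive:
  fixes f :: "real \<Rightarrow> real"
  assumes "integrable (leb T) f"
  shows "integrable (leb T) (\<lambda>t. LINT s|leb t. f s)"
  using integrable_conv[OF finite_measure.integrable_const[OF finite_measure_leb, of T 1] assms]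
  by (simp only: mult_1)

lemma W11_real_primitive:
  fixes k k' :: "real \<Rightarrow> real"
  assumes T: "0 < T" and k: "has_weak_deriv T k k'"
  obtains k0 where "AE t in leb T. k t = k0 + (LINT s|leb t. k' s)"
proof -
  have ik: "integrable (leb T) k" "integrable (leb T) k'"
    using k by (auto simp: has_weak_deriv_def Bochner_integrable_eq_library)
  note iG = integrable_primitive[OF ik(2)]
  have G: "has_weak_deriv T (\<lambda>t. LINT s|leb t. k' s) k'"
    by (rule has_weak_deriv_primitive) (auto simp: Bochner_integrable_eq_library ik iG)
  obtain c where "AE t in leb T. k t - (LINT s|leb t. k' s) = c"
  proof (rule AE_constant_if_weak_deriv_0[OF T, of "\<lambda>t. k t - (LINT s|leb t. k' s)"])
    show "integrable (leb T) (\<lambda>t. k t - (LINT s|leb t. k' s))" using ik iG by simp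
    fix p p' assume p: "test_fun T p p'"
    have "(LINT t|leb T. p' t * (k t - (LINT s|leb t. k' s))) = (LINT t|leb T. p' t * k t) - (LINT t|leb T. p' t * (LINT s|leb t. k' s))"
      using integrable_test_fun_mult(2)[OF ik(1) p] integrable_test_fun_mult(2)[OF iG p]
      by (simp add: right_diff_distrib)
    also have "\<dots> = 0"
      using has_weak_deriv_inner_left[OF k p, of 1] has_weak_deriv_inner_left[OF G p, of 1] by simp
    finally show "(LINT t|leb T. p' t * (k t - (LINT s|leb t. k' s))) = 0" .
  qed
  then have "AE t in leb T. k t = c + (LINT s|leb t. k' s)" by (auto elim!: eventually_mono)
  then show thesis by (rule that)
qed

lemma nonneg_nonincreasing_AE_nonneg:
  assumes "nonneg_nonincreasing T k"
  shows "AE t in leb T. 0 \<le> k t"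
proof -
  obtain \<kappa> where "AE t in leb T. k t = \<kappa> t" and \<kappa>: "\<And>t. t \<in> {0<..<T} \<Longrightarrow> 0 \<le> \<kappa> t"
    using assms unfolding nonneg_nonincreasing_def by blast
  from this(1) AE_space show ?thesis by eventually_elim (use \<kappa> in auto)
qed

text \<open>The continuous representative of \<open>k\<close> agrees almost everywhere with a nonincreasing function
  and is therefore nonincreasing, so \<open>- k'\<close> has a nondecreasing primitive.\<close>

lemma nonincreasing_AE_weak_deriv_nonpos:
  fixes k k' :: "real \<Rightarrow> real"
  assumes T: "0 < T" and k: "has_weak_deriv T k k'" and mono: "nonneg_nonincreasing T k"
  shows "AE t in leb T. k' t \<le> 0"
proof -
  obtain k0 where k0: "AE t in leb T. k t = k0 + (LINT s|leb t. k' s)"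
    using W11_real_primitive[OF T k] by blast
  obtain \<kappa> where \<kappa>: "AE t in leb T. k t = \<kappa> t" "antimono_on {0<..<T} \<kappa>"
    using mono by (auto simp: nonneg_nonincreasing_def)
  have ik: "integrable (leb T) k'" using k by (auto simp: has_weak_deriv_def Bochner_integrable_eq_library)
  define S where "S = {t \<in> {0<..<T}. \<kappa> t = k0 + (LINT s|leb t. k' s)}"
  have "AE t in leb T. t \<in> S"
    using k0 \<kappa>(1) AE_space[of "leb T"] by eventually_elim (auto simp: S_def)
  moreover have "continuous_on {0..T} (\<lambda>t. LINT s|leb t. - k' s)"
    by (rule continuous_on_subset[OF continuous_on_integral_leb]) (use ik in auto)
  moreover have "(LINT s|leb a. - k' s) \<le> (LINT s|leb b. - k' s)"
    if "a \<in> S" "b \<in> S" "a < b" for a b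
    using that monotone_onD[OF \<kappa>(2), of a b] by (auto simp: S_def)
  ultimately have "(LINT s|leb a. - k' s) \<le> (LINT s|leb b. - k' s)" if "0 \<le> a" "a \<le> b" "b \<le> T" for a b
    using that mono_if_mono_AE[of T "\<lambda>t. LINT s|leb t. - k' s" S a b] by blast
  then have "AE t in leb T. 0 \<le> - k' t"
    by (rule AE_nonneg_if_integral_mono[rotated]) (use ik in simp_all)
  then show ?thesis by (rule eventually_mono) simp
qed

lemma integral_leb_const: "0 \<le> t \<Longrightarrow> (LINT s|leb t. c) = t * (c::real)"
  by (simp only: lebesgue_integral_const space_lebesgue_on measure_leb real_scaleR_def)

text \<open>Fubini's theorem for the convolution of \<open>f\<close> with the constant 1.\<close>

lemma integral_primitive_eq:
  fixes f :: "real \<Rightarrow> real"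
  assumes f: "integrable (leb t) f"
  shows "(LINT r|leb t. LINT s|leb r. f s) = t * (LINT s|leb t. f s) - (LINT s|leb t. s * f s)"
    and "integrable (leb t) (\<lambda>s. s * f s)"
proof -
  show i: "integrable (leb t) (\<lambda>s. s * f s)"
    by (rule integrable_bounded_mult[OF f borel_measurable_id_leb, of t]) auto
  have "(LINT r|leb t. LINT s|leb r. 1 * f s) = (LINT s|leb t. (LINT q|leb (t - s). 1) * f s)"
    by (rule integral_conv_full[OF finite_measure.integrable_const[OF finite_measure_leb] f])
  also have "\<dots> = (LINT s|leb t. t * f s - s * f s)"
  proof (rule Bochner_Integration.integral_cong[OF refl])
    fix s assume "s \<in> space (leb t)"
    then have "(LINT q|leb (t - s). 1) = (t - s) * (1::real)" by (intro integral_leb_const) simp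
    then show "(LINT q|leb (t - s). 1) * f s = t * f s - s * f s"
      by (simp only: left_diff_distrib mult_1_right)
  qed
  also have "\<dots> = t * (LINT s|leb t. f s) - (LINT s|leb t. s * f s)"
    using f i by simp
  finally show "(LINT r|leb t. LINT s|leb r. f s) = t * (LINT s|leb t. f s) - (LINT s|leb t. s * f s)" by simp
qed

text \<open>Integration by parts in \<open>\<integral>\<^sub>0\<^sup>t s (-k'(s)) ds\<close>, for the absolutely continuous representative
  of \<open>k\<close>. This bounds the total weight of all time lags by the \<open>L\<^sup>1\<close> norm of the kernel.\<close>

lemma integral_kernel_identity:
  fixes k k' :: "real \<Rightarrow> real"
  assumes k': "integrable (leb t) k'" and ae: "AE r in leb t. k r = k0 + (LINT s|leb r. k' s)"
    and k: "integrable (leb t) k" and t: "0 \<le> t"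
  shows "t * (k0 + (LINT s|leb t. k' s)) + (LINT s|leb t. s * (- k' s)) = (LINT s|leb t. k s)"
proof -
  have c: "integrable (leb t) (\<lambda>_. k0)" by (rule finite_measure.integrable_const[OF finite_measure_leb])
  have "(LINT s|leb t. k s) = (LINT r|leb t. k0 + (LINT s|leb r. k' s))"
    using integrable_primitive[OF k'] c k by (intro integral_cong_AE ae) auto
  also have "\<dots> = t * k0 + (LINT r|leb t. LINT s|leb r. k' s)"
    using integrable_primitive[OF k'] c integral_leb_const[OF t, of k0] by simp
  finally show ?thesis by (simp add: integral_primitive_eq[OF k'] algebra_simps)
qed

section \<open>Convolution of a kernel with a Hilbert-space valued function\<close>

lemma Bochner_integrable_leb_mono:
  fixes w :: "real \<Rightarrow> 'a::{real_normed_vector, complete_space}"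
  assumes "Bochner_integrable (leb T) w" "t \<le> T"
  shows "Bochner_integrable (leb t) w"
proof -
  have "leb t = restrict_space (leb T) ({..<t} \<inter> space (leb T))"
    using assms(2) by (subst restrict_restrict_space) (auto intro!: arg_cong[where f="restrict_space lebesgue"])
  then show ?thesis
    using Bochner_integrable_restrict_space[OF complete_measure_leb assms(1) sets_leb_lessThan] by simp
qed

lemma AE_Bochner_integrable_conv:
  fixes w :: "real \<Rightarrow> 'a::{real_normed_vector, complete_space}"
  assumes a: "integrable (leb T) a" and w: "Bochner_integrable (leb T) w"
  shows "AE t in leb T. Bochner_integrable (leb t) (\<lambda>s. a (t - s) *\<^sub>R w s)"
  using AE_integrable_conv[OF a Bochner_integrable_norm[OF w]] AE_space
proof eventually_elim
  case (elim t)
  then have t: "t \<le> T" by simp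
  show ?case
  proof (rule Bochner_integrable_scaleR[OF complete_measure_leb Bochner_integrable_leb_mono[OF w t] _ elim(1)])
    show "(\<lambda>s. a (t - s)) \<in> borel_measurable (leb t)"
      using integrable_leb_reflect[OF integrable_leb_mono[OF a t]] by simp
  qed
qed

lemma conv_inner_left:
  fixes w :: "real \<Rightarrow> 'a::real_inner"
  assumes "Bochner_integrable (leb t) (\<lambda>s. a (t - s) *\<^sub>R w s)"
  shows "integrable (leb t) (\<lambda>s. a (t - s) * (w s \<bullet> h))"
    and "conv a w t \<bullet> h = (LINT s|leb t. a (t - s) * (w s \<bullet> h))"
  using integrable_inner_left_Bochner[OF assms, of h] Bochner_integral_inner_left(2)[OF assms, of h]
  by (simp_all add: conv_def)

lemma conv_real: "conv a b t = (LINT s|leb t. a (t - s) * b s)" for a b :: "real \<Rightarrow> real"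
  by (simp add: conv_def Bochner_integral_eq_library)

text \<open>For a simple function \<open>S\<close>, the convolution \<open>a * S\<close> is a finite sum of scalar convolutions times
  fixed vectors. In general \<open>w\<close> is approximated by simple functions in \<open>L\<^sup>1\<close>, and
  \<open>\<parallel>a * w - a * S\<parallel> \<le> |a| * \<parallel>w - S\<parallel>\<close> has integral at most \<open>\<parallel>a\<parallel> \<parallel>w - S\<parallel>\<close> by Fubini.\<close>

lemma Bochner_integrable_conv:
  fixes w :: "real \<Rightarrow> 'a::{real_inner, complete_space}"
  assumes a: "integrable (leb T) a" and w: "Bochner_integrable (leb T) w"
  shows "Bochner_integrable (leb T) (conv a w)"
proof -
  obtain S where S: "\<And>i::nat. Bochner_Integration.simple_bochner_integrable (leb T) (S i)"
    and lim: "(\<lambda>i. \<integral>\<^sup>+x. norm (w x - S i x) \<partial>leb T) \<longlonglongrightarrow> 0"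
    using Bochner_integrable_approx[OF w] by blast
  note aw = AE_Bochner_integrable_conv[OF a w]
  have BS: "Bochner_integrable (leb T) (S i)" for i by (rule Bochner_integrable_simple[OF S])
  have BD: "Bochner_integrable (leb T) (\<lambda>s. w s - S i s)" for i
  proof -
    have "Bochner_integrable (leb T) (\<lambda>s. (-1) *\<^sub>R S i s)"
      by (rule Bochner_integrable_scaleR_bounded[OF complete_measure_leb BS, of "\<lambda>_. -1" 1]) auto
    from Bochner_integrable_add[OF complete_measure_leb w this] show ?thesis by simp
  qed
  note iD = Bochner_integrable_norm[OF BD]
  have ia: "integrable (leb T) (\<lambda>s. \<bar>a s\<bar>)" using a by simp
  define E where "E i t = (LINT s|leb t. \<bar>a (t - s)\<bar> * norm (w s - S i s))" for i t
  have E0: "E i t \<ge> 0" for i t unfolding E_def by (rule integral_nonneg_AE) simp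
  have iE: "integrable (leb T) (E i)" for i
    unfolding E_def by (rule integrable_conv[OF ia iD])
  show ?thesis
  proof (rule Bochner_integrable_L1_limit[OF complete_measure_leb])
    fix i
    show "(\<lambda>t. ennreal (E i t)) \<in> borel_measurable (leb T)" using iE[of i] by simp
    let ?Y = "S i ` space (leb T) - {0}"
    let ?A = "\<lambda>y. {z \<in> space (leb T). S i z = y}"
    have fin: "finite ?Y" using simple_bochner_integrableD[OF S[of i]] by (simp add: simple_function_def)
    have ind: "integrable (leb T) (indicat_real (?A y))" for y
    proof (rule integrable_real_indicator)
      show "?A y \<in> sets (leb T)" by (rule sets_Collect_simple_function[OF simple_bochner_integrableD[OF S]])
      show "emeasure (leb T) (?A y) < \<infinity>"
        using finite_measure.emeasure_finite[OF finite_measure_leb, of T "?A y"] by (simp add: less_top)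
    qed
    define g where "g t = (\<Sum>y\<in>?Y. (LINT s|leb t. a (t - s) * indicator (?A y) s) *\<^sub>R y)" for t
    have "Bochner_integrable (leb T) g"
      unfolding g_def
      by (intro Bochner_integrable_sum complete_measure_leb Bochner_integrable_scaleR_const integrable_conv[OF a ind])
    moreover have "AE t in leb T. conv a (S i) t = g t"
    proof -
      have "AE t in leb T. \<forall>y\<in>?Y. integrable (leb t) (\<lambda>s. a (t - s) * indicator (?A y) s)"
        using AE_integrable_conv[OF a ind] fin by (simp add: AE_ball_countable countable_finite)
      with AE_Bochner_integrable_conv[OF a BS[of i]] AE_space
      show ?thesis
      proof eventually_elim
        case (elim t)
        have "conv a (S i) t \<bullet> h = g t \<bullet> h" for h
        proof -
          have "g t \<bullet> h = (\<Sum>y\<in>?Y. (LINT s|leb t. a (t - s) * indicator (?A y) s * (y \<bullet> h)))"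
            by (simp add: g_def inner_sum_left)
          also have "\<dots> = (LINT s|leb t. (\<Sum>y\<in>?Y. a (t - s) * indicator (?A y) s * (y \<bullet> h)))"
            using elim(3) by (intro Bochner_Integration.integral_sum[symmetric]) auto
          also have "\<dots> = (LINT s|leb t. a (t - s) * (S i s \<bullet> h))"
          proof (rule Bochner_Integration.integral_cong[OF refl])
            fix s assume "s \<in> space (leb t)"
            then have "s \<in> space (leb T)" using elim(2) by simp
            from simple_function_eq_sum_indicator[OF simple_bochner_integrableD[OF S[of i]] this]
            have "S i s \<bullet> h = (\<Sum>y\<in>?Y. indicator (?A y) s *\<^sub>R y) \<bullet> h" by (rule arg_cong)
            then show "(\<Sum>y\<in>?Y. a (t - s) * indicator (?A y) s * (y \<bullet> h)) = a (t - s) * (S i s \<bullet> h)"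
              by (simp only: inner_sum_left inner_scaleR_left sum_distrib_left mult.assoc)
          qed
          also have "\<dots> = conv a (S i) t \<bullet> h" by (rule conv_inner_left(2)[OF elim(1), symmetric])
          finally show ?thesis by simp
        qed
        then show ?case using vector_eq_rdot by blast
      qed
    qed
    ultimately show "Bochner_integrable (leb T) (conv a (S i))"
      by (rule Bochner_integrable_cong_AE[OF complete_measure_leb])
    show "AE t in leb T. ennreal (norm (conv a w t - conv a (S i) t)) \<le> ennreal (E i t)"
      using aw AE_Bochner_integrable_conv[OF a BS[of i]] AE_Bochner_integrable_conv[OF a BD[of i]]
    proof eventually_elim
      case (elim t)
      have "(conv a w t - conv a (S i) t) \<bullet> h = conv a (\<lambda>s. w s - S i s) t \<bullet> h" for h
        by (simp add: inner_diff_left conv_inner_left(2)[OF elim(1)] conv_inner_left(2)[OF elim(2)]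
            conv_inner_left(2)[OF elim(3)] right_diff_distrib conv_inner_left(1)[OF elim(1)] conv_inner_left(1)[OF elim(2)])
      then have "conv a w t - conv a (S i) t = conv a (\<lambda>s. w s - S i s) t" using vector_eq_rdot by blast
      also have "norm \<dots> \<le> E i t"
        unfolding conv_def E_def using norm_Bochner_integral_le[OF elim(3)] by simp
      finally show ?case by (rule ennreal_leI)
    qed
  next
    define A where "A = (LINT s|leb T. \<bar>a s\<bar>)"
    have A0: "A \<ge> 0" unfolding A_def by (rule integral_nonneg_AE) simp
    have "(\<integral>\<^sup>+t. E i t \<partial>leb T) \<le> ennreal A * (\<integral>\<^sup>+x. norm (w x - S i x) \<partial>leb T)" for i
    proof -
      have "(\<integral>\<^sup>+t. E i t \<partial>leb T) = ennreal (LINT t|leb T. E i t)"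
        by (rule nn_integral_eq_integral[OF iE]) (simp add: E0)
      also have "(LINT t|leb T. E i t) = (LINT s|leb T. (LINT q|leb (T - s). \<bar>a q\<bar>) * norm (w s - S i s))"
        unfolding E_def by (rule integral_conv_full[OF ia iD])
      also have "\<dots> \<le> (LINT s|leb T. A * norm (w s - S i s))"
      proof (rule integral_mono_AE')
        show "AE s in leb T. (LINT q|leb (T - s). \<bar>a q\<bar>) * norm (w s - S i s) \<le> A * norm (w s - S i s)"
        proof (rule AE_I2)
          fix s assume "s \<in> space (leb T)"
          then have "(LINT q|leb (T - s). \<bar>a q\<bar>) \<le> A"
            unfolding A_def by (intro integral_mono_lebesgue_on_AE[OF ia]) auto
          then show "(LINT q|leb (T - s). \<bar>a q\<bar>) * norm (w s - S i s) \<le> A * norm (w s - S i s)"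
            by (rule mult_right_mono) simp
        qed
      qed (use iD A0 in auto)
      finally have "(\<integral>\<^sup>+t. E i t \<partial>leb T) \<le> ennreal (A * (LINT s|leb T. norm (w s - S i s)))"
        by (simp add: ennreal_leI)
      also have "\<dots> = ennreal A * (\<integral>\<^sup>+x. norm (w x - S i x) \<partial>leb T)"
        using A0 iD[of i] by (simp add: ennreal_mult nn_integral_eq_integral)
      finally show ?thesis .
    qed
    moreover have l: "(\<lambda>i. ennreal A * (\<integral>\<^sup>+x. norm (w x - S i x) \<partial>leb T)) \<longlonglongrightarrow> 0"
      using ennreal_tendsto_cmult[OF _ lim, of "ennreal A"] by simp
    ultimately show "(\<lambda>i. \<integral>\<^sup>+t. E i t \<partial>leb T) \<longlonglongrightarrow> 0"
      by (intro tendsto_sandwich[OF _ _ tendsto_const l] always_eventually allI) simp_all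
  qed
qed

lemma integral_leb_abs_le:
  fixes f :: "real \<Rightarrow> real"
  assumes f: "integrable (leb T) f" and "t \<le> T"
  shows "(LINT s|leb t. \<bar>f s\<bar>) \<le> (LINT s|leb T. \<bar>f s\<bar>)"
proof (rule integral_mono_lebesgue_on_AE)
  show "integrable (leb T) (\<lambda>s. \<bar>f s\<bar>)" using f by simp
qed (use \<open>t \<le> T\<close> in auto)

text \<open>Formally: insert \<open>k(t-s) = k\<^sub>0 + \<integral>\<^sub>0\<^bsup>t-s\<^esup> k'\<close> and exchange the integrals. The equality holds at every
  \<open>t\<close>, not only almost everywhere, which the integrated inequality requires.\<close>

lemma conv_eq_integral:
  fixes k k' b :: "real \<Rightarrow> real"
  assumes k': "integrable (leb T) k'" and ae: "AE t in leb T. k t = k0 + (LINT s|leb t. k' s)"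
    and k: "integrable (leb T) k" and b: "integrable (leb T) b" and t: "t \<le> T"
  shows "(LINT s|leb t. k (t - s) * b s) = (LINT r|leb t. k0 * b r + (LINT s|leb r. k' (r - s) * b s))"
proof -
  let ?G = "\<lambda>x. LINT q|leb x. k' q"
  have k't: "integrable (leb t) k'" and bt: "integrable (leb t) b" and kt: "integrable (leb t) k"
    using integrable_leb_mono t k' b k by blast+
  have Gt: "integrable (leb t) (\<lambda>s. ?G (t - s))"
    by (rule integrable_leb_reflect[OF integrable_primitive[OF k't]])
  have iGb: "integrable (leb t) (\<lambda>s. ?G (t - s) * b s)"
  proof (rule integrable_bounded_mult[OF bt, of _ "LINT q|leb t. \<bar>k' q\<bar>"])
    show "(\<lambda>s. ?G (t - s)) \<in> borel_measurable (leb t)" using Gt by simp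
    fix s assume "s \<in> space (leb t)"
    then have "(LINT q|leb (t - s). \<bar>k' q\<bar>) \<le> (LINT q|leb t. \<bar>k' q\<bar>)"
      by (intro integral_leb_abs_le[OF k't]) simp
    then show "\<bar>?G (t - s)\<bar> \<le> (LINT q|leb t. \<bar>k' q\<bar>)"
      using integral_abs_bound[of "leb (t - s)" k'] by linarith
  qed
  have "AE x in lborel. x \<in> {0<..<t} \<longrightarrow> k x = k0 + ?G x"
    using AE_leb_mono[OF ae t] by (simp only: AE_leb_iff)
  from AE_lborel_reflect[OF this, of t]
  have kk: "AE s in leb t. k (t - s) * b s = k0 * b s + ?G (t - s) * b s"
    unfolding AE_leb_iff by eventually_elim (auto simp: distrib_right)
  have "(LINT s|leb t. k (t - s) * b s) = (LINT s|leb t. k0 * b s + ?G (t - s) * b s)"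
  proof (rule integral_cong_AE[OF _ _ kk])
    show "(\<lambda>s. k0 * b s + ?G (t - s) * b s) \<in> borel_measurable (leb t)" using iGb bt by auto
    show "(\<lambda>s. k (t - s) * b s) \<in> borel_measurable (leb t)"
      using integrable_leb_reflect[OF kt] bt by auto
  qed
  also have "\<dots> = (LINT s|leb t. k0 * b s) + (LINT s|leb t. ?G (t - s) * b s)"
    using iGb bt by simp
  also have "(LINT s|leb t. ?G (t - s) * b s) = (LINT r|leb t. LINT s|leb r. k' (r - s) * b s)"
    by (rule integral_conv[OF k' b t, symmetric])
  also have "(LINT s|leb t. k0 * b s) + \<dots> = (LINT r|leb t. k0 * b r + (LINT s|leb r. k' (r - s) * b s))"
    using bt integrable_conv[OF k't bt] by (intro Bochner_Integration.integral_add[symmetric]) auto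
  finally show ?thesis .
qed

lemma has_weak_deriv_conv:
  fixes w :: "real \<Rightarrow> 'a::{real_inner, complete_space}"
  assumes k': "integrable (leb T) k'" and ae: "AE t in leb T. k t = k0 + (LINT s|leb t. k' s)"
    and k: "integrable (leb T) k" and w: "Bochner_integrable (leb T) w"
  shows "has_weak_deriv T (conv k w) (\<lambda>t. k0 *\<^sub>R w t + conv k' w t)"
proof (rule has_weak_deriv_primitive)
  show "Bochner_integrable (leb T) (conv k w)" by (rule Bochner_integrable_conv[OF k w])
  show "Bochner_integrable (leb T) (\<lambda>t. k0 *\<^sub>R w t + conv k' w t)"
    by (intro Bochner_integrable_add complete_measure_leb Bochner_integrable_conv[OF k' w]
        Bochner_integrable_scaleR_bounded[OF _ w, of "\<lambda>_. k0" "\<bar>k0\<bar>"]) auto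
  fix h
  note wh = integrable_inner_left_Bochner[OF w, of h]
  have aes: "AE s in leb T. (k0 *\<^sub>R w s + conv k' w s) \<bullet> h = k0 * (w s \<bullet> h) + (LINT r|leb s. k' (s - r) * (w r \<bullet> h))"
    using AE_Bochner_integrable_conv[OF k' w]
    by eventually_elim (simp add: inner_add_left conv_inner_left(2))
  show "AE t in leb T. conv k w t \<bullet> h = (LINT s|leb t. (k0 *\<^sub>R w s + conv k' w s) \<bullet> h)"
    using AE_Bochner_integrable_conv[OF k w] AE_space
  proof eventually_elim
    case (elim t)
    then have t: "t \<le> T" by simp
    have "conv k w t \<bullet> h = (LINT r|leb t. k0 * (w r \<bullet> h) + (LINT s|leb r. k' (r - s) * (w s \<bullet> h)))"
      unfolding conv_inner_left(2)[OF elim(1)] by (rule conv_eq_integral[OF k' ae k wh t])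
    also have "\<dots> = (LINT s|leb t. (k0 *\<^sub>R w s + conv k' w s) \<bullet> h)"
    proof (rule integral_cong_AE)
      note wt = integrable_leb_mono[OF wh t] and kt = integrable_leb_mono[OF k' t]
      show m: "(\<lambda>r. k0 * (w r \<bullet> h) + (LINT s|leb r. k' (r - s) * (w s \<bullet> h))) \<in> borel_measurable (leb t)"
        using wt integrable_conv[OF kt wt] by auto
      show ae': "AE r in leb t. k0 * (w r \<bullet> h) + (LINT s|leb r. k' (r - s) * (w s \<bullet> h)) = (k0 *\<^sub>R w r + conv k' w r) \<bullet> h"
        using AE_leb_mono[OF aes t] by eventually_elim simp
      show "(\<lambda>r. (k0 *\<^sub>R w r + conv k' w r) \<bullet> h) \<in> borel_measurable (leb t)"
        by (rule complete_measure.measurable_cong_AE[OF complete_measure_leb m]) (use ae' in \<open>auto elim!: eventually_mono\<close>)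
    qed
    finally show ?case .
  qed
qed

lemma weak_deriv_conv:
  fixes w :: "real \<Rightarrow> 'a::{real_inner, complete_space}"
  assumes "integrable (leb T) k'" "AE t in leb T. k t = k0 + (LINT s|leb t. k' s)"
    "integrable (leb T) k" "Bochner_integrable (leb T) w"
  shows "conv k w \<in> W11 T"
    and "AE t in leb T. weak_deriv T (conv k w) t = k0 *\<^sub>R w t + conv k' w t"
    and "Bochner_integrable (leb T) (weak_deriv T (conv k w))"
proof -
  note * = has_weak_deriv_conv[OF assms]
  show "conv k w \<in> W11 T" using * by (auto simp: W11_def)
  have **: "has_weak_deriv T (conv k w) (weak_deriv T (conv k w))"
    using someI[of "has_weak_deriv T (conv k w)", OF *] by (simp only: weak_deriv_def)
  show "AE t in leb T. weak_deriv T (conv k w) t = k0 *\<^sub>R w t + conv k' w t"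
    by (rule has_weak_deriv_unique[OF ** *])
  show "Bochner_integrable (leb T) (weak_deriv T (conv k w))"
    using ** by (simp add: has_weak_deriv_def)
qed

section \<open>The convolution inequality\<close>

text \<open>The subgradient inequality at \<open>x\<close> tested with \<open>z\<close>, a point near \<open>y\<close> in the domain of \<open>f\<close>.
  In the application \<open>f\<close> is \<open>\<phi>\<^sup>t\<close>, \<open>x = u(t)\<close>, and \<open>y\<close> is \<open>u(s)\<close> or \<open>u\<^sub>0\<close> with energy \<open>b\<close>, \<open>m = |b|\<close>; the number
  \<open>d\<close> is the time lag times the constant of (A2) or (A1), which supply \<open>z\<close>.\<close>

lemma subdiff_perturbed_bound:
  fixes f :: "'a::real_inner \<Rightarrow> ereal"
  assumes proper: "proper f" and x: "x \<in> Dom f" and \<xi>: "\<xi> \<in> subdiff f x"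
    and z: "norm (z - y) \<le> d * sqrt (1 + m)" "f z \<le> ereal (b + d * (1 + m))"
    and d: "0 \<le> d" and m: "0 \<le> m" and \<epsilon>: "0 < \<epsilon>" "\<epsilon> < 1"
  shows "real_of_ereal (f x) - b - d * (\<epsilon> * (norm \<xi>)\<^sup>2 + 2 / \<epsilon> * (1 + m)) \<le> (x - y) \<bullet> \<xi>"
proof -
  have "f z < \<infinity>" using z(2) by (rule le_less_trans) simp
  then have "z \<in> Dom f" by (simp add: Dom_def)
  moreover have fin: "\<bar>f v\<bar> \<noteq> \<infinity>" if "v \<in> Dom f" for v
    using that proper by (auto simp: Dom_def proper_def)
  ultimately obtain fx fz where f: "f x = ereal fx" "f z = ereal fz"
    using x by (metis ereal_real)
  have "f z - f x \<ge> ereal (\<xi> \<bullet> (z - x))"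
    using \<xi> \<open>z \<in> Dom f\<close> by (auto simp: subdiff_def)
  then have 1: "\<xi> \<bullet> (z - x) \<le> fz - fx" by (simp add: f)
  have 2: "fz \<le> b + d * (1 + m)" using z(2) by (simp add: f)
  define n where "n = norm \<xi>"
  define q where "q = sqrt (1 + m)"
  have q: "q\<^sup>2 = 1 + m" "q \<ge> 0" using m by (auto simp: q_def)
  have "\<xi> \<bullet> (y - z) \<le> n * (d * q)"
  proof -
    have "\<xi> \<bullet> (y - z) \<le> n * norm (y - z)" unfolding n_def by (rule norm_cauchy_schwarz)
    also have "\<dots> \<le> n * (d * q)"
      using z(1) by (intro mult_left_mono) (auto simp: n_def q_def norm_minus_commute)
    finally show ?thesis .
  qed
  then have 3: "(x - y) \<bullet> \<xi> \<ge> fx - b - d * (1 + m) - d * (q * n)"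
    using 1 2 by (simp add: inner_diff_right inner_diff_left inner_commute algebra_simps)
  \<comment> \<open>Young's inequality, multiplied by \<open>\<epsilon>\<close>; the first term uses \<open>\<epsilon> < 1\<close>.\<close>
  have "\<epsilon> * (1 + m) + \<epsilon> * (q * n) \<le> \<epsilon>\<^sup>2 * n\<^sup>2 + 2 * (1 + m)"
  proof -
    have "0 \<le> (\<epsilon> * n - q)\<^sup>2" by simp
    then have "2 * (\<epsilon> * (q * n)) \<le> \<epsilon>\<^sup>2 * n\<^sup>2 + q\<^sup>2" by (simp add: power2_diff power_mult_distrib algebra_simps)
    moreover have "\<epsilon> * (1 + m) \<le> 1 + m" using \<epsilon> m by (simp add: mult_le_cancel_right1)
    moreover have "0 \<le> \<epsilon>\<^sup>2 * n\<^sup>2" by simp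
    moreover have "Z + X \<le> Y + 2 * M" if "2 * X \<le> Y + M" "Z \<le> M" "0 \<le> Y" "0 \<le> M" for X Y Z M :: real
      using that by linarith
    ultimately show ?thesis using m q by (simp only: add_nonneg_nonneg zero_le_one)
  qed
  then have "(1 + m) + q * n \<le> \<epsilon> * n\<^sup>2 + 2 / \<epsilon> * (1 + m)"
    using \<epsilon> by (simp add: field_simps power2_eq_square)
  then have "d * ((1 + m) + q * n) \<le> d * (\<epsilon> * n\<^sup>2 + 2 / \<epsilon> * (1 + m))"
    using d by (rule mult_left_mono)
  then show ?thesis using 3 by (simp add: f n_def distrib_left)
qed

text \<open>Integration of the bounds for fixed \<open>t\<close>. In the application \<open>m s = k'(t - s)\<close>, \<open>K\<close> is the value
  of the kernel at \<open>t\<close>, \<open>A s = (u(s) - u\<^sub>0) \<bullet> g(t)\<close>, \<open>b s = \<phi>\<^sup>s(u(s))\<close>, and \<open>p = \<epsilon> \<parallel>g(t)\<parallel>\<^sup>2\<close>,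
  \<open>r = 2/\<epsilon>\<close> come from Young's inequality. Writing \<open>k0 = K - \<integral> m\<close> turns the difference of the two sides into a combination of
  \<open>At\<close>, \<open>At - A s\<close> and \<open>bt\<close>, \<open>bt - b s\<close> with the nonnegative weights \<open>K\<close> and \<open>- m s\<close>.\<close>

lemma kernel_inequality:
  fixes m A b :: "real \<Rightarrow> real"
  assumes t: "0 < t" and m: "integrable (leb t) m" "AE s in leb t. m s \<le> 0"
    and mA: "integrable (leb t) (\<lambda>s. m s * A s)" and mb: "integrable (leb t) (\<lambda>s. m s * b s)"
    and K: "K = k0 + (LINT s|leb t. m s)" "0 \<le> K" and c: "0 \<le> c1" "0 \<le> c2" and pr: "0 \<le> p" "0 \<le> r"
    and N: "t * K + (LINT s|leb t. (t - s) * - m s) \<le> N"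
    and past: "AE s in leb t. bt - b s - c2 * (t - s) * (p + r * (1 + \<bar>b s\<bar>)) \<le> At - A s"
    and init: "bt - b0 - c1 * t * (p + r * (1 + \<bar>b0\<bar>)) \<le> At"
  shows "k0 * bt + (LINT s|leb t. m s * b s) - K * b0
     - 2 * (c1 + c2) * N * p - (c1 + c2) * r * N * (1 + \<bar>b0\<bar>)
     - (c1 + c2) * r * (LINT s|leb t. (t - s) * - m s * \<bar>b s\<bar>)
     \<le> k0 * At + (LINT s|leb t. m s * A s)"
proof -
  have ts: "(\<lambda>s. t - s) \<in> borel_measurable (leb t)" using borel_measurable_id_leb by auto
  have tm: "integrable (leb t) (\<lambda>s. (t - s) * - m s)"
    by (rule integrable_bounded_mult[OF _ ts, of _ t]) (use m in auto)
  have tmb: "integrable (leb t) (\<lambda>s. (t - s) * - m s * \<bar>b s\<bar>)"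
  proof -
    have i: "integrable (leb t) (\<lambda>s. (t - s) * \<bar>m s * b s\<bar>)"
      by (rule integrable_bounded_mult[OF _ ts, of _ t]) (use mb in auto)
    have ae: "AE s in leb t. (t - s) * - m s * \<bar>b s\<bar> = (t - s) * \<bar>m s * b s\<bar>"
      using m(2) by eventually_elim (simp add: abs_mult)
    have "(\<lambda>s. (t - s) * - m s * \<bar>b s\<bar>) \<in> borel_measurable (leb t)"
      by (rule complete_measure.measurable_cong_AE[OF complete_measure_leb borel_measurable_integrable[OF i] ae]) simp
    then show ?thesis
      by (rule integrable_cong_AE_imp[OF i]) (use ae in \<open>eventually_elim, simp\<close>)
  qed
  define J where "J = (LINT s|leb t. (t - s) * - m s)"
  define Q where "Q = (LINT s|leb t. (t - s) * - m s * \<bar>b s\<bar>)"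
  have J0: "0 \<le> J" unfolding J_def
    by (rule integral_nonneg_AE) (use m(2) AE_space in \<open>eventually_elim, auto simp: mult_nonneg_nonpos\<close>)
  have Q0: "0 \<le> Q" unfolding Q_def
    by (rule integral_nonneg_AE) (use m(2) AE_space in \<open>eventually_elim, auto simp: mult_nonneg_nonpos mult_nonpos_nonneg\<close>)
  have "(LINT s|leb t. - (c2 * (p + r)) * ((t - s) * - m s) - c2 * (r) * ((t - s) * - m s * \<bar>b s\<bar>))
      \<le> (LINT s|leb t. m s * A s - m s * At - m s * b s + m s * bt)"
  proof (rule integral_mono_AE)
    show "AE s in leb t. - (c2 * (p + r)) * ((t - s) * - m s) - c2 * (r) * ((t - s) * - m s * \<bar>b s\<bar>)
        \<le> m s * A s - m s * At - m s * b s + m s * bt"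
      using past m(2)
    proof eventually_elim
      case (elim s)
      have "- m s * (bt - b s - c2 * (t - s) * (p + r * (1 + \<bar>b s\<bar>))) \<le> - m s * (At - A s)"
        using elim by (intro mult_left_mono) auto
      then show ?case by (simp add: algebra_simps)
    qed
  qed (use m mA mb tm tmb in auto)
  also have "\<dots> = (LINT s|leb t. m s * A s) - (LINT s|leb t. m s) * At - (LINT s|leb t. m s * b s) + (LINT s|leb t. m s) * bt"
    using m mA mb by simp
  finally have 1: "- (c2 * (p + r)) * J - c2 * (r) * Q
     \<le> (LINT s|leb t. m s * A s) - (LINT s|leb t. m s) * At - (LINT s|leb t. m s * b s) + (LINT s|leb t. m s) * bt"
    using tm tmb by (simp add: J_def Q_def)
  have 2: "K * (bt - b0 - c1 * t * (p + r * (1 + \<bar>b0\<bar>))) \<le> K * At"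
    using init K(2) by (rule mult_left_mono)
  define V where "V = p + r * (1 + \<bar>b0\<bar>)"
  have prV: "0 \<le> p + r" "p + r \<le> V" using pr by (auto simp: V_def distrib_left)
  have tK: "0 \<le> t * K" using t K(2) by simp
  have NJ: "J \<le> N" "t * K \<le> N" "0 \<le> N" using N tK J0 by (auto simp: J_def)
  have 3: "c1 * (t * K) * V \<le> c1 * N * V"
    using c prV NJ by (intro mult_right_mono mult_left_mono) auto
  have 4: "c2 * (p + r) * J \<le> c2 * V * N"
    using c prV NJ J0 by (intro mult_mono mult_nonneg_nonneg order_refl) auto
  have 5: "c2 * r * Q \<le> (c1 + c2) * r * Q"
    using c Q0 pr by (intro mult_right_mono) auto
  have 6: "(c1 + c2) * N * V \<le> 2 * (c1 + c2) * N * p + (c1 + c2) * r * N * (1 + \<bar>b0\<bar>)"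
  proof -
    have "0 \<le> (c1 + c2) * N * p" using c NJ pr by simp
    moreover have "(c1 + c2) * N * V = (c1 + c2) * N * p + (c1 + c2) * r * N * (1 + \<bar>b0\<bar>)"
      by (simp add: V_def algebra_simps)
    ultimately show ?thesis by linarith
  qed
  have 2: "K * bt - K * b0 - c1 * (t * K) * V \<le> K * At"
    using 2 by (simp add: V_def algebra_simps)
  have k0: "k0 = K - (LINT s|leb t. m s)" using K by simp
  have 7: "(c1 + c2) * N * V = c1 * N * V + c2 * V * N" by (simp add: algebra_simps)
  have 1: "- (c2 * (p + r) * J) - c2 * r * Q
     \<le> (LINT s|leb t. m s * A s) - (LINT s|leb t. m s) * At - (LINT s|leb t. m s * b s) + (LINT s|leb t. m s) * bt"
    using 1 by (simp only: mult_minus_left)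
  show ?thesis
    unfolding Q_def[symmetric] unfolding k0 left_diff_distrib
    using 1 2 3 4 5 6 7 by linarith
qed

lemma mult_le_sum_squares:
  fixes x y :: real
  assumes "0 \<le> x" "0 \<le> y"
  shows "x * y \<le> x\<^sup>2 + y\<^sup>2"
proof -
  have "2 * (x * y) \<le> x\<^sup>2 + y\<^sup>2" using sum_squares_bound[of x y] by (simp add: mult.assoc)
  moreover have "0 \<le> x * y" using assms by simp
  ultimately show ?thesis by linarith
qed

lemma integrable_inner_L2:
  fixes w g :: "real \<Rightarrow> 'a::{real_inner, complete_space}"
  assumes w: "w \<in> L2 T" and g: "g \<in> L2 T"
  shows "integrable (leb T) (\<lambda>t. w t \<bullet> g t)"
proof (rule Bochner_Integration.integrable_bound)
  show "integrable (leb T) (\<lambda>t. (norm (w t))\<^sup>2 + (norm (g t))\<^sup>2)" using w g by (simp add: L2_def)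
  show "(\<lambda>t. w t \<bullet> g t) \<in> borel_measurable (leb T)"
    using w g by (intro borel_measurable_inner_Bochner complete_measure_leb) (auto simp: L2_def)
  show "AE t in leb T. norm (w t \<bullet> g t) \<le> norm ((norm (w t))\<^sup>2 + (norm (g t))\<^sup>2)"
  proof (rule AE_I2)
    fix t
    have "\<bar>w t \<bullet> g t\<bar> \<le> norm (w t) * norm (g t)" by (rule Cauchy_Schwarz_ineq2)
    also have "\<dots> \<le> (norm (w t))\<^sup>2 + (norm (g t))\<^sup>2"
      by (rule mult_le_sum_squares) simp_all
    finally show "norm (w t \<bullet> g t) \<le> norm ((norm (w t))\<^sup>2 + (norm (g t))\<^sup>2)" by simp
  qed
qed

text \<open>Young's inequality is applied under the convolution integral: with
  \<open>\<parallel>w(s)\<parallel> \<parallel>g(t)\<parallel> \<le> \<parallel>w(s)\<parallel>\<^sup>2 + \<parallel>g(t)\<parallel>\<^sup>2\<close> the integrand is dominated by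
  \<open>|a| * \<parallel>w\<parallel>\<^sup>2 + \<parallel>a\<parallel> \<parallel>g\<parallel>\<^sup>2\<close>, which is integrable.\<close>

lemma integrable_conv_inner_L2:
  fixes w g :: "real \<Rightarrow> 'a::{real_inner, complete_space}"
  assumes a: "integrable (leb T) a" and w: "w \<in> L2 T" and g: "g \<in> L2 T"
  shows "integrable (leb T) (\<lambda>t. conv a w t \<bullet> g t)"
proof -
  have Bw: "Bochner_integrable (leb T) w" and w2: "integrable (leb T) (\<lambda>t. (norm (w t))\<^sup>2)"
    and Bg: "Bochner_integrable (leb T) g" and g2: "integrable (leb T) (\<lambda>t. (norm (g t))\<^sup>2)"
    using w g by (auto simp: L2_def)
  have ia: "integrable (leb T) (\<lambda>s. \<bar>a s\<bar>)" using a by simp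
  define A where "A = (LINT s|leb T. \<bar>a s\<bar>)"
  have A0: "0 \<le> A" unfolding A_def by (rule integral_nonneg_AE) simp
  define C where "C t = (LINT s|leb t. \<bar>a (t - s)\<bar> * (norm (w s))\<^sup>2)" for t
  have C0: "0 \<le> C t" for t unfolding C_def by (rule integral_nonneg_AE) simp
  show ?thesis
  proof (rule Bochner_Integration.integrable_bound)
    show "integrable (leb T) (\<lambda>t. C t + A * (norm (g t))\<^sup>2)"
      using integrable_conv[OF ia w2] g2 by (simp add: C_def)
    show "(\<lambda>t. conv a w t \<bullet> g t) \<in> borel_measurable (leb T)"
      by (rule borel_measurable_inner_Bochner[OF complete_measure_leb Bochner_integrable_conv[OF a Bw] Bg])
    show "AE t in leb T. norm (conv a w t \<bullet> g t) \<le> norm (C t + A * (norm (g t))\<^sup>2)"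
      using AE_Bochner_integrable_conv[OF a Bw] AE_integrable_conv[OF ia Bochner_integrable_norm[OF Bw]]
        AE_integrable_conv[OF ia w2] AE_space
    proof eventually_elim
      case (elim t)
      then have t: "t \<le> T" by simp
      let ?n = "norm (g t)"
      note iat = integrable_leb_mono[OF ia t]
      have "norm (conv a w t) \<le> (LINT s|leb t. \<bar>a (t - s)\<bar> * norm (w s))"
        unfolding conv_def using norm_Bochner_integral_le[OF elim(1)] by simp
      then have "norm (conv a w t) * ?n \<le> (LINT s|leb t. \<bar>a (t - s)\<bar> * norm (w s)) * ?n"
        by (rule mult_right_mono) simp
      also have "\<dots> = (LINT s|leb t. \<bar>a (t - s)\<bar> * norm (w s) * ?n)" by simp
      also have "\<dots> \<le> (LINT s|leb t. \<bar>a (t - s)\<bar> * (norm (w s))\<^sup>2 + \<bar>a (t - s)\<bar> * ?n\<^sup>2)"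
      proof (rule integral_mono)
        fix s
        have "norm (w s) * ?n \<le> (norm (w s))\<^sup>2 + ?n\<^sup>2"
          by (rule mult_le_sum_squares) simp_all
        then have "\<bar>a (t - s)\<bar> * (norm (w s) * ?n) \<le> \<bar>a (t - s)\<bar> * ((norm (w s))\<^sup>2 + ?n\<^sup>2)"
          by (rule mult_left_mono) simp
        then show "\<bar>a (t - s)\<bar> * norm (w s) * ?n \<le> \<bar>a (t - s)\<bar> * (norm (w s))\<^sup>2 + \<bar>a (t - s)\<bar> * ?n\<^sup>2"
          by (simp add: algebra_simps)
      qed (use elim integrable_leb_reflect[OF iat] in auto)
      also have "\<dots> = C t + (LINT s|leb t. \<bar>a (t - s)\<bar>) * ?n\<^sup>2"
        using elim(3) integrable_leb_reflect[OF iat] by (simp add: C_def)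
      also have "(LINT s|leb t. \<bar>a (t - s)\<bar>) = (LINT s|leb t. \<bar>a s\<bar>)"
        by (rule integral_leb_reflect[OF iat])
      also have "C t + \<dots> * ?n\<^sup>2 \<le> C t + A * ?n\<^sup>2"
        unfolding A_def using integral_leb_abs_le[OF a t] by (intro add_left_mono mult_right_mono) auto
      finally have "norm (conv a w t) * ?n \<le> C t + A * ?n\<^sup>2" .
      moreover have "\<bar>conv a w t \<bullet> g t\<bar> \<le> norm (conv a w t) * ?n" by (rule Cauchy_Schwarz_ineq2)
      ultimately show ?case using C0[of t] A0 by simp
    qed
  qed
qed

lemma L1_ereal_integrable:
  assumes "f \<in> L1_ereal T"
  shows "integrable (leb T) (\<lambda>t. real_of_ereal (f t))"
proof (rule integrableI_bounded)
  show "(\<lambda>t. real_of_ereal (f t)) \<in> borel_measurable (leb T)"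
    using assms by (auto simp: L1_ereal_def intro: borel_measurable_real_of_ereal)
  have "(\<integral>\<^sup>+t. ennreal (norm (real_of_ereal (f t))) \<partial>leb T) \<le> (\<integral>\<^sup>+t. e2ennreal \<bar>f t\<bar> \<partial>leb T)"
  proof (rule nn_integral_mono)
    fix t show "ennreal (norm (real_of_ereal (f t))) \<le> e2ennreal \<bar>f t\<bar>"
      by (cases "f t") (simp_all add: e2ennreal_ereal)
  qed
  also have "\<dots> < \<infinity>" using assms by (simp add: L1_ereal_def)
  finally show "(\<integral>\<^sup>+t. ennreal (norm (real_of_ereal (f t))) \<partial>leb T) < \<infinity>" .
qed

lemma L2_diff_const:
  fixes u :: "real \<Rightarrow> 'a::{real_inner, complete_space}"
  assumes "u \<in> L2 T"
  shows "(\<lambda>t. u t - x) \<in> L2 T"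
proof -
  have u: "Bochner_integrable (leb T) u" and u2: "integrable (leb T) (\<lambda>t. (norm (u t))\<^sup>2)"
    using assms by (auto simp: L2_def)
  have c: "integrable (leb T) (\<lambda>_. c :: real)" for c by (rule finite_measure.integrable_const[OF finite_measure_leb])
  have B: "Bochner_integrable (leb T) (\<lambda>t. u t - x)"
    using Bochner_integrable_add[OF complete_measure_leb u Bochner_integrable_scaleR_const[OF c, of 1 "- x"]] by simp
  have "integrable (leb T) (\<lambda>t. (norm (u t - x))\<^sup>2)"
  proof (rule Bochner_Integration.integrable_bound)
    show "integrable (leb T) (\<lambda>t. 2 * (norm (u t))\<^sup>2 + 2 * (norm x)\<^sup>2)"
      by (intro Bochner_Integration.integrable_add integrable_mult_right u2 c)
    show "(\<lambda>t. (norm (u t - x))\<^sup>2) \<in> borel_measurable (leb T)"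
      using Bochner_integrable_norm[OF B] by auto
    show "AE t in leb T. norm ((norm (u t - x))\<^sup>2) \<le> norm (2 * (norm (u t))\<^sup>2 + 2 * (norm x)\<^sup>2)"
    proof (rule AE_I2)
      fix t
      have "(norm (u t - x))\<^sup>2 \<le> (norm (u t) + norm x)\<^sup>2"
        by (intro power_mono norm_triangle_ineq4) simp
      also have "\<dots> \<le> 2 * (norm (u t))\<^sup>2 + 2 * (norm x)\<^sup>2"
        using sum_squares_bound[of "norm (u t)" "norm x"] by (simp add: power2_sum)
      finally show "norm ((norm (u t - x))\<^sup>2) \<le> norm (2 * (norm (u t))\<^sup>2 + 2 * (norm x)\<^sup>2)" by simp
    qed
  qed
  with B show ?thesis by (simp add: L2_def)
qed

theorem lemma4p5:
  fixes T :: real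
    and \<phi> :: "real \<Rightarrow> 'a::{real_inner, complete_space} \<Rightarrow> ereal"
    and u\<^sub>0 :: 'a
  assumes "0 < T"
    and "\<And>t. t \<in> {0..T} \<Longrightarrow> proper (\<phi> t) \<and> lsc (\<phi> t) \<and> convex_functional (\<phi> t)"
    and "cond_A1 T \<phi>"
    and "cond_A2 T \<phi>"
    and "u\<^sub>0 \<in> Dom (\<phi> 0)"
  shows "\<exists>c\<ge>0. \<forall>k\<in>W11 T. \<forall>u\<in>L2 T. \<forall>g\<in>L2 T.
    nonneg_nonincreasing T k \<longrightarrow>
    (\<lambda>t. \<phi> t (u t)) \<in> L1_ereal T \<longrightarrow>
    (AE t in leb T. u t \<in> Dom_subdiff (\<phi> t) \<and> g t \<in> subdiff (\<phi> t) (u t)) \<longrightarrow>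
      conv k (\<lambda>s. u s - u\<^sub>0) \<in> W11 T \<and>
      conv k (\<lambda>s. rval \<phi> s (u s)) \<in> W11 T \<and>
      (\<forall>\<epsilon>\<in>{0<..<1}.
        (AE t in leb T.
           weak_deriv T (conv k (\<lambda>s. u s - u\<^sub>0)) t \<bullet> g t
           \<ge> weak_deriv T (conv k (\<lambda>s. rval \<phi> s (u s))) t
             - k t * rval \<phi> 0 u\<^sub>0
             - \<epsilon> * c * L1_norm T k * (norm (g t))\<^sup>2
             - c / \<epsilon> * L1_norm T k * (1 + \<bar>rval \<phi> 0 u\<^sub>0\<bar>)
             - c / \<epsilon> * (LINT s|leb t. (- s * weak_deriv T k s) * \<bar>rval \<phi> (t - s) (u (t - s))\<bar>)) \<and>
        (\<forall>t\<in>{0<..T}.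
           (LINT s|leb t. weak_deriv T (conv k (\<lambda>s. u s - u\<^sub>0)) s \<bullet> g s)
           \<ge> conv k (\<lambda>s. rval \<phi> s (u s)) t
             - rval \<phi> 0 u\<^sub>0 * (LINT s|leb t. k s)
             - \<epsilon> * c * L1_norm T k * (LINT s|leb t. (norm (g s))\<^sup>2)
             - c / \<epsilon> * t * L1_norm T k * (1 + \<bar>rval \<phi> 0 u\<^sub>0\<bar>)
             - c / \<epsilon> * L1_norm T k * (LINT s|leb t. \<bar>rval \<phi> s (u s)\<bar>)))"
proof -
  note T = assms(1)
  obtain c1 where c1: "0 \<le> c1" and A1: "\<And>s t z. s \<in> {0..T} \<Longrightarrow> t \<in> {0..T} \<Longrightarrow> s \<le> t \<Longrightarrow> z \<in> Dom (\<phi> s) \<Longrightarrow>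
       \<exists>z'\<in>Dom (\<phi> t). norm (z' - z) \<le> c1 * \<bar>t - s\<bar> * sqrt (1 + \<bar>rval \<phi> s z\<bar>) \<and>
          \<phi> t z' \<le> \<phi> s z + ereal (c1 * \<bar>t - s\<bar> * (1 + \<bar>rval \<phi> s z\<bar>))"
    using assms(3) unfolding cond_A1_def by blast
  obtain c2 where c2: "0 \<le> c2" and A2: "\<And>u t. u \<in> L2 T \<Longrightarrow> (\<lambda>t. \<phi> t (u t)) \<in> L1_ereal T \<Longrightarrow> t \<in> {0<..<T} \<Longrightarrow>
       \<exists>w\<in>L2 t. AE s in leb t. norm (w s - u s) \<le> c2 * \<bar>t - s\<bar> * sqrt (1 + \<bar>rval \<phi> s (u s)\<bar>) \<and>
          \<phi> t (w s) \<le> \<phi> s (u s) + ereal (c2 * \<bar>t - s\<bar> * (1 + \<bar>rval \<phi> s (u s)\<bar>))"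
    using assms(4) unfolding cond_A2_def by blast
  \<comment> \<open>The factor 2 comes from \<open>r = 2/\<epsilon>\<close> in \<open>kernel_inequality\<close>.\<close>
  define c where "c = 2 * (c1 + c2)"
  have c: "0 \<le> c" using c1 c2 by (simp add: c_def)
  define b0 where "b0 = rval \<phi> 0 u\<^sub>0"
  have proper: "proper (\<phi> t)" if "t \<in> {0..T}" for t using assms(2)[OF that] by blast
  have fin: "\<phi> t z = ereal (rval \<phi> t z)" if "t \<in> {0..T}" "z \<in> Dom (\<phi> t)" for t z
    using proper[OF that(1)] that(2) by (cases "\<phi> t z") (auto simp: proper_def Dom_def)
  show ?thesis
  proof (intro exI[of _ c] conjI[OF c] ballI impI)
    fix k u g
    assume kW: "k \<in> W11 T" and u: "u \<in> L2 T" and g: "g \<in> L2 T"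
      and mono: "nonneg_nonincreasing T k" and \<phi>u: "(\<lambda>t. \<phi> t (u t)) \<in> L1_ereal T"
      and sub: "AE t in leb T. u t \<in> Dom_subdiff (\<phi> t) \<and> g t \<in> subdiff (\<phi> t) (u t)"
    define k' where "k' = weak_deriv T k"
    define b where "b s = rval \<phi> s (u s)" for s
    define w where "w s = u s - u\<^sub>0" for s
    define N where "N = L1_norm T k"
    have dk: "has_weak_deriv T k k'"
      using kW someI_ex[of "has_weak_deriv T k"] by (simp add: W11_def k'_def weak_deriv_def)
    have ik: "integrable (leb T) k" and ik': "integrable (leb T) k'"
      using dk by (auto simp: has_weak_deriv_def Bochner_integrable_eq_library)
    obtain k0 where k0: "AE t in leb T. k t = k0 + (LINT s|leb t. k' s)"
      using W11_real_primitive[OF T dk] by blast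
    have kpos: "AE t in leb T. 0 \<le> k t" by (rule nonneg_nonincreasing_AE_nonneg[OF mono])
    have k'neg: "AE t in leb T. k' t \<le> 0" by (rule nonincreasing_AE_weak_deriv_nonpos[OF T dk mono])
    have N: "(LINT s|leb t. k s) \<le> N" if "t \<le> T" for t
    proof -
      have "(LINT s|leb t. k s) \<le> (LINT s|leb t. \<bar>k s\<bar>)"
        using integrable_leb_mono[OF ik that] by (intro integral_mono) auto
      then show ?thesis using integral_leb_abs_le[OF ik that] by (simp add: N_def L1_norm_def)
    qed
    have wL2: "w \<in> L2 T" unfolding w_def by (rule L2_diff_const[OF u])
    have Bw: "Bochner_integrable (leb T) w" using wL2 by (simp add: L2_def)
    have g2: "integrable (leb T) (\<lambda>t. (norm (g t))\<^sup>2)" using g by (simp add: L2_def)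
    have ib: "integrable (leb T) b" unfolding b_def by (rule L1_ereal_integrable[OF \<phi>u])
    have Bb: "Bochner_integrable (leb T) b" using ib by (simp add: Bochner_integrable_eq_library)
    have iab: "integrable (leb T) (\<lambda>s. \<bar>b s\<bar>)" using ib by simp
    have isk': "integrable (leb T) (\<lambda>s. - s * k' s)"
      using integral_primitive_eq(2)[OF ik'] by simp
    note Lw = weak_deriv_conv[OF ik' k0 ik Bw] and Lb = weak_deriv_conv[OF ik' k0 ik Bb]
    let ?L = "weak_deriv T (conv k w)" and ?P = "weak_deriv T (conv k b)"
    have iP: "integrable (leb T) ?P" using Lb(3) by (simp add: Bochner_integrable_eq_library)
    have iL: "integrable (leb T) (\<lambda>t. ?L t \<bullet> g t)"
    proof (rule integrable_cong_AE_imp)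
      show "integrable (leb T) (\<lambda>t. k0 * (w t \<bullet> g t) + conv k' w t \<bullet> g t)"
        using integrable_inner_L2[OF wL2 g] integrable_conv_inner_L2[OF ik' wL2 g] by simp
      show "(\<lambda>t. ?L t \<bullet> g t) \<in> borel_measurable (leb T)"
        using g by (intro borel_measurable_inner_Bochner complete_measure_leb Lw(3)) (simp add: L2_def)
      show "AE t in leb T. k0 * (w t \<bullet> g t) + conv k' w t \<bullet> g t = ?L t \<bullet> g t"
        using Lw(2) by eventually_elim (simp add: inner_add_left)
    qed
    have pointwise: "AE t in leb T. ?P t - k t * b0 - \<epsilon> * c * N * (norm (g t))\<^sup>2 - c / \<epsilon> * N * (1 + \<bar>b0\<bar>)
          - c / \<epsilon> * (LINT s|leb t. (- s * k' s) * \<bar>b (t - s)\<bar>) \<le> ?L t \<bullet> g t"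
      if \<epsilon>: "\<epsilon> \<in> {0<..<1}" for \<epsilon>
      using sub Lw(2) Lb(2) k0 kpos AE_Bochner_integrable_conv[OF ik' Bw] AE_integrable_conv[OF ik' ib]
        AE_integrable_conv[OF isk' iab] AE_space
    proof eventually_elim
      case (elim t)
      then have t: "0 < t" "t < T" and tT: "t \<in> {0..T}" by auto
      have ut: "u t \<in> Dom (\<phi> t)" and gt: "g t \<in> subdiff (\<phi> t) (u t)"
        using elim by (auto simp: Dom_subdiff_def)
      note ik't = integrable_leb_mono[OF ik' less_imp_le[OF t(2)]]
      let ?p = "\<epsilon> * (norm (g t))\<^sup>2" and ?r = "2 / \<epsilon>"
      have refl: "(LINT s|leb t. (t - s) * - k' (t - s) * \<bar>b s\<bar>) = (LINT s|leb t. (- s * k' s) * \<bar>b (t - s)\<bar>)"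
      proof -
        have "(LINT s|leb t. (t - s) * - k' (t - s) * \<bar>b s\<bar>) = (LINT s|leb t. - (t - s) * k' (t - s) * \<bar>b s\<bar>)"
          by (rule Bochner_Integration.integral_cong) (simp_all only: minus_mult_commute)
        also have "\<dots> = (LINT s|leb t. - (t - (t - s)) * k' (t - (t - s)) * \<bar>b (t - s)\<bar>)"
          by (rule integral_leb_reflect[OF elim(8), symmetric])
        finally show ?thesis by simp
      qed
      have "k0 * b t + (LINT s|leb t. k' (t - s) * b s) - k t * b0
          - 2 * (c1 + c2) * N * ?p - (c1 + c2) * ?r * N * (1 + \<bar>b0\<bar>)
          - (c1 + c2) * ?r * (LINT s|leb t. (t - s) * - k' (t - s) * \<bar>b s\<bar>)
         \<le> k0 * (w t \<bullet> g t) + (LINT s|leb t. k' (t - s) * (w s \<bullet> g t))"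
      proof (rule kernel_inequality[OF t(1)])
        show "integrable (leb t) (\<lambda>s. k' (t - s))" by (rule integrable_leb_reflect[OF ik't])
        have "AE x in lborel. x \<in> {0<..<t} \<longrightarrow> k' x \<le> 0"
          using AE_leb_mono[OF k'neg less_imp_le[OF t(2)]] by (simp only: AE_leb_iff)
        from AE_lborel_reflect[OF this, of t]
        show "AE s in leb t. k' (t - s) \<le> 0" unfolding AE_leb_iff by eventually_elim auto
        show "integrable (leb t) (\<lambda>s. k' (t - s) * (w s \<bullet> g t))" by (rule conv_inner_left(1)[OF elim(6)])
        show "integrable (leb t) (\<lambda>s. k' (t - s) * b s)" by (rule elim(7))
        show "k t = k0 + (LINT s|leb t. k' (t - s))"
          unfolding integral_leb_reflect[OF ik't] by (rule elim(4))
        show "0 \<le> k t" by (rule elim(5))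
        show "0 \<le> c1" "0 \<le> c2" by fact+
        show "0 \<le> ?p" "0 \<le> ?r" using \<epsilon> by auto
        have "integrable (leb t) (\<lambda>s. s * - k' s)"
          using integral_primitive_eq(2)[OF ik't] by simp
        from integral_leb_reflect[OF this]
        have "t * k t + (LINT s|leb t. (t - s) * - k' (t - s)) = (LINT s|leb t. k s)"
          using integral_kernel_identity[OF ik't AE_leb_mono[OF k0] integrable_leb_mono[OF ik]] t elim(4)
          by simp
        then show "t * k t + (LINT s|leb t. (t - s) * - k' (t - s)) \<le> N" using N t by simp
      next
        obtain v where "AE s in leb t. norm (v s - u s) \<le> c2 * \<bar>t - s\<bar> * sqrt (1 + \<bar>rval \<phi> s (u s)\<bar>) \<and>
          \<phi> t (v s) \<le> \<phi> s (u s) + ereal (c2 * \<bar>t - s\<bar> * (1 + \<bar>rval \<phi> s (u s)\<bar>))"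
          using A2[OF u \<phi>u] t by (meson greaterThanLessThan_iff)
        with AE_leb_mono[OF sub less_imp_le[OF t(2)]] AE_space
        show "AE s in leb t. b t - b s - c2 * (t - s) * (?p + ?r * (1 + \<bar>b s\<bar>)) \<le> w t \<bullet> g t - w s \<bullet> g t"
        proof eventually_elim
          case (elim s)
          then have s: "s < t" "s \<in> {0..T}" using t by auto
          have bs: "\<phi> s (u s) = ereal (b s)"
            unfolding b_def using elim by (intro fin s) (auto simp: Dom_subdiff_def)
          have v: "norm (v s - u s) \<le> c2 * (t - s) * sqrt (1 + \<bar>b s\<bar>)"
            "\<phi> t (v s) \<le> ereal (b s + c2 * (t - s) * (1 + \<bar>b s\<bar>))"
            using elim s by (simp_all add: bs)
          have "b t - b s - c2 * (t - s) * (?p + ?r * (1 + \<bar>b s\<bar>)) \<le> (u t - u s) \<bullet> g t"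
            unfolding b_def[of t]
            by (rule subdiff_perturbed_bound[OF proper[OF tT] ut gt v]) (use s \<epsilon> c2 in auto)
          then show ?case by (simp add: w_def inner_diff_left)
        qed
        obtain z where z: "norm (z - u\<^sub>0) \<le> c1 * \<bar>t - 0\<bar> * sqrt (1 + \<bar>rval \<phi> 0 u\<^sub>0\<bar>)"
          "\<phi> t z \<le> \<phi> 0 u\<^sub>0 + ereal (c1 * \<bar>t - 0\<bar> * (1 + \<bar>rval \<phi> 0 u\<^sub>0\<bar>))"
          using A1[OF _ tT _ assms(5)] T t by auto
        have b0: "\<phi> 0 u\<^sub>0 = ereal b0" unfolding b0_def using T by (intro fin assms(5)) auto
        have z': "norm (z - u\<^sub>0) \<le> c1 * t * sqrt (1 + \<bar>b0\<bar>)" "\<phi> t z \<le> ereal (b0 + c1 * t * (1 + \<bar>b0\<bar>))"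
          using z t by (simp_all add: b0)
        show "b t - b0 - c1 * t * (?p + ?r * (1 + \<bar>b0\<bar>)) \<le> w t \<bullet> g t"
          unfolding b_def[of t] w_def
          by (rule subdiff_perturbed_bound[OF proper[OF tT] ut gt z']) (use t \<epsilon> c1 in auto)
      qed
      then have "k0 * b t + (LINT s|leb t. k' (t - s) * b s) - k t * b0 - \<epsilon> * c * N * (norm (g t))\<^sup>2 - c / \<epsilon> * N * (1 + \<bar>b0\<bar>)
          - c / \<epsilon> * (LINT s|leb t. (- s * k' s) * \<bar>b (t - s)\<bar>)
         \<le> k0 * (w t \<bullet> g t) + (LINT s|leb t. k' (t - s) * (w s \<bullet> g t))"
        unfolding refl by (simp add: c_def mult_ac)
      then show ?case
        unfolding elim(2,3) by (simp add: inner_add_left conv_inner_left(2)[OF elim(6)] conv_real)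
    qed
    have integrated: "conv k b t - b0 * (LINT s|leb t. k s) - \<epsilon> * c * N * (LINT s|leb t. (norm (g s))\<^sup>2)
          - c / \<epsilon> * t * N * (1 + \<bar>b0\<bar>) - c / \<epsilon> * N * (LINT s|leb t. \<bar>b s\<bar>) \<le> (LINT s|leb t. ?L s \<bullet> g s)"
      if \<epsilon>: "\<epsilon> \<in> {0<..<1}" and t: "t \<in> {0<..T}" for \<epsilon> t
    proof -
      have tT: "t \<le> T" and t0: "0 \<le> t" using t by auto
      note mono = integrable_leb_mono[OF _ tT]
      \<comment> \<open>The memory term, reflected into the form of the convolution of \<open>- q k'(q)\<close> with \<open>|b|\<close>, to which
        Fubini's theorem applies.\<close>
      define Q where "Q r = (LINT s|leb r. (- (r - s) * k' (r - s)) * \<bar>b s\<bar>)" for r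
      have iQ: "integrable (leb t) Q"
        unfolding Q_def by (rule integrable_conv[OF mono[OF isk'] mono[OF iab]])
      have "(LINT r|leb t. Q r) = (LINT s|leb t. (LINT q|leb (t - s). - q * k' q) * \<bar>b s\<bar>)"
        unfolding Q_def by (rule integral_conv_full[OF mono[OF isk'] mono[OF iab]])
      also have "\<dots> \<le> (LINT s|leb t. N * \<bar>b s\<bar>)"
      proof (rule integral_mono_AE')
        show "integrable (leb t) (\<lambda>s. N * \<bar>b s\<bar>)" using mono[OF iab] by simp
        have "0 \<le> N" by (auto simp: N_def L1_norm_def intro: integral_nonneg_AE)
        then show "AE s in leb t. 0 \<le> N * \<bar>b s\<bar>" by simp
        show "AE s in leb t. (LINT q|leb (t - s). - q * k' q) * \<bar>b s\<bar> \<le> N * \<bar>b s\<bar>"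
        proof -
          have "AE x in lborel. x \<in> {0<..<t} \<longrightarrow> k x = k0 + (LINT s|leb x. k' s) \<and> 0 \<le> k x"
            using AE_conjI[OF AE_leb_mono[OF k0 tT] AE_leb_mono[OF kpos tT]] by (simp only: AE_leb_iff)
          from AE_lborel_reflect[OF this, of t]
          have "AE s in leb t. k (t - s) = k0 + (LINT q|leb (t - s). k' q) \<and> 0 \<le> k (t - s)"
            unfolding AE_leb_iff by eventually_elim auto
          with AE_space show ?thesis
          proof eventually_elim
            case (elim s)
            then have s: "0 \<le> t - s" "t - s \<le> T" using tT by auto
            have "(t - s) * k (t - s) + (LINT q|leb (t - s). q * - k' q) = (LINT q|leb (t - s). k q)"
              using integral_kernel_identity[OF integrable_leb_mono[OF ik' s(2)] AE_leb_mono[OF k0 s(2)] integrable_leb_mono[OF ik s(2)] s(1)] elim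
              by simp
            moreover have "0 \<le> (t - s) * k (t - s)" using s elim by simp
            ultimately have "(LINT q|leb (t - s). - q * k' q) \<le> N" using N[OF s(2)] by simp
            then show ?case by (rule mult_right_mono) simp
          qed
        qed
      qed
      also have "\<dots> = N * (LINT s|leb t. \<bar>b s\<bar>)" by simp
      finally have Qle: "(LINT r|leb t. Q r) \<le> N * (LINT s|leb t. \<bar>b s\<bar>)" .
      have Pint: "(LINT s|leb t. ?P s) = conv k b t"
      proof -
        have "conv k b t = (LINT r|leb t. k0 * b r + (LINT s|leb r. k' (r - s) * b s))"
          unfolding conv_real by (rule conv_eq_integral[OF ik' k0 ik ib tT])
        also have "\<dots> = (LINT s|leb t. ?P s)"
        proof (rule integral_cong_AE)
          show "AE r in leb t. k0 * b r + (LINT s|leb r. k' (r - s) * b s) = ?P r"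
            using AE_leb_mono[OF Lb(2) tT] by eventually_elim (simp add: conv_real)
          show "(\<lambda>r. k0 * b r + (LINT s|leb r. k' (r - s) * b s)) \<in> borel_measurable (leb t)"
            using mono[OF ib] integrable_conv[OF mono[OF ik'] mono[OF ib]] by auto
        qed (use mono[OF iP] in auto)
        finally show ?thesis by simp
      qed
      have const: "integrable (leb t) (\<lambda>_. x :: real)" for x
        by (rule finite_measure.integrable_const[OF finite_measure_leb])
      have ineq: "AE s in leb t. ?P s - k s * b0 - \<epsilon> * c * N * (norm (g s))\<^sup>2 - c / \<epsilon> * N * (1 + \<bar>b0\<bar>) - c / \<epsilon> * Q s \<le> ?L s \<bullet> g s"
        using AE_leb_mono[OF pointwise[OF \<epsilon>] tT] AE_leb_mono[OF AE_integrable_conv[OF isk' iab] tT]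
      proof eventually_elim
        case (elim s)
        have "Q s = (LINT r|leb s. (- r * k' r) * \<bar>b (s - r)\<bar>)"
          unfolding Q_def using integral_leb_reflect[OF elim(2)] by simp
        with elim(1) show ?case by simp
      qed
      have "(LINT s|leb t. ?P s - k s * b0 - \<epsilon> * c * N * (norm (g s))\<^sup>2 - c / \<epsilon> * N * (1 + \<bar>b0\<bar>) - c / \<epsilon> * Q s)
          \<le> (LINT s|leb t. ?L s \<bullet> g s)"
        by (rule integral_mono_AE[OF _ mono[OF iL] ineq])
           (intro Bochner_Integration.integrable_diff integrable_mult_left integrable_mult_right const mono[OF iP] mono[OF ik] mono[OF g2] iQ)
      also have "(LINT s|leb t. ?P s - k s * b0 - \<epsilon> * c * N * (norm (g s))\<^sup>2 - c / \<epsilon> * N * (1 + \<bar>b0\<bar>) - c / \<epsilon> * Q s)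
          = conv k b t - (LINT s|leb t. k s) * b0 - \<epsilon> * c * N * (LINT s|leb t. (norm (g s))\<^sup>2)
            - t * (c / \<epsilon> * N * (1 + \<bar>b0\<bar>)) - c / \<epsilon> * (LINT s|leb t. Q s)"
        using mono[OF iP] mono[OF ik] mono[OF g2] iQ const
        by (simp only: Bochner_Integration.integral_diff Bochner_Integration.integrable_diff integrable_mult_left
            integrable_mult_right integral_mult_left_zero integral_mult_right_zero integral_leb_const[OF t0] Pint)
      finally have "conv k b t - (LINT s|leb t. k s) * b0 - \<epsilon> * c * N * (LINT s|leb t. (norm (g s))\<^sup>2)
            - t * (c / \<epsilon> * N * (1 + \<bar>b0\<bar>)) - c / \<epsilon> * (LINT s|leb t. Q s) \<le> (LINT s|leb t. ?L s \<bullet> g s)" .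
      moreover have "c / \<epsilon> * (LINT s|leb t. Q s) \<le> c / \<epsilon> * (N * (LINT s|leb t. \<bar>b s\<bar>))"
        using Qle c \<epsilon> by (intro mult_left_mono) auto
      ultimately show ?thesis by (simp add: mult_ac)
    qed
    have eqs: "(\<lambda>s. u s - u\<^sub>0) = w" "(\<lambda>s. rval \<phi> s (u s)) = b" by (auto simp: w_def b_def)
    show "conv k (\<lambda>s. u s - u\<^sub>0) \<in> W11 T \<and> conv k (\<lambda>s. rval \<phi> s (u s)) \<in> W11 T \<and>
      (\<forall>\<epsilon>\<in>{0<..<1}.
        (AE t in leb T.
           weak_deriv T (conv k (\<lambda>s. u s - u\<^sub>0)) t \<bullet> g t
           \<ge> weak_deriv T (conv k (\<lambda>s. rval \<phi> s (u s))) t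
             - k t * rval \<phi> 0 u\<^sub>0
             - \<epsilon> * c * L1_norm T k * (norm (g t))\<^sup>2
             - c / \<epsilon> * L1_norm T k * (1 + \<bar>rval \<phi> 0 u\<^sub>0\<bar>)
             - c / \<epsilon> * (LINT s|leb t. (- s * weak_deriv T k s) * \<bar>rval \<phi> (t - s) (u (t - s))\<bar>)) \<and>
        (\<forall>t\<in>{0<..T}.
           (LINT s|leb t. weak_deriv T (conv k (\<lambda>s. u s - u\<^sub>0)) s \<bullet> g s)
           \<ge> conv k (\<lambda>s. rval \<phi> s (u s)) t
             - rval \<phi> 0 u\<^sub>0 * (LINT s|leb t. k s)
             - \<epsilon> * c * L1_norm T k * (LINT s|leb t. (norm (g s))\<^sup>2)
             - c / \<epsilon> * t * L1_norm T k * (1 + \<bar>rval \<phi> 0 u\<^sub>0\<bar>)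
             - c / \<epsilon> * L1_norm T k * (LINT s|leb t. \<bar>rval \<phi> s (u s)\<bar>)))"
      unfolding eqs b_def[symmetric] b0_def[symmetric] k'_def[symmetric] N_def[symmetric]
      by (intro conjI ballI Lw(1) Lb(1) pointwise integrated)
  qed
qed

end
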